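(* Let $f:\mathbb{R}_{>0}\to\mathbb{R}$ be continuous and non-decreasing with $f(t)<1$ for all $t$. Then the set $T(f)=\{\Lambda\in X: a_t\Lambda\in\mathcal{K}(f(t))\text{ for an unbounded set of }t>0\}$ has full Haar measure if $\int(1-f(t))\,dt$ diverges and zero Haar measure if it converges.
   Context: $X$ is the space of unimodular lattices in $\mathbb{R}^2$ with Haar (invariant probability) measure; $a_t=\operatorname{diag}(e^t,e^{-t})$; $\Delta=\sqrt3/2$; $\mathcal{K}(r)=\{\Lambda\in X:\Lambda$ has no nonzero vector of Euclidean norm $<r/\sqrt\Delta\}$ (so $\mathcal{K}(r)=X$ for $r\le0$). *)

theory Defs
  imports "HOL-Probability.Probability"
begin

definition SL2 :: "(real^2^2) set" where
  "SL2 = {g. det g = 1}"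

definition int_lattice :: "(real^2) set" where
  "int_lattice = {z. \<forall>i. z $ i \<in> \<int>}"

definition act :: "real^2^2 \<Rightarrow> (real^2) set \<Rightarrow> (real^2) set" where
  "act g \<Lambda> = (\<lambda>v. g *v v) ` \<Lambda>"

text \<open>A lattice with basis the columns of \<^term>\<open>g\<close> has covolume \<^term>\<open>\<bar>det g\<bar>\<close>.\<close>

definition unimodular_lattices :: "(real^2) set set" where
  "unimodular_lattices = {act g int_lattice | g. \<bar>det g\<bar> = 1}"

text \<open>The quotient topology of the orbit map \<open>g \<mapsto> g \<int>\<^sup>2\<close> on \<open>SL\<^sub>2(\<real>)\<close>,
  that is, of \<open>SL\<^sub>2(\<real>) / SL\<^sub>2(\<int>)\<close>; see \<open>quotient_map_orbit\<close> below.\<close>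

definition lattice_topology :: "(real^2) set topology" where
  "lattice_topology = topology (\<lambda>U. U \<subseteq> unimodular_lattices \<and>
     openin (top_of_set SL2) {g \<in> SL2. act g int_lattice \<in> U})"

lemma openin_lattice_topology:
  "openin lattice_topology U \<longleftrightarrow> U \<subseteq> unimodular_lattices \<and>
     openin (top_of_set SL2) {g \<in> SL2. act g int_lattice \<in> U}"
proof -
  let ?P = "\<lambda>U. {g \<in> SL2. act g int_lattice \<in> U}"
  have "istopology (\<lambda>U. U \<subseteq> unimodular_lattices \<and> openin (top_of_set SL2) (?P U))"
    unfolding istopology_def
  proof (intro conjI allI impI)
    fix S T
    assume a: "S \<subseteq> unimodular_lattices \<and> openin (top_of_set SL2) (?P S)"
      and b: "T \<subseteq> unimodular_lattices \<and> openin (top_of_set SL2) (?P T)"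
    show "S \<inter> T \<subseteq> unimodular_lattices" using a by blast
    have "?P (S \<inter> T) = ?P S \<inter> ?P T" by blast
    moreover have "openin (top_of_set SL2) (?P S \<inter> ?P T)"
      using a b by (intro openin_Int) simp_all
    ultimately show "openin (top_of_set SL2) (?P (S \<inter> T))" by (simp only:)
  next
    fix \<K>
    assume a: "\<forall>K\<in>\<K>. K \<subseteq> unimodular_lattices \<and> openin (top_of_set SL2) (?P K)"
    then show "\<Union>\<K> \<subseteq> unimodular_lattices" by blast
    have "?P (\<Union>\<K>) = (\<Union>K\<in>\<K>. ?P K)" by blast
    moreover have "openin (top_of_set SL2) (\<Union>K\<in>\<K>. ?P K)"
      using a by (intro openin_Union) (auto simp only: image_iff)
    ultimately show "openin (top_of_set SL2) (?P (\<Union>\<K>))" by (simp only:)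
  qed
  then show ?thesis
    by (simp only: lattice_topology_def topology_inverse')
qed

lemma unimodular_lattices_eq_orbit:
  "unimodular_lattices = (\<lambda>g. act g int_lattice) ` SL2"
proof
  show "(\<lambda>g. act g int_lattice) ` SL2 \<subseteq> unimodular_lattices"
    by (auto simp: unimodular_lattices_def SL2_def)
  show "unimodular_lattices \<subseteq> (\<lambda>g. act g int_lattice) ` SL2"
  proof
    fix \<Lambda> assume "\<Lambda> \<in> unimodular_lattices"
    then obtain g where g: "\<Lambda> = act g int_lattice" "\<bar>det g\<bar> = 1"
      by (auto simp: unimodular_lattices_def)
    show "\<Lambda> \<in> (\<lambda>g. act g int_lattice) ` SL2"
    proof (cases "det g = 1")
      case True
      then show ?thesis using g by (auto simp: SL2_def)
    next
      case False
      define s :: "real^2^2" where "s = vector [vector [1, 0], vector [0, -1]]"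
      have sv: "s *v z = vector [z $ 1, - z $ 2]" for z
        by (simp add: s_def vec_eq_iff forall_2 matrix_vector_mult_def sum_2)
      have inv: "s *v (s *v z) = z" for z
        by (simp add: sv vec_eq_iff forall_2)
      have mem: "s *v z \<in> int_lattice" if "z \<in> int_lattice" for z
        using that by (simp add: sv int_lattice_def forall_2)
      have "act s int_lattice = int_lattice"
        unfolding act_def using mem inv by (metis image_subsetI subset_antisym subsetI image_eqI)
      moreover have "act (g ** s) int_lattice = act g (act s int_lattice)"
        by (simp add: act_def image_image matrix_vector_mul_assoc)
      ultimately have "act (g ** s) int_lattice = \<Lambda>"
        by (simp add: g)
      moreover have "det (g ** s) = 1"
      proof -
        have "det s = -1" by (simp add: s_def det_2)
        moreover have "det g = -1" using g(2) False by linarith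
        ultimately show ?thesis by (metis det_mul mult_minus1 minus_minus)
      qed
      ultimately show ?thesis by (auto simp: SL2_def)
    qed
  qed
qed

lemma topspace_lattice_topology: "topspace lattice_topology = unimodular_lattices"
proof -
  have "{g \<in> SL2. act g int_lattice \<in> unimodular_lattices} = SL2"
    by (auto simp: unimodular_lattices_def SL2_def)
  then have "openin lattice_topology unimodular_lattices"
    by (simp add: openin_lattice_topology)
  moreover have "topspace lattice_topology \<subseteq> unimodular_lattices"
    using openin_topspace[of lattice_topology] by (simp only: openin_lattice_topology)
  ultimately show ?thesis
    by (intro subset_antisym openin_subset)
qed

lemma quotient_map_orbit:
  "quotient_map (top_of_set SL2) lattice_topology (\<lambda>g. act g int_lattice)"
proof -
  have 1: "(\<lambda>g. act g int_lattice) ` SL2 = unimodular_lattices"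
    by (rule unimodular_lattices_eq_orbit[symmetric])
  have 2: "openin (top_of_set SL2) {x \<in> SL2. act x int_lattice \<in> U} = openin lattice_topology U"
    if "U \<subseteq> unimodular_lattices" for U
    using that by (simp add: openin_lattice_topology)
  show ?thesis
    unfolding quotient_map_def topspace_lattice_topology topspace_euclidean_subtopology
    by (intro conjI allI impI 1 2)
qed

text \<open>The \<open>SL\<^sub>2(\<real>)\<close>-invariant Borel probability measure on the space of lattices
  is unique, so the predicate characterises the Haar measure.\<close>

definition is_haar_measure :: "(real^2) set measure \<Rightarrow> bool" where
  "is_haar_measure M \<longleftrightarrow>
     prob_space M \<and>
     space M = unimodular_lattices \<and>
     sets M = sigma_sets unimodular_lattices {U. openin lattice_topology U} \<and>
     (\<forall>g\<in>SL2. \<forall>A\<in>sets M. emeasure M (act g ` A) = emeasure M A)"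

definition diag_flow :: "real \<Rightarrow> real^2^2" where
  "diag_flow t = vector [vector [exp t, 0], vector [0, exp (- t)]]"

definition \<Delta> :: real where
  "\<Delta> = sqrt 3 / 2"

definition \<K> :: "real \<Rightarrow> (real^2) set set" where
  "\<K> r = {\<Lambda> \<in> unimodular_lattices. \<not> (\<exists>v\<in>\<Lambda>. v \<noteq> 0 \<and> norm v < r / sqrt \<Delta>)}"

definition T_set :: "(real \<Rightarrow> real) \<Rightarrow> (real^2) set set" where
  "T_set f = {\<Lambda> \<in> unimodular_lattices.
     \<not> bounded {t. t > 0 \<and> act (diag_flow t) \<Lambda> \<in> \<K> (f t)}}"

end

theory Submission
  imports Defs
begin

text \<open>
  The stronger assertion proved is that for \<^emph>\<open>every\<close> unimodular lattice \<open>\<Lambda>\<close> the sheared lattice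
  \<open>u\<^sub>x \<Lambda>\<close>, where \<open>u\<^sub>x (X, Y) = (X + xY, Y)\<close>, lies in \<open>T_set f\<close> for almost every, respectively
  almost no, real \<open>x\<close>; Fubini and invariance of the measure under \<open>u\<^sub>x\<close> then give the theorem.

  With \<open>z = x + \<i> exp (-2t)\<close> the lattice \<open>a\<^sub>t u\<^sub>x \<Lambda>\<close> is, up to rotation and scaling,
  \<open>{X + zY | (X, Y) \<in> \<Lambda>}\<close>. It lies in \<open>\<K> 1\<close> exactly at the discrete set of points \<open>z\<close> where it is
  hexagonal, and it lies in \<open>\<K> (1 - \<psi>)\<close> only within hyperbolic distance \<open>O(\<psi>)\<close> of such a point;
  conversely \<open>\<bar>x - Re w\<bar> \<le> \<psi> Im w\<close> with \<open>w\<close> hexagonal suffices at height \<open>Im w\<close>. Hence \<open>T_set f\<close>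
  is governed by the approximation of \<open>x\<close> by real parts of hexagonal points \<open>w\<close> up to \<open>Im w (1 - f t)\<close>.
  A box of side \<open>h\<close> at height \<open>h\<close> contains boundedly many hexagonal points, which settles the
  convergence case by the Borel-Cantelli lemma. In the divergence case, at least half of the cells of
  a grid of mesh \<open>h\<close> contain the real part of a hexagonal point at height comparable to \<open>h\<close>, because
  \<open>a\<^sub>t u\<^sub>x \<Lambda>\<close> stays out of the cusp for most \<open>x\<close>. The resulting intervals are quasi-independent at
  different scales, so that their limsup set fills a fixed proportion of every interval, and a set
  with this property is conull.
\<close>

section \<open>Reduced bases and hexagonal points\<close>

text \<open>With this normalisation \<open>1 / \<Delta>\<close> is the largest possible squared
  length of a shortest vector of a unimodular lattice, attained by the hexagonal ones alone. Up to
  rotation the target is thus a point when \<open>f\<close> is close to 1, and its orbit has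
  codimension two in X: a neighbourhood of radius \<psi> has measure of order
  \<open>\<psi>^2\<close>. The integral nevertheless carries the first power of
  \<open>1 - f\<close>, because time is continuous: a passage lasts a time of order \<psi>, so
  passages occur at rate \<psi>. In the half-plane the time absorbs the condition on
  \<open>Im z\<close> and leaves one condition on \<open>Re z\<close>; it must be an interval of
  relative length linear in \<psi>, as a bound of order \<open>sqrt \<psi>\<close> would change the
  criterion. Quasi-independence gives only a positive proportion. Having the same proportion in
  every interval, for an arbitrary lattice, takes the place of a zero-one law. A separate obstacle
  is measurability: \<open>T_set f\<close> quantifies over uncountably many times, and Fubini needs
  a set that is measurable jointly in the shear and the lattice.\<close>

lemma Delta_facts: "\<Delta> > 0" "\<Delta>\<^sup>2 = 3/4" "\<Delta> \<le> 1"
proof -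
  show "\<Delta> > 0" "\<Delta>\<^sup>2 = 3/4" by (simp_all add: \<Delta>_def power_divide)
  show "\<Delta> \<le> 1" using real_sqrt_le_mono[of 3 4] by (simp add: \<Delta>_def)
qed

text \<open>Gauss reduction by minimising the sum of the squared lengths over all bases of
  determinant one: replacing one vector by its sum or difference with the other cannot lower that
  sum, which bounds the inner product from both sides. If the inner product is negative,
  \<open>(B, - A)\<close> has the opposite sign and the same determinant.\<close>

lemma reduced_basis:
  fixes \<alpha> \<beta> :: complex
  assumes pos: "Im (cnj \<alpha> * \<beta>) > 0"
  obtains m n m' n' :: int where "m * n' - n * m' = 1"
    "0 \<le> Re (cnj (of_int m * \<alpha> + of_int n * \<beta>) * (of_int m' * \<alpha> + of_int n' * \<beta>))"
    "2 * Re (cnj (of_int m * \<alpha> + of_int n * \<beta>) * (of_int m' * \<alpha> + of_int n' * \<beta>))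
       \<le> (cmod (of_int m * \<alpha> + of_int n * \<beta>))\<^sup>2"
    "2 * Re (cnj (of_int m * \<alpha> + of_int n * \<beta>) * (of_int m' * \<alpha> + of_int n' * \<beta>))
       \<le> (cmod (of_int m' * \<alpha> + of_int n' * \<beta>))\<^sup>2"
proof -
  define l :: "int \<Rightarrow> int \<Rightarrow> complex" where "l m n = of_int m * \<alpha> + of_int n * \<beta>" for m n
  define E where "E = (\<lambda>(m, n, m', n'). (cmod (l m n))\<^sup>2 + (cmod (l m' n'))\<^sup>2)"
  define R where "R = (cmod \<alpha>)\<^sup>2 + (cmod \<beta>)\<^sup>2"
  define y where "y = Im (cnj \<alpha> * \<beta>)"
  define S where "S = {(m, n, m', n'). m * n' - n * m' = 1 \<and> E (m, n, m', n') \<le> R}"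
  \<comment> \<open>The area spanned with \<beta> or \<alpha> reads off a coordinate, so vectors of
    bounded length have bounded coordinates and \<open>S\<close> is finite.\<close>
  have coord: "Im (cnj (l m n) * \<beta>) = of_int m * y" "Im (cnj \<alpha> * l m n) = of_int n * y" for m n
    by (simp_all add: l_def y_def algebra_simps)
  define k where "k = \<lceil>R / y\<rceil>"
  have bnd: "\<bar>m\<bar> \<le> k \<and> \<bar>n\<bar> \<le> k" if "(cmod (l m n))\<^sup>2 \<le> R" for m n
  proof -
    have R: "cmod (l m n) \<le> sqrt R" "cmod \<alpha> \<le> sqrt R" "cmod \<beta> \<le> sqrt R"
      using that by (auto simp: R_def intro!: real_le_rsqrt)
    have R0: "R \<ge> 0" by (simp add: R_def)
    have "\<bar>of_int m * y\<bar> \<le> cmod (l m n) * cmod \<beta>"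
      using abs_Im_le_cmod[of "cnj (l m n) * \<beta>"] coord(1)[of m n] by (simp add: norm_mult)
    also have "\<dots> \<le> sqrt R * sqrt R" using R R0 by (intro mult_mono) auto
    finally have 1: "\<bar>of_int m * y\<bar> \<le> R" using R0 by simp
    have "\<bar>of_int n * y\<bar> \<le> cmod \<alpha> * cmod (l m n)"
      using abs_Im_le_cmod[of "cnj \<alpha> * l m n"] coord(2)[of m n] by (simp add: norm_mult)
    also have "\<dots> \<le> sqrt R * sqrt R" using R R0 by (intro mult_mono) auto
    finally have 2: "\<bar>of_int n * y\<bar> \<le> R" using R0 by simp
    have "y > 0" using pos by (simp add: y_def)
    then have "of_int \<bar>m\<bar> \<le> R / y" "of_int \<bar>n\<bar> \<le> R / y"
      using 1 2 by (simp_all add: abs_mult field_simps)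
    then show ?thesis unfolding k_def by linarith
  qed
  have "S \<subseteq> {-k..k} \<times> {-k..k} \<times> {-k..k} \<times> {-k..k}"
  proof
    fix s assume "s \<in> S"
    then obtain m n m' n' where s: "s = (m, n, m', n')" and e: "E (m, n, m', n') \<le> R"
      by (auto simp: S_def)
    have "(cmod (l m n))\<^sup>2 \<le> R" "(cmod (l m' n'))\<^sup>2 \<le> R"
      using e zero_le_power2[of "cmod (l m n)"] zero_le_power2[of "cmod (l m' n')"]
      unfolding E_def prod.case by linarith+
    from this[THEN bnd] show "s \<in> {-k..k} \<times> {-k..k} \<times> {-k..k} \<times> {-k..k}" by (auto simp: s)
  qed
  then have fin: "finite S" by (rule finite_subset) auto
  have "(1, 0, 0, 1) \<in> S" by (simp add: S_def E_def R_def l_def)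
  then have "S \<noteq> {}" by auto
  from arg_min_if_finite(1)[OF fin this, of E] arg_min_least[OF fin this, of _ E]
  obtain s where s: "s \<in> S" and min: "\<And>s'. s' \<in> S \<Longrightarrow> E s \<le> E s'" by auto
  obtain m n m' n' where s_eq: "s = (m, n, m', n')" by (cases s) auto
  have det: "m * n' - n * m' = 1" and le: "E (m, n, m', n') \<le> R" using s by (auto simp: S_def s_eq)
  define A B where "A = l m n" and "B = l m' n'"
  have min': "(cmod A)\<^sup>2 + (cmod B)\<^sup>2 \<le> (cmod (l i j))\<^sup>2 + (cmod (l i' j'))\<^sup>2"
    if "i * j' - j * i' = 1" for i j i' j'
  proof (cases "E (i, j, i', j') \<le> R")
    case True
    then have "(i, j, i', j') \<in> S" using that by (simp add: S_def)
    from min[OF this] show ?thesis by (simp add: s_eq E_def A_def B_def)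
  next
    case False
    then show ?thesis using le by (simp add: E_def A_def B_def)
  qed
  have sq: "(cmod (u + v))\<^sup>2 = (cmod u)\<^sup>2 + (cmod v)\<^sup>2 + 2 * Re (cnj u * v)"
    "(cmod (u - v))\<^sup>2 = (cmod u)\<^sup>2 + (cmod v)\<^sup>2 - 2 * Re (cnj u * v)" for u v
    unfolding cmod_power2 by (simp_all add: power2_eq_square algebra_simps)
  have red: "l (m - m') (n - n') = A - B" "l (m' - m) (n' - n) = B - A"
    "l (m + m') (n + n') = A + B" "l (-m) (-n) = - A"
    by (simp_all add: l_def A_def B_def algebra_simps)
  have d: "(m - m') * n' - (n - n') * m' = 1" "m * (n' - n) - n * (m' - m) = 1"
    "(m + m') * n' - (n + n') * m' = 1" "m * (n + n') - n * (m + m') = 1"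
    using det by (simp_all add: algebra_simps)
  have comm: "Re (cnj B * A) = Re (cnj A * B)" by (simp add: algebra_simps)
  have AB: "l m n = A" "l m' n' = B" by (simp_all add: A_def B_def)
  have up: "2 * Re (cnj A * B) \<le> (cmod A)\<^sup>2" "2 * Re (cnj A * B) \<le> (cmod B)\<^sup>2"
    and lo: "- 2 * Re (cnj A * B) \<le> (cmod A)\<^sup>2" "- 2 * Re (cnj A * B) \<le> (cmod B)\<^sup>2"
    using min'[OF d(1)] min'[OF d(2)] min'[OF d(3)] min'[OF d(4)] unfolding red sq comm AB
    by linarith+
  show thesis
  proof (cases "0 \<le> Re (cnj A * B)")
    case True
    then show thesis using that[OF det] up by (simp add: A_def B_def l_def)
  next
    case False
    have dd: "m' * (- n) - n' * (- m) = 1" using det by (simp add: algebra_simps)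
    have "Re (cnj B * - A) = - Re (cnj A * B)" by (simp add: algebra_simps)
    then show thesis using that[OF dd, folded l_def, unfolded red AB] lo False
      by (simp only: norm_minus_cancel)
  qed
qed

text \<open>For the Gram entries of a reduced basis \<open>4 b^2 \<le> a c\<close>, so the
  discriminant gives \<open>a c \<le> 4/3 y^2\<close>, and a lower bound on one diagonal entry
  becomes an upper bound on the other.\<close>

lemma reduced_form_bounds:
  fixes a b c y \<delta> :: real
  assumes "0 \<le> b" "2 * b \<le> a" "2 * b \<le> c" "a * c - b\<^sup>2 = y\<^sup>2" "\<delta> > 0" "y > 0" "\<delta> * y \<le> a" "\<delta> * y \<le> c"
  shows "a \<le> 4 / 3 * y / \<delta>" "c \<le> 4 / 3 * y / \<delta>"
proof -
  have "(2 * b) * (2 * b) \<le> a * c" using assms by (intro mult_mono) auto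
  then have ac: "a * c \<le> 4 / 3 * y\<^sup>2" using assms(4) by (simp add: power2_eq_square)
  have "a * (\<delta> * y) \<le> a * c" "(\<delta> * y) * c \<le> a * c" using assms by (auto intro!: mult_mono)
  with ac have "(a * \<delta>) * y \<le> (4 / 3 * y) * y" "(c * \<delta>) * y \<le> (4 / 3 * y) * y"
    by (simp_all add: power2_eq_square algebra_simps)
  then show "a \<le> 4 / 3 * y / \<delta>" "c \<le> 4 / 3 * y / \<delta>"
    using assms by (simp_all add: field_simps)
qed

section \<open>Hexagonal points and the hyperbolic distance to them\<close>

text \<open>The point \<open>z\<close> of the upper half-plane at which \<open>p' + z q' = exp (\<i>\<pi>/3) (p + z q)\<close>,
  so that the lattice with basis \<open>(p, q)\<close>, \<open>(p', q')\<close> becomes hexagonal.\<close>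

definition hex_point :: "real \<Rightarrow> real \<Rightarrow> real \<Rightarrow> real \<Rightarrow> complex" where
  "hex_point p q p' q' =
    (Complex (1/2) \<Delta> * of_real p - of_real p') / (of_real q' - Complex (1/2) \<Delta> * of_real q)"

lemma basis_identities:
  fixes p q p' q' :: real and z :: complex
  assumes det: "p * q' - p' * q = 1"
  defines "\<alpha> \<equiv> of_real p + z * of_real q" and "\<beta> \<equiv> of_real p' + z * of_real q'"
  shows "Im (cnj \<alpha> * \<beta>) = Im z"
    and "(cmod \<alpha>)\<^sup>2 * (cmod \<beta>)\<^sup>2 - (Re (cnj \<alpha> * \<beta>))\<^sup>2 = (Im z)\<^sup>2"
proof -
  have "Im (cnj \<alpha> * \<beta>) = Im z * (p * q' - p' * q)"
    by (simp add: \<alpha>_def \<beta>_def algebra_simps)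
  then show 1: "Im (cnj \<alpha> * \<beta>) = Im z" by (simp add: det)
  have "(cmod \<alpha>)\<^sup>2 * (cmod \<beta>)\<^sup>2 = (cmod (cnj \<alpha> * \<beta>))\<^sup>2"
    by (simp add: norm_mult power_mult_distrib)
  also have "\<dots> = (Re (cnj \<alpha> * \<beta>))\<^sup>2 + (Im (cnj \<alpha> * \<beta>))\<^sup>2" by (rule cmod_power2)
  finally show "(cmod \<alpha>)\<^sup>2 * (cmod \<beta>)\<^sup>2 - (Re (cnj \<alpha> * \<beta>))\<^sup>2 = (Im z)\<^sup>2"
    by (simp only: 1)
qed

lemma hex_point_denominator:
  assumes "p * q' - p' * q = (1::real)"
  shows "of_real q' - Complex (1/2) \<Delta> * of_real q \<noteq> 0"
proof
  assume 0: "of_real q' - Complex (1/2) \<Delta> * of_real q = 0"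
  have "Im (of_real q' - Complex (1/2) \<Delta> * of_real q) = - \<Delta> * q"
    "Re (of_real q' - Complex (1/2) \<Delta> * of_real q) = q' - q / 2" by simp_all
  with 0 Delta_facts(1) have "q = 0" "q' = 0" by auto
  with assms show False by simp
qed

lemma hex_point_ratio:
  assumes "p * q' - p' * q = (1::real)"
  shows "of_real p' + hex_point p q p' q' * of_real q'
    = Complex (1/2) \<Delta> * (of_real p + hex_point p q p' q' * of_real q)"
  using hex_point_denominator[OF assms] by (simp add: hex_point_def field_simps)

lemma Im_hex_point:
  assumes "p * q' - p' * q = (1::real)"
  shows "Im (hex_point p q p' q') = \<Delta> / (cmod (of_real q' - Complex (1/2) \<Delta> * of_real q))\<^sup>2"
    and "Im (hex_point p q p' q') > 0"
proof -
  define D where "D = of_real q' - Complex (1/2) \<Delta> * of_real q"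
  have D: "D \<noteq> 0" unfolding D_def by (rule hex_point_denominator[OF assms])
  have "Im ((Complex (1/2) \<Delta> * of_real p - of_real p') * cnj D) = \<Delta> * (p * q' - p' * q)"
    by (simp add: D_def algebra_simps)
  then show 1: "Im (hex_point p q p' q') = \<Delta> / (cmod (of_real q' - Complex (1/2) \<Delta> * of_real q))\<^sup>2"
    unfolding hex_point_def D_def[symmetric] by (subst complex_div_cnj) (simp add: assms cmod_power2)
  then show "Im (hex_point p q p' q') > 0" using D Delta_facts(1) by (simp add: D_def)
qed

text \<open>In the half-plane \<open>|w - z|^2 / (Im w * Im z)\<close> equals
  \<open>2 (cosh d - 1)\<close> for the hyperbolic distance \<open>d\<close>. The bracket on the
  right, a quadratic expression in the basis at \<open>z\<close>, is therefore this distance in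
  disguise.\<close>

lemma hex_point_distance:
  fixes p q p' q' :: real and z :: complex
  assumes det: "p * q' - p' * q = 1"
  defines "\<alpha> \<equiv> of_real p + z * of_real q" and "\<beta> \<equiv> of_real p' + z * of_real q'"
  shows "\<Delta> * (cmod (hex_point p q p' q' - z))\<^sup>2 =
    Im (hex_point p q p' q') * ((cmod \<alpha>)\<^sup>2 + (cmod \<beta>)\<^sup>2 - Re (cnj \<alpha> * \<beta>) - 2 * \<Delta> * Im z)"
proof -
  define \<rho> where "\<rho> = Complex (1/2) \<Delta>"
  define D where "D = of_real q' - \<rho> * of_real q"
  have D: "D \<noteq> 0" unfolding D_def \<rho>_def by (rule hex_point_denominator[OF det])
  have "hex_point p q p' q' - z = (\<rho> * \<alpha> - \<beta>) / D"
    unfolding hex_point_def \<rho>_def[symmetric] D_def[symmetric] using D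
    by (simp add: field_simps \<alpha>_def \<beta>_def) (simp add: D_def algebra_simps)
  then have 1: "(cmod (hex_point p q p' q' - z))\<^sup>2 = (cmod (\<rho> * \<alpha> - \<beta>))\<^sup>2 / (cmod D)\<^sup>2"
    by (simp add: norm_divide power_divide)
  have \<rho>1: "cmod \<rho> = 1"
    using Delta_facts(2) by (simp add: \<rho>_def cmod_def power2_eq_square)
  have "(cmod (\<rho> * \<alpha> - \<beta>))\<^sup>2 = (cmod (\<rho> * \<alpha>))\<^sup>2 + (cmod \<beta>)\<^sup>2 - 2 * Re (cnj (\<rho> * \<alpha>) * \<beta>)"
    unfolding cmod_power2 by (simp add: power2_eq_square algebra_simps)
  moreover have "cnj (\<rho> * \<alpha>) * \<beta> = cnj \<rho> * (cnj \<alpha> * \<beta>)" by simp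
  moreover have "Re (cnj \<rho> * (cnj \<alpha> * \<beta>)) = Re (cnj \<alpha> * \<beta>) / 2 + \<Delta> * Im (cnj \<alpha> * \<beta>)"
    by (simp add: \<rho>_def)
  moreover have "Im (cnj \<alpha> * \<beta>) = Im z"
    unfolding \<alpha>_def \<beta>_def by (rule basis_identities(1)[OF det])
  ultimately have 2: "(cmod (\<rho> * \<alpha> - \<beta>))\<^sup>2
      = (cmod \<alpha>)\<^sup>2 + (cmod \<beta>)\<^sup>2 - Re (cnj \<alpha> * \<beta>) - 2 * \<Delta> * Im z"
    by (simp only: norm_mult \<rho>1) (simp add: algebra_simps)
  show ?thesis
    unfolding 1 2 Im_hex_point(1)[OF det] by (simp add: D_def \<rho>_def)
qed

text \<open>The hypothesis says \<open>2 cosh d \<le> 2 + \<kappa>\<close> for the hyperbolic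
  distance \<open>d\<close> between \<open>z\<close> and the hexagonal point, so the heights differ
  by a factor of at most \<open>2 + \<kappa>\<close>. For small \<kappa> the horizontal bound is of
  order \<open>sqrt \<kappa>\<close>, which is what later turns a quadratic defect into a linear
  displacement.\<close>

lemma hex_point_near:
  fixes p q p' q' \<kappa> :: real and z :: complex
  assumes det: "p * q' - p' * q = 1" and y: "Im z > 0" and \<kappa>: "\<kappa> \<ge> 0"
  defines "\<alpha> \<equiv> of_real p + z * of_real q" and "\<beta> \<equiv> of_real p' + z * of_real q'"
  assumes le: "(cmod \<alpha>)\<^sup>2 + (cmod \<beta>)\<^sup>2 - Re (cnj \<alpha> * \<beta>) - 2 * \<Delta> * Im z \<le> \<Delta> * (\<kappa> * Im z)"
  shows "Im (hex_point p q p' q') \<le> (2 + \<kappa>) * Im z"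
    and "Im z \<le> (2 + \<kappa>) * Im (hex_point p q p' q')"
    and "(Re (hex_point p q p' q') - Re z)\<^sup>2 \<le> \<kappa> * (2 + \<kappa>) * (Im z)\<^sup>2"
proof -
  define w where "w = hex_point p q p' q'"
  have w: "Im w > 0" unfolding w_def by (rule Im_hex_point[OF det])
  have "\<Delta> * (cmod (w - z))\<^sup>2 \<le> Im w * (\<Delta> * (\<kappa> * Im z))"
    unfolding w_def hex_point_distance[OF det]
    using mult_left_mono[OF le less_imp_le[OF w]] by (simp add: \<alpha>_def \<beta>_def w_def)
  then have "\<Delta> * (cmod (w - z))\<^sup>2 \<le> \<Delta> * (\<kappa> * Im z * Im w)" by (simp add: algebra_simps)
  then have "(cmod (w - z))\<^sup>2 \<le> \<kappa> * Im z * Im w"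
    using Delta_facts(1) by simp
  then have 1: "(Re w - Re z)\<^sup>2 + (Im w - Im z)\<^sup>2 \<le> \<kappa> * Im z * Im w"
    by (simp add: cmod_power2)
  have 2: "(Im w - Im z)\<^sup>2 \<le> \<kappa> * Im z * Im w"
    using 1 zero_le_power2[of "Re w - Re z"] by linarith
  have e: "(Im w - Im z)\<^sup>2 = Im w * Im w + Im z * Im z - 2 * (Im z * Im w)"
    by (simp add: power2_eq_square algebra_simps)
  have 2: "Im w * Im w + Im z * Im z \<le> (2 + \<kappa>) * Im z * Im w"
    using 2 unfolding e by (simp add: algebra_simps)
  have pz: "Im z * Im z \<ge> 0" "Im w * Im w \<ge> 0" by simp_all
  have "Im w * Im w \<le> ((2 + \<kappa>) * Im z) * Im w"
    using 2 pz by (simp only: mult.commute mult.left_commute)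
  then show A: "Im (hex_point p q p' q') \<le> (2 + \<kappa>) * Im z" using w by (simp add: w_def)
  have "Im z * Im z \<le> ((2 + \<kappa>) * Im w) * Im z"
    using 2 pz by (simp only: mult.commute mult.left_commute)
  then show "Im z \<le> (2 + \<kappa>) * Im (hex_point p q p' q')" using y by (simp add: w_def)
  have "(Re w - Re z)\<^sup>2 \<le> \<kappa> * Im z * Im w" using 1 zero_le_power2[of "Im w - Im z"] by linarith
  also have "\<dots> \<le> \<kappa> * Im z * ((2 + \<kappa>) * Im z)"
    using A y \<kappa> by (intro mult_left_mono) (auto simp: w_def)
  finally show "(Re (hex_point p q p' q') - Re z)\<^sup>2 \<le> \<kappa> * (2 + \<kappa>) * (Im z)\<^sup>2"
    by (simp add: w_def power2_eq_square algebra_simps)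
qed

section \<open>Lattices without short vectors\<close>

text \<open>For \<open>z = x + \<i>y\<close> with \<open>y = exp (-2t)\<close>, the vector \<open>(X, Y)\<close> is mapped by
  \<open>diag_flow t\<close> after the shear by \<open>x\<close> to a vector of norm \<open>\<bar>X + zY\<bar> / sqrt y\<close>.\<close>

definition thick :: "real \<Rightarrow> real \<Rightarrow> real \<Rightarrow> real \<Rightarrow> real \<Rightarrow> complex \<Rightarrow> bool" where
  "thick r p q p' q' z \<longleftrightarrow> (\<forall>m n :: int. (m, n) \<noteq> (0, 0) \<longrightarrow>
     r * sqrt (Im z) \<le> cmod (of_int m * (of_real p + z * of_real q) + of_int n * (of_real p' + z * of_real q')))"

lemma thick_mono: "thick r p q p' q' z \<Longrightarrow> s \<le> r \<Longrightarrow> Im z \<ge> 0 \<Longrightarrow> thick s p q p' q' z"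
  unfolding thick_def by (meson mult_right_mono order_trans real_sqrt_ge_zero)

lemma hexagonal_form_ge_1:
  fixes m n :: int
  assumes "(m, n) \<noteq> (0, 0)"
  shows "1 \<le> m\<^sup>2 + m * n + n\<^sup>2"
proof -
  have "4 * (m\<^sup>2 + m * n + n\<^sup>2) = (2 * m + n)\<^sup>2 + 3 * n\<^sup>2"
    by (simp add: power2_eq_square algebra_simps)
  also have "\<dots> > 0" using assms
    by (cases "n = 0") (auto simp: add_nonneg_pos)
  finally show ?thesis by simp
qed

text \<open>At \<open>w\<close> every nonzero vector has squared length at least
  \<open>Im w / \<Delta>\<close>. A horizontal move by \<open>s\<close> changes
  \<open>X + wY\<close> by \<open>sY\<close>, and \<open>\<bar>Y\<bar> * Im w\<close> is at most the
  length, so only the proportion \<psi> of each length can be lost.\<close>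

lemma thick_near_hex_point:
  fixes p q p' q' :: real
  assumes det: "p * q' - p' * q = 1"
  defines "w \<equiv> hex_point p q p' q'"
  assumes s: "\<bar>s\<bar> \<le> \<psi> * Im w" and \<psi>: "\<psi> \<le> 1"
  shows "thick ((1 - \<psi>) / sqrt \<Delta>) p q p' q' (w + of_real s)"
  unfolding thick_def
proof (intro allI impI)
  fix m n :: int assume mn: "(m, n) \<noteq> (0, 0)"
  define \<alpha> where "\<alpha> = of_real p + w * of_real q"
  have w: "Im w > 0" unfolding w_def by (rule Im_hex_point[OF det])
  have \<beta>: "of_real p' + w * of_real q' = Complex (1/2) \<Delta> * \<alpha>"
    unfolding w_def \<alpha>_def by (rule hex_point_ratio[OF det])
  have "Im w = Im (cnj \<alpha> * (Complex (1/2) \<Delta> * \<alpha>))"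
    using basis_identities(1)[OF det, of w] by (simp only: \<beta> \<alpha>_def[symmetric])
  also have "\<dots> = \<Delta> * (cmod \<alpha>)\<^sup>2"
    unfolding cmod_power2 by (simp add: power2_eq_square algebra_simps)
  finally have yw: "(cmod \<alpha>)\<^sup>2 = Im w / \<Delta>" using Delta_facts(1) by simp
  define X where "X = of_int m * p + of_int n * p'"
  define Y where "Y = of_int m * q + of_int n * q'"
  have v: "of_int m * (of_real p + z * of_real q) + of_int n * (of_real p' + z * of_real q')
      = of_real X + z * of_real Y" for z :: complex
    by (simp add: X_def Y_def algebra_simps)
  have "of_real X + w * of_real Y = \<alpha> * (of_int m + of_int n * Complex (1/2) \<Delta>)"
    unfolding v[symmetric] \<beta> by (simp add: \<alpha>_def algebra_simps)
  then have "(cmod (of_real X + w * of_real Y))\<^sup>2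
      = Im w / \<Delta> * (cmod (of_int m + of_int n * Complex (1/2) \<Delta>))\<^sup>2"
    by (simp add: norm_mult power_mult_distrib yw)
  also have "(cmod (of_int m + of_int n * Complex (1/2) \<Delta>))\<^sup>2
      = (of_int m + of_int n / 2)\<^sup>2 + (of_int n)\<^sup>2 * \<Delta>\<^sup>2"
    by (simp add: cmod_power2 power_mult_distrib)
  also have "\<dots> = of_int (m\<^sup>2 + m * n + n\<^sup>2)"
    unfolding Delta_facts(2) by (simp add: power2_eq_square field_simps)
  finally have "(cmod (of_real X + w * of_real Y))\<^sup>2 = Im w / \<Delta> * of_int (m\<^sup>2 + m * n + n\<^sup>2)" .
  moreover have "Im w / \<Delta> * 1 \<le> Im w / \<Delta> * of_int (m\<^sup>2 + m * n + n\<^sup>2)"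
    using hexagonal_form_ge_1[OF mn] w Delta_facts(1)
    by (intro mult_left_mono) (auto simp flip: of_int_add of_int_mult of_int_power)
  ultimately have "sqrt (Im w / \<Delta>) \<le> cmod (of_real X + w * of_real Y)"
    by (intro real_le_lsqrt) auto
  then have 1: "sqrt (Im w) / sqrt \<Delta> \<le> cmod (of_real X + w * of_real Y)"
    by (simp add: real_sqrt_divide)
  have "\<bar>Y\<bar> * Im w \<le> cmod (of_real X + w * of_real Y)"
    using abs_Im_le_cmod[of "of_real X + w * of_real Y"] w by (simp add: abs_mult mult.commute)
  have "cmod (of_real X + w * of_real Y) - cmod (of_real (s * Y))
      \<le> cmod (of_real X + w * of_real Y + of_real (s * Y))"
    by (rule norm_diff_ineq)
  moreover have "cmod (of_real (s * Y)) \<le> \<psi> * cmod (of_real X + w * of_real Y)"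
  proof -
    have "cmod (of_real (s * Y)) = \<bar>s\<bar> * \<bar>Y\<bar>" by (simp only: norm_of_real abs_mult)
    also have "\<dots> \<le> (\<psi> * Im w) * \<bar>Y\<bar>" using s by (intro mult_right_mono) auto
    also have "\<dots> = \<psi> * (\<bar>Y\<bar> * Im w)" by simp
    also have "\<dots> \<le> \<psi> * cmod (of_real X + w * of_real Y)"
    proof (intro mult_left_mono)
      show "0 \<le> \<psi>" using s w by (smt (verit) zero_le_mult_iff)
    qed fact
    finally show ?thesis .
  qed
  moreover have "(1 - \<psi>) * (sqrt (Im w) / sqrt \<Delta>) \<le> (1 - \<psi>) * cmod (of_real X + w * of_real Y)"
    using 1 \<psi> by (intro mult_left_mono) auto
  ultimately show "(1 - \<psi>) / sqrt \<Delta> * sqrt (Im (w + of_real s)) \<le>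
      cmod (of_int m * (of_real p + (w + of_real s) * of_real q)
        + of_int n * (of_real p' + (w + of_real s) * of_real q'))"
    unfolding v by (simp add: algebra_simps)
qed

lemma thick_change_basis:
  fixes m n m' n' :: int and p q p' q' :: real
  assumes det: "m * n' - n * m' = 1"
    and th: "thick r (m * p + n * p') (m * q + n * q') (m' * p + n' * p') (m' * q + n' * q') z"
  shows "thick r p q p' q' z"
  unfolding thick_def
proof (intro allI impI)
  fix i j :: int assume ij: "(i, j) \<noteq> (0, 0)"
  define k l where "k = i * n' - j * m'" and "l = j * m - i * n"
  have i: "i = k * m + l * m'" and j: "j = k * n + l * n'"
    using det unfolding k_def l_def by algebra+
  then have "(k, l) \<noteq> (0, 0)" using ij by auto
  from th[unfolded thick_def, rule_format, OF this]
  show "r * sqrt (Im z) \<le> cmod (of_int i * (of_real p + z * of_real q) + of_int j * (of_real p' + z * of_real q'))"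
    by (simp add: i j algebra_simps)
qed

lemma change_basis_det:
  fixes m n m' n' :: int and p q p' q' :: real
  assumes "m * n' - n * m' = 1" "p * q' - p' * q = 1"
  shows "(m * p + n * p') * (m' * q + n' * q') - (m' * p + n' * p') * (m * q + n * q') = 1"
proof -
  have "(m * p + n * p') * (m' * q + n' * q') - (m' * p + n' * p') * (m * q + n * q')
    = of_int (m * n' - n * m') * (p * q' - p' * q)" by (simp add: algebra_simps)
  then show ?thesis using assms by simp
qed

text \<open>A quantitative form of Mahler's criterion: the absence of short vectors bounds a reduced
  basis from below, and the fixed covolume then bounds it from above.\<close>

lemma reduced_lattice_basis:
  fixes p q p' q' :: real and z :: complex
  assumes det: "p * q' - p' * q = 1" and y: "Im z > 0"
    and th: "thick r p q p' q' z" and r: "r > 0"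
  obtains m n m' n' :: int and \<alpha> \<beta> where "m * n' - n * m' = 1"
    "\<alpha> = of_real (m * p + n * p') + z * of_real (m * q + n * q')"
    "\<beta> = of_real (m' * p + n' * p') + z * of_real (m' * q + n' * q')"
    "0 \<le> Re (cnj \<alpha> * \<beta>)" "2 * Re (cnj \<alpha> * \<beta>) \<le> (cmod \<alpha>)\<^sup>2" "2 * Re (cnj \<alpha> * \<beta>) \<le> (cmod \<beta>)\<^sup>2"
    "(cmod \<alpha>)\<^sup>2 * (cmod \<beta>)\<^sup>2 - (Re (cnj \<alpha> * \<beta>))\<^sup>2 = (Im z)\<^sup>2"
    "r\<^sup>2 * Im z \<le> (cmod \<alpha>)\<^sup>2" "r\<^sup>2 * Im z \<le> (cmod \<beta>)\<^sup>2"
    "(cmod \<alpha>)\<^sup>2 \<le> 4 / 3 * Im z / r\<^sup>2" "(cmod \<beta>)\<^sup>2 \<le> 4 / 3 * Im z / r\<^sup>2"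
proof -
  define \<alpha>0 \<beta>0 where "\<alpha>0 = of_real p + z * of_real q" and "\<beta>0 = of_real p' + z * of_real q'"
  have "Im (cnj \<alpha>0 * \<beta>0) > 0"
    unfolding \<alpha>0_def \<beta>0_def basis_identities(1)[OF det] by (rule y)
  then obtain m n m' n' :: int where d: "m * n' - n * m' = 1"
    and red: "0 \<le> Re (cnj (of_int m * \<alpha>0 + of_int n * \<beta>0) * (of_int m' * \<alpha>0 + of_int n' * \<beta>0))"
    "2 * Re (cnj (of_int m * \<alpha>0 + of_int n * \<beta>0) * (of_int m' * \<alpha>0 + of_int n' * \<beta>0))
       \<le> (cmod (of_int m * \<alpha>0 + of_int n * \<beta>0))\<^sup>2"
    "2 * Re (cnj (of_int m * \<alpha>0 + of_int n * \<beta>0) * (of_int m' * \<alpha>0 + of_int n' * \<beta>0))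
       \<le> (cmod (of_int m' * \<alpha>0 + of_int n' * \<beta>0))\<^sup>2"
    by (rule reduced_basis)
  define \<alpha> \<beta> where "\<alpha> = of_real (m * p + n * p') + z * of_real (m * q + n * q')"
    and "\<beta> = of_real (m' * p + n' * p') + z * of_real (m' * q + n' * q')"
  have e: "of_int m * \<alpha>0 + of_int n * \<beta>0 = \<alpha>" "of_int m' * \<alpha>0 + of_int n' * \<beta>0 = \<beta>"
    by (simp_all add: \<alpha>_def \<beta>_def \<alpha>0_def \<beta>0_def algebra_simps)
  have id: "(cmod \<alpha>)\<^sup>2 * (cmod \<beta>)\<^sup>2 - (Re (cnj \<alpha> * \<beta>))\<^sup>2 = (Im z)\<^sup>2"
    unfolding \<alpha>_def \<beta>_def by (rule basis_identities(2)[OF change_basis_det[OF d det]])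
  have nz: "(m, n) \<noteq> (0, 0)" "(m', n') \<noteq> (0, 0)" using d by auto
  have "r * sqrt (Im z) \<le> cmod \<alpha>" "r * sqrt (Im z) \<le> cmod \<beta>"
    using th[unfolded thick_def, rule_format, OF nz(1)] th[unfolded thick_def, rule_format, OF nz(2)]
    by (simp_all only: \<alpha>0_def[symmetric] \<beta>0_def[symmetric] e)
  then have "(r * sqrt (Im z))\<^sup>2 \<le> (cmod \<alpha>)\<^sup>2" "(r * sqrt (Im z))\<^sup>2 \<le> (cmod \<beta>)\<^sup>2"
    using r y by (auto intro!: power_mono)
  then have lo: "r\<^sup>2 * Im z \<le> (cmod \<alpha>)\<^sup>2" "r\<^sup>2 * Im z \<le> (cmod \<beta>)\<^sup>2"
    using y by (simp_all add: power_mult_distrib)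
  note red = red[unfolded e]
  have r2: "r\<^sup>2 > 0" using r by simp
  show thesis
    by (rule that[OF d \<alpha>_def \<beta>_def red id lo reduced_form_bounds[OF red id r2 y lo]])
qed

text \<open>A thick point is within bounded hyperbolic distance of a hexagonal one. For
  \<open>r = 1/7\<close> the squared lengths sum to at most \<open>2 * 4/3 * 49 < 131\<close>, in
  units of \<open>Im z\<close>, and \<open>131 \<le> 160 * \<Delta>\<close>; subtracting
  \<open>2 * \<Delta>\<close> leaves \<open>\<kappa> = 158\<close>. Hence
  \<open>2 + \<kappa> = 160\<close>, and \<open>158 * 160 \<le> 160^2\<close> serves the horizontal
  distance.\<close>

lemma hex_point_near_thick:
  fixes p q p' q' :: real and z :: complex
  assumes det: "p * q' - p' * q = 1" and y: "Im z > 0" and th: "thick (1/7) p q p' q' z"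
  obtains w where "Im w \<le> 160 * Im z" "Im z \<le> 160 * Im w" "\<bar>Re w - Re z\<bar> \<le> 160 * Im z"
    "\<And>s \<psi>. \<bar>s\<bar> \<le> \<psi> * Im w \<Longrightarrow> \<psi> \<le> 1 \<Longrightarrow> thick ((1 - \<psi>) / sqrt \<Delta>) p q p' q' (w + of_real s)"
proof -
  obtain m n m' n' :: int and \<alpha> \<beta> where d: "m * n' - n * m' = 1"
    and ab: "\<alpha> = of_real (m * p + n * p') + z * of_real (m * q + n * q')"
    "\<beta> = of_real (m' * p + n' * p') + z * of_real (m' * q + n' * q')"
    and red: "0 \<le> Re (cnj \<alpha> * \<beta>)" 
    and up: "(cmod \<alpha>)\<^sup>2 \<le> 4 / 3 * Im z / (1/7)\<^sup>2" "(cmod \<beta>)\<^sup>2 \<le> 4 / 3 * Im z / (1/7)\<^sup>2"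
    using reduced_lattice_basis[OF det y th] by (smt (verit) zero_less_divide_1_iff)
  define w where "w = hex_point (m * p + n * p') (m * q + n * q') (m' * p + n' * p') (m' * q + n' * q')"
  note det1 = change_basis_det[OF d det]
  have "(cmod \<alpha>)\<^sup>2 + (cmod \<beta>)\<^sup>2 - Re (cnj \<alpha> * \<beta>) - 2 * \<Delta> * Im z \<le> 131 * Im z - 2 * \<Delta> * Im z"
    using up red y by (simp add: power_divide)
  also have "\<dots> \<le> \<Delta> * (158 * Im z)"
  proof -
    have "131 \<le> 160 * \<Delta>"
    proof (rule power2_le_imp_le)
      show "131\<^sup>2 \<le> (160 * \<Delta>)\<^sup>2" unfolding power_mult_distrib Delta_facts(2) by simp
    qed (use Delta_facts in auto)
    then have "131 * Im z \<le> 160 * \<Delta> * Im z" using y by (intro mult_right_mono) auto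
    then show ?thesis by (simp add: algebra_simps)
  qed
  finally have k: "(cmod \<alpha>)\<^sup>2 + (cmod \<beta>)\<^sup>2 - Re (cnj \<alpha> * \<beta>) - 2 * \<Delta> * Im z \<le> \<Delta> * (158 * Im z)" .
  note near = hex_point_near[OF det1 y _ k[unfolded ab], folded w_def, simplified]
  have "(Re w - Re z)\<^sup>2 \<le> (160 * Im z)\<^sup>2"
  proof -
    have "160\<^sup>2 * (Im z)\<^sup>2 = 25280 * (Im z)\<^sup>2 + 320 * (Im z)\<^sup>2" by simp
    then show ?thesis using near(3) zero_le_power2[of "Im z"] unfolding power_mult_distrib by linarith
  qed
  then have "\<bar>Re w - Re z\<bar> \<le> 160 * Im z" using y abs_le_square_iff[of "Re w - Re z" "160 * Im z"] by simp
  moreover have "thick ((1 - \<psi>) / sqrt \<Delta>) p q p' q' (w + of_real s)"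
    if "\<bar>s\<bar> \<le> \<psi> * Im w" "\<psi> \<le> 1" for s \<psi>
    using thick_change_basis[OF d thick_near_hex_point[OF det1, folded w_def, OF that]] .
  ultimately show thesis using that near by simp
qed

text \<open>The defect is of second order. The differences \<open>d = c - a\<close> and
  \<open>e = a - 2 b\<close>, which vanish for the hexagonal form, are \<open>O(\<psi>)\<close> by
  the lower bound on \<open>a\<close>, while at fixed discriminant the excess of
  \<open>(a + c - b)^2\<close> over \<open>4 * \<Delta>^2\<close> is a quadratic form in
  \<open>d\<close> and \<open>e\<close>.\<close>

lemma hexagonal_defect_bound:
  fixes a b c \<psi> :: real
  assumes b: "0 \<le> b" "2 * b \<le> a" "2 * b \<le> c" and disc: "a * c - b\<^sup>2 = 1"
    and \<psi>: "0 \<le> \<psi>" "\<psi> \<le> 1/2" and lo: "(1 - \<psi>)\<^sup>2 / \<Delta> \<le> a" "(1 - \<psi>)\<^sup>2 / \<Delta> \<le> c"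
  shows "a + c - b - 2 * \<Delta> \<le> \<Delta> * (1408 * \<psi>\<^sup>2)"
proof -
  have ord: "a + c - b - 2 * \<Delta> \<le> \<Delta> * (1408 * \<psi>\<^sup>2)"
    if b: "0 \<le> b" "2 * b \<le> a" and disc: "a * c - b\<^sup>2 = 1" and lo: "(1 - \<psi>)\<^sup>2 / \<Delta> \<le> a"
      and ac: "a \<le> c" for a b c
  proof -
    define d e where "d = c - a" and "e = a - 2 * b"
    have de: "d \<ge> 0" "e \<ge> 0" using ac b by (auto simp: d_def e_def)
    have D: "\<Delta> > 0" "\<Delta>\<^sup>2 = 3/4" "\<Delta> \<le> 1" by (rule Delta_facts)+
    have "(1/2)\<^sup>2 \<le> (1 - \<psi>)\<^sup>2" using \<psi> by (intro power_mono) auto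
    then have h: "1/4 \<le> (1 - \<psi>)\<^sup>2" by (simp add: power2_eq_square)
    have "(1 - \<psi>)\<^sup>2 \<le> (1 - \<psi>)\<^sup>2 / \<Delta>" using D by (simp add: field_simps mult_left_le_one_le)
    then have a4: "1/4 \<le> a" using h lo by linarith
    have "(1 - \<psi>)\<^sup>2 \<le> a * \<Delta>" using lo D by (simp add: field_simps)
    then have "((1 - \<psi>)\<^sup>2)\<^sup>2 \<le> (a * \<Delta>)\<^sup>2" by (intro power_mono) auto
    then have q: "((1 - \<psi>)\<^sup>2)\<^sup>2 \<le> 3 / 4 * a\<^sup>2" by (simp add: power_mult_distrib D)
    have bern: "1 - 4 * \<psi> \<le> ((1 - \<psi>)\<^sup>2)\<^sup>2"
      using Bernoulli_inequality[of "- \<psi>" 4] \<psi> by (simp flip: power_mult)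
    \<comment> \<open>Both summands on the right are nonnegative and the left side is at most
      \<open>4 * \<psi>\<close>; since \<open>a\<close> is bounded below, \<open>d\<close> and
      \<open>e\<close> are at most linear in \<psi>.\<close>
    have id: "1 - 3 / 4 * a\<^sup>2 = a * (d + e / 4) + e / 4 * (a - e)"
      unfolding disc[symmetric] d_def e_def by (simp add: power2_eq_square field_simps)
    have "e / 4 * (a - e) \<ge> 0" using de b by (intro mult_nonneg_nonneg) (auto simp: e_def)
    then have "a * (d + e / 4) \<le> 4 * \<psi>" using id q bern by linarith
    moreover have "1/4 * (d + e / 4) \<le> a * (d + e / 4)" using a4 de by (intro mult_right_mono) auto
    ultimately have "1/4 * (d + e / 4) \<le> 4 * \<psi>" by (rule order_trans[rotated])
    then have s: "d + e / 4 \<le> 16 * \<psi>" by (simp add: field_simps)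
    have dd: "d \<le> 16 * \<psi>" "e \<le> 64 * \<psi>" "d + e \<le> 64 * \<psi>" using s de by linarith+
    have "d\<^sup>2 \<le> (16 * \<psi>)\<^sup>2" "e\<^sup>2 \<le> (64 * \<psi>)\<^sup>2" "(d + e)\<^sup>2 \<le> (64 * \<psi>)\<^sup>2"
      using dd de by (intro power_mono; simp)+
    then have sum: "(d\<^sup>2 + e\<^sup>2 + (d + e)\<^sup>2) / 2 \<le> 4224 * \<psi>\<^sup>2" by (simp add: power_mult_distrib)
    define S where "S = a + c - b"
    have id2: "S\<^sup>2 - 4 * \<Delta>\<^sup>2 = (d\<^sup>2 + e\<^sup>2 + (d + e)\<^sup>2) / 2"
    proof -
      have "S\<^sup>2 - 3 * (a * c - b\<^sup>2) = (d\<^sup>2 + e\<^sup>2 + (d + e)\<^sup>2) / 2"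
        unfolding S_def d_def e_def by (simp add: power2_eq_square field_simps)
      then show ?thesis by (simp add: disc D)
    qed
    have "0 \<le> (d\<^sup>2 + e\<^sup>2 + (d + e)\<^sup>2) / 2" by simp
    then have S2: "(2 * \<Delta>)\<^sup>2 \<le> S\<^sup>2" unfolding id2[symmetric] power_mult_distrib by simp
    have S0: "S \<ge> 0" using b ac a4 unfolding S_def by linarith
    have S: "2 * \<Delta> \<le> S" by (rule power2_le_imp_le[OF S2 S0])
    have "(S - 2 * \<Delta>) * (4 * \<Delta>) \<le> (S - 2 * \<Delta>) * (S + 2 * \<Delta>)"
      using S by (intro mult_left_mono) auto
    also have "\<dots> = S\<^sup>2 - 4 * \<Delta>\<^sup>2" by (simp add: power2_eq_square algebra_simps)
    also have "\<dots> \<le> 4224 * \<psi>\<^sup>2" using id2 sum by simp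
    also have "\<dots> = (\<Delta> * (1408 * \<psi>\<^sup>2)) * (4 * \<Delta>)"
    proof -
      have "(\<Delta> * (1408 * \<psi>\<^sup>2)) * (4 * \<Delta>) = \<Delta>\<^sup>2 * (5632 * \<psi>\<^sup>2)" by (simp add: power2_eq_square)
      then show ?thesis by (simp add: D(2))
    qed
    finally have "(S - 2 * \<Delta>) * (4 * \<Delta>) \<le> (\<Delta> * (1408 * \<psi>\<^sup>2)) * (4 * \<Delta>)" .
    then show ?thesis using D(1) unfolding S_def[symmetric]
      by (metis mult_le_cancel_right_pos mult_pos_pos zero_less_numeral)
  qed
  show ?thesis
  proof (cases "a \<le> c")
    case True
    then show ?thesis using ord[of b a c] assms by simp
  next
    case False
    then show ?thesis using ord[of b c a] assms by (simp add: algebra_simps)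
  qed
qed

text \<open>The square root of the quadratic defect, after rescaling to height one. With
  \<open>\<kappa> = 1408 * \<psi>^2\<close> and \<open>\<psi> \<le> 1/2\<close> one has
  \<open>2 + \<kappa> \<le> 354\<close>, and \<open>1408 * 354 < 707^2\<close>.\<close>

lemma near_hexagonal:
  fixes p q p' q' \<psi> :: real and z :: complex
  assumes det: "p * q' - p' * q = 1" and y: "Im z > 0" and \<psi>: "0 \<le> \<psi>" "\<psi> \<le> 1/2"
  defines "\<alpha> \<equiv> of_real p + z * of_real q" and "\<beta> \<equiv> of_real p' + z * of_real q'"
  assumes red: "0 \<le> Re (cnj \<alpha> * \<beta>)" "2 * Re (cnj \<alpha> * \<beta>) \<le> (cmod \<alpha>)\<^sup>2" "2 * Re (cnj \<alpha> * \<beta>) \<le> (cmod \<beta>)\<^sup>2"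
    and lo: "(1 - \<psi>)\<^sup>2 / \<Delta> * Im z \<le> (cmod \<alpha>)\<^sup>2" "(1 - \<psi>)\<^sup>2 / \<Delta> * Im z \<le> (cmod \<beta>)\<^sup>2"
  shows "\<bar>Re (hex_point p q p' q') - Re z\<bar> \<le> 707 * \<psi> * Im z"
proof -
  define y where "y = Im z"
  have y0: "y > 0" using y by (simp add: y_def)
  define a b c where "a = (cmod \<alpha>)\<^sup>2 / y" and "b = Re (cnj \<alpha> * \<beta>) / y" and "c = (cmod \<beta>)\<^sup>2 / y"
  have "(cmod \<alpha>)\<^sup>2 * (cmod \<beta>)\<^sup>2 - (Re (cnj \<alpha> * \<beta>))\<^sup>2 = y\<^sup>2"
    unfolding \<alpha>_def \<beta>_def y_def by (rule basis_identities(2)[OF det])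
  then have "a * c - b\<^sup>2 = y\<^sup>2 / y\<^sup>2"
    unfolding a_def b_def c_def by (simp add: power_divide flip: diff_divide_distrib power2_eq_square)
  then have disc: "a * c - b\<^sup>2 = 1" using y0 by simp
  have r: "0 \<le> b" "2 * b \<le> a" "2 * b \<le> c" "(1 - \<psi>)\<^sup>2 / \<Delta> \<le> a" "(1 - \<psi>)\<^sup>2 / \<Delta> \<le> c"
    using red lo y0 unfolding a_def b_def c_def y_def[symmetric]
    by (auto simp: divide_right_mono pos_le_divide_eq)
  have "(a + c - b - 2 * \<Delta>) * y \<le> \<Delta> * (1408 * \<psi>\<^sup>2) * y"
    using hexagonal_defect_bound[OF r(1-3) disc \<psi> r(4,5)] y0 by (intro mult_right_mono) auto
  moreover have "a * y = (cmod \<alpha>)\<^sup>2" "b * y = Re (cnj \<alpha> * \<beta>)" "c * y = (cmod \<beta>)\<^sup>2"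
    using y0 by (auto simp: a_def b_def c_def)
  ultimately have k: "(cmod \<alpha>)\<^sup>2 + (cmod \<beta>)\<^sup>2 - Re (cnj \<alpha> * \<beta>) - 2 * \<Delta> * Im z \<le> \<Delta> * ((1408 * \<psi>\<^sup>2) * Im z)"
    by (simp add: left_diff_distrib distrib_right y_def[symmetric] mult.assoc)
  have \<kappa>0: "0 \<le> 1408 * \<psi>\<^sup>2" by simp
  have "(Re (hex_point p q p' q') - Re z)\<^sup>2 \<le> (1408 * \<psi>\<^sup>2) * (2 + 1408 * \<psi>\<^sup>2) * (Im z)\<^sup>2"
    by (rule hex_point_near(3)[OF det y \<kappa>0 k[unfolded \<alpha>_def \<beta>_def]])
  also have "\<dots> \<le> (1408 * \<psi>\<^sup>2) * 354 * (Im z)\<^sup>2"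
  proof (intro mult_right_mono mult_left_mono)
    have "\<psi>\<^sup>2 \<le> (1/2)\<^sup>2" using \<psi> by (intro power_mono) auto
    then show "2 + 1408 * \<psi>\<^sup>2 \<le> 354" by (simp add: power2_eq_square)
  qed auto
  also have "\<dots> \<le> (707 * \<psi> * Im z)\<^sup>2" by (simp add: power_mult_distrib)
  finally show ?thesis using \<psi> y abs_le_square_iff[of "Re (hex_point p q p' q') - Re z" "707 * \<psi> * Im z"]
    by simp
qed

section \<open>Covering near-hexagonal times\<close>

text \<open>Moving the base point alters a vector only through \<open>Y\<close>, and
  \<open>\<bar>Y\<bar> * Im z\<close> is bounded by its length at \<open>z\<close>. Lengths at two
  points of one hyperbolic box are therefore comparable.\<close>

lemma lattice_vector_comparison:
  fixes X Y :: real and z w :: complex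
  assumes "Im z > 0"
  shows "cmod (of_real X + w * of_real Y) \<le> (1 + cmod (w - z) / Im z) * cmod (of_real X + z * of_real Y)"
proof -
  have "\<bar>Y\<bar> * Im z \<le> cmod (of_real X + z * of_real Y)"
    using abs_Im_le_cmod[of "of_real X + z * of_real Y"] assms by (simp add: abs_mult mult.commute)
  then have Y: "\<bar>Y\<bar> \<le> cmod (of_real X + z * of_real Y) / Im z" using assms by (simp add: field_simps)
  have "of_real X + w * of_real Y = (of_real X + z * of_real Y) + (w - z) * of_real Y"
    by (simp add: algebra_simps)
  then have "cmod (of_real X + w * of_real Y) \<le> cmod (of_real X + z * of_real Y) + cmod (w - z) * \<bar>Y\<bar>"
    using norm_triangle_ineq[of "of_real X + z * of_real Y" "(w - z) * of_real Y"]
    by (simp only: norm_mult norm_of_real)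
  also have "\<dots> \<le> cmod (of_real X + z * of_real Y) + cmod (w - z) * (cmod (of_real X + z * of_real Y) / Im z)"
    using Y by (intro add_mono mult_left_mono) auto
  finally show ?thesis by (simp add: algebra_simps)
qed

text \<open>Relative to a basis reduced at one point of the box, every basis reduced at another
  point of the box has integer coordinates at most \<open>60\<close>, which leaves \<open>121 ^ 4\<close> candidates for
  the nearby hexagonal point.\<close>

lemma near_hexagonal_cover:
  fixes p q p' q' \<psi> x0 h :: real
  assumes det: "p * q' - p' * q = 1" and h: "h > 0" and \<psi>: "0 \<le> \<psi>" "\<psi> \<le> 1/2"
  shows "\<exists>B \<in> sets lborel. emeasure lborel B \<le> ennreal (121 ^ 4 * (5656 * \<psi> * h)) \<and>
    {x \<in> {x0..x0 + h}. \<exists>y \<in> {h..4 * h}. thick ((1 - \<psi>) / sqrt \<Delta>) p q p' q' (Complex x y)} \<subseteq> B"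
    (is "\<exists>B \<in> _. _ \<and> ?S \<subseteq> B")
proof (cases "?S = {}")
  case True
  then show ?thesis by (intro bexI[of _ "{}"]) auto
next
  case False
  define r where "r = (1 - \<psi>) / sqrt \<Delta>"
  have D: "0 < \<Delta>" "\<Delta> \<le> 1" by (rule Delta_facts)+
  have r0: "r > 0" using \<psi> D by (simp add: r_def)
  have r2: "r\<^sup>2 = (1 - \<psi>)\<^sup>2 / \<Delta>" using D by (simp add: r_def power_divide)
  have r4: "1/4 \<le> r\<^sup>2"
  proof -
    have "1/4 \<le> (1 - \<psi>)\<^sup>2" using power_mono[of "1/2" "1 - \<psi>" 2] \<psi> by (simp add: power2_eq_square)
    also have "\<dots> \<le> (1 - \<psi>)\<^sup>2 / \<Delta>" using D by (simp add: field_simps mult_left_le_one_le)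
    finally show ?thesis by (simp add: r2)
  qed
  have up: "4 / 3 * y / r\<^sup>2 \<le> 6 * y" if "y > 0" for y
  proof -
    have "4 / 3 * y \<le> 6 * y * (1/4)" using that by simp
    also have "\<dots> \<le> 6 * y * r\<^sup>2" using r4 that by (intro mult_left_mono) auto
    finally show ?thesis using r0 by (simp add: divide_le_eq)
  qed
  obtain x1 y1 where z1: "x1 \<in> {x0..x0 + h}" "y1 \<in> {h..4 * h}" "thick r p q p' q' (Complex x1 y1)"
    using False by (auto simp: r_def)
  define z1 where "z1 = Complex x1 y1"
  have y1: "Im z1 > 0" using z1 h by (simp add: z1_def)
  obtain m0 n0 m0' n0' :: int and \<alpha>0 \<beta>0 where d0: "m0 * n0' - n0 * m0' = 1"
    and ab0: "\<alpha>0 = of_real (m0 * p + n0 * p') + z1 * of_real (m0 * q + n0 * q')"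
    "\<beta>0 = of_real (m0' * p + n0' * p') + z1 * of_real (m0' * q + n0' * q')"
    and up0: "(cmod \<alpha>0)\<^sup>2 \<le> 4 / 3 * Im z1 / r\<^sup>2" "(cmod \<beta>0)\<^sup>2 \<le> 4 / 3 * Im z1 / r\<^sup>2"
    by (rule reduced_lattice_basis[OF det y1 z1(3)[folded z1_def] r0])
  define P Q P' Q' where PQ: "P = m0 * p + n0 * p'" "Q = m0 * q + n0 * q'"
    "P' = m0' * p + n0' * p'" "Q' = m0' * q + n0' * q'"
  have detP: "P * Q' - P' * Q = 1" unfolding PQ by (rule change_basis_det[OF d0 det])
  have ab0: "\<alpha>0 = of_real P + z1 * of_real Q" "\<beta>0 = of_real P' + z1 * of_real Q'"
    by (simp_all add: ab0 PQ)
  have up0: "(cmod \<alpha>0)\<^sup>2 \<le> 6 * Im z1" "(cmod \<beta>0)\<^sup>2 \<le> 6 * Im z1"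
    using up0 up[OF y1] by linarith+
  define xi where "xi = (\<lambda>(m :: int, n :: int, m' :: int, n' :: int).
    Re (hex_point (m * P + n * P') (m * Q + n * Q') (m' * P + n' * P') (m' * Q + n' * Q')))"
  define K where "K = {-60..60::int} \<times> {-60..60::int} \<times> {-60..60::int} \<times> {-60..60::int}"
  \<comment> \<open>The radius is \<open>707 * \<psi> * y\<close> at the largest height
    \<open>y = 4 * h\<close>.\<close>
  define B where "B = (\<Union>k\<in>K. {xi k - 2828 * \<psi> * h .. xi k + 2828 * \<psi> * h})"
  have fin: "finite K" by (simp add: K_def)
  have card: "card K = 121 ^ 4" by (simp add: K_def card_cartesian_product)
  have B: "B \<in> sets lborel" unfolding B_def using fin by (intro sets.finite_UN) auto
  have "emeasure lborel B \<le> (\<Sum>k\<in>K. emeasure lborel {xi k - 2828 * \<psi> * h .. xi k + 2828 * \<psi> * h})"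
    unfolding B_def using fin by (intro emeasure_subadditive_finite) auto
  also have "\<dots> = (\<Sum>k\<in>K. ennreal (5656 * \<psi> * h))"
    using \<psi> h by (intro sum.cong) auto
  also have "\<dots> = ennreal (\<Sum>k\<in>K. 5656 * \<psi> * h)"
    using \<psi> h by (intro sum_ennreal) auto
  also have "(\<Sum>k\<in>K. 5656 * \<psi> * h) = 121 ^ 4 * (5656 * \<psi> * h)" by (simp add: card)
  finally have mB: "emeasure lborel B \<le> ennreal (121 ^ 4 * (5656 * \<psi> * h))" .
  have "?S \<subseteq> B"
  proof
    fix x assume "x \<in> ?S"
    then obtain y where x: "x \<in> {x0..x0 + h}" and y: "y \<in> {h..4 * h}"
      and th: "thick r p q p' q' (Complex x y)" by (auto simp: r_def)
    define z where "z = Complex x y"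
    have yz: "Im z > 0" "Im z = y" using y h by (auto simp: z_def)
    \<comment> \<open>Thickness is transported to the basis reduced at \<open>z1\<close> by the
      inverse integer matrix, so that coordinates are taken relative to that basis.\<close>
    have "thick r P Q P' Q' z"
    proof -
      have d0': "n0' * m0 - (- n0) * (- m0') = 1" using d0 by (simp add: algebra_simps)
      have eq: "of_int n0' * P + of_int (- n0) * P' = p" "of_int n0' * Q + of_int (- n0) * Q' = q"
        "of_int (- m0') * P + of_int m0 * P' = p'" "of_int (- m0') * Q + of_int m0 * Q' = q'"
      proof -
        have d: "real_of_int m0 * real_of_int n0' - real_of_int n0 * real_of_int m0' = 1"
          using d0 by (metis of_int_1 of_int_diff of_int_mult)
        show "of_int n0' * P + of_int (- n0) * P' = p" "of_int n0' * Q + of_int (- n0) * Q' = q"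
          "of_int (- m0') * P + of_int m0 * P' = p'" "of_int (- m0') * Q + of_int m0 * Q' = q'"
          unfolding PQ of_int_minus using d by algebra+
      qed
      show ?thesis using thick_change_basis[OF d0', of r P P' Q Q' z] th by (simp only: eq z_def)
    qed
    then obtain m n m' n' :: int and \<alpha> \<beta> where d: "m * n' - n * m' = 1"
      and ab: "\<alpha> = of_real (m * P + n * P') + z * of_real (m * Q + n * Q')"
      "\<beta> = of_real (m' * P + n' * P') + z * of_real (m' * Q + n' * Q')"
      and red: "0 \<le> Re (cnj \<alpha> * \<beta>)" "2 * Re (cnj \<alpha> * \<beta>) \<le> (cmod \<alpha>)\<^sup>2" "2 * Re (cnj \<alpha> * \<beta>) \<le> (cmod \<beta>)\<^sup>2"
      and lo: "r\<^sup>2 * Im z \<le> (cmod \<alpha>)\<^sup>2" "r\<^sup>2 * Im z \<le> (cmod \<beta>)\<^sup>2"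
      and upz: "(cmod \<alpha>)\<^sup>2 \<le> 4 / 3 * Im z / r\<^sup>2" "(cmod \<beta>)\<^sup>2 \<le> 4 / 3 * Im z / r\<^sup>2"
      by (rule reduced_lattice_basis[OF detP yz(1) _ r0]) blast
    have zz: "cmod (z1 - z) \<le> 4 * y"
    proof -
      have "cmod (z1 - z) \<le> \<bar>Re (z1 - z)\<bar> + \<bar>Im (z1 - z)\<bar>" by (rule cmod_le)
      also have "\<dots> \<le> h + 3 * h" using x y z1 by (auto simp: z_def z1_def intro!: add_mono)
      finally show ?thesis using y by auto
    qed
    \<comment> \<open>A reduced vector at \<open>z\<close> has squared length at most
      \<open>6 * y \<le> 24 * Im z1\<close>; passing to \<open>z1\<close> costs a factor
      \<open>5^2\<close>. Pairing it with a basis vector of squared length at most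
      \<open>6 * Im z1\<close> gives \<open>600 * 6 = 60^2\<close>.\<close>
    have small: "\<bar>i\<bar> \<le> 60 \<and> \<bar>j\<bar> \<le> 60"
      if "(cmod (of_real (i * P + j * P') + z * of_real (i * Q + j * Q')))\<^sup>2 \<le> 4 / 3 * Im z / r\<^sup>2" for i j :: int
    proof -
      define v where "v = of_real (i * P + j * P') + z * of_real (i * Q + j * Q')"
      define v1 where "v1 = of_real (i * P + j * P') + z1 * of_real (i * Q + j * Q')"
      have "(cmod v)\<^sup>2 \<le> 6 * y" using that up[OF yz(1)] yz unfolding v_def by linarith
      also have "\<dots> \<le> 24 * Im z1" using y z1 by (simp add: z1_def)
      finally have v: "(cmod v)\<^sup>2 \<le> 24 * Im z1" .
      have "cmod v1 \<le> (1 + cmod (z1 - z) / Im z) * cmod v"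
        unfolding v_def v1_def by (rule lattice_vector_comparison[OF yz(1)])
      also have "\<dots> \<le> 5 * cmod v"
        using zz yz by (intro mult_right_mono) (auto simp: divide_le_eq)
      finally have "(cmod v1)\<^sup>2 \<le> (5 * cmod v)\<^sup>2" by (intro power_mono) auto
      also have "\<dots> \<le> 600 * Im z1" using v by (simp add: power_mult_distrib)
      finally have v1: "(cmod v1)\<^sup>2 \<le> 600 * Im z1" .
      have prod: "\<bar>k\<bar> \<le> 60" if "\<bar>of_int k * Im z1\<bar> \<le> cmod v1 * cmod u" "(cmod u)\<^sup>2 \<le> 6 * Im z1" for k :: int and u
      proof -
        have "(of_int k * Im z1)\<^sup>2 \<le> (cmod v1 * cmod u)\<^sup>2"
          using that(1) by (metis abs_ge_zero power2_abs power_mono)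
        also have "\<dots> = (cmod v1)\<^sup>2 * (cmod u)\<^sup>2" by (simp add: power_mult_distrib)
        also have "\<dots> \<le> (600 * Im z1) * (6 * Im z1)" using v1 that(2) y1 by (intro mult_mono) auto
        also have "\<dots> = (60 * Im z1)\<^sup>2" by (simp add: power2_eq_square)
        finally have "\<bar>of_int k * Im z1\<bar> \<le> \<bar>60 * Im z1\<bar>" by (simp add: abs_le_square_iff)
        then have "of_int \<bar>k\<bar> * Im z1 \<le> 60 * Im z1" using y1 by (simp add: abs_mult)
        then have "real_of_int \<bar>k\<bar> \<le> 60" using y1 by (simp only: mult_le_cancel_right_pos)
        then show ?thesis by linarith
      qed
      have v1e: "v1 = of_int i * \<alpha>0 + of_int j * \<beta>0" by (simp add: v1_def ab0 algebra_simps)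
      have Im0: "Im (cnj \<alpha>0 * \<beta>0) = Im z1" unfolding ab0 by (rule basis_identities(1)[OF detP])
      have "Im (cnj v1 * \<beta>0) = of_int i * Im (cnj \<alpha>0 * \<beta>0)" "Im (cnj v1 * \<alpha>0) = - of_int j * Im (cnj \<alpha>0 * \<beta>0)"
        by (simp_all add: v1e algebra_simps)
      then have "\<bar>of_int i * Im z1\<bar> \<le> cmod v1 * cmod \<beta>0" "\<bar>of_int j * Im z1\<bar> \<le> cmod v1 * cmod \<alpha>0"
        using abs_Im_le_cmod[of "cnj v1 * \<beta>0"] abs_Im_le_cmod[of "cnj v1 * \<alpha>0"]
        unfolding Im0 by (simp_all add: norm_mult)
      then show ?thesis using prod up0 by blast
    qed
    have "(m, n, m', n') \<in> K"
      using small[OF upz(1)[unfolded ab]] small[OF upz(2)[unfolded ab]] by (auto simp: K_def)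
    moreover have "\<bar>xi (m, n, m', n') - x\<bar> \<le> 707 * \<psi> * y"
      using near_hexagonal[OF change_basis_det[OF d detP] yz(1) \<psi>
          red[unfolded ab] lo[unfolded ab r2]]
      by (simp add: xi_def z_def)
    moreover have "707 * \<psi> * y \<le> 707 * \<psi> * (4 * h)" using y \<psi> by (intro mult_left_mono) auto
    ultimately show "x \<in> B" unfolding B_def by (auto intro!: bexI[of _ "(m, n, m', n')"])
  qed
  with B mB show ?thesis by blast
qed

section \<open>Nondivergence\<close>

text \<open>Two lattice vectors that are short at a common point \<open>x\<close> have determinant less than one in
  absolute value, hence are parallel. So the intervals on which a vector has length less than \<open>7/2\<close>
  (in the first coordinate) are pairwise disjoint for different directions, and the
  bad set consists of their concentric copies shrunk by the factor \<open>2/49\<close>.\<close>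

lemma nondivergence:
  fixes p q p' q' a b :: real
  assumes det: "p * q' - p' * q = 1" and ab: "a < b"
  obtains y0 where "y0 > 0"
    "\<And>y. 0 < y \<Longrightarrow> y < y0 \<Longrightarrow> \<exists>B \<in> sets lborel. emeasure lborel B \<le> ennreal ((b - a) / 4) \<and>
      {x \<in> {a..b}. \<not> thick (1/7) p q p' q' (Complex x y)} \<subseteq> B"
proof -
  define N where "N = 1 + \<bar>p\<bar> + \<bar>q\<bar> + \<bar>p'\<bar> + \<bar>q'\<bar>"
  define M where "M = \<bar>a\<bar> + \<bar>b\<bar>"
  \<comment> \<open>\<open>C\<close> and \<open>y0\<close> are made for \<open>Ylow\<close>: a
    lattice vector with both coordinates at most \<open>C * s\<close>, where
    \<open>N * (C * s) < 1\<close>, is excluded by the discreteness bound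
    \<open>disc\<close>.\<close>
  define C where "C = 1/7 + 7/2 * (1 + M) / (b - a)"
  define y0 where "y0 = (1 / (N * C))\<^sup>2"
  have N: "N \<ge> 1" and M: "M \<ge> 0" by (simp_all add: N_def M_def)
  have C: "C > 0" using M ab by (simp add: C_def add_pos_nonneg)
  have disc: "1 \<le> N * e" if mn: "(m, n) \<noteq> (0, 0)"
    and e: "\<bar>m * p + n * p'\<bar> \<le> e" "\<bar>m * q + n * q'\<bar> \<le> e" for m n :: int and e
  proof -
    have e0: "e \<ge> 0" using e(1) by linarith
    have "of_int m * (p * q' - p' * q) = (m * p + n * p') * q' - (m * q + n * q') * p'"
      "of_int n * (p * q' - p' * q) = (m * q + n * q') * p - (m * p + n * p') * q"
      by (simp_all add: algebra_simps)
    then have m: "of_int m = (m * p + n * p') * q' - (m * q + n * q') * p'"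
      and n: "of_int n = (m * q + n * q') * p - (m * p + n * p') * q" by (simp_all add: det)
    have tri: "\<bar>u * v - u' * v'\<bar> \<le> e * \<bar>v\<bar> + e * \<bar>v'\<bar>" if "\<bar>u\<bar> \<le> e" "\<bar>u'\<bar> \<le> e" for u v u' v' :: real
    proof -
      have "\<bar>u * v - u' * v'\<bar> \<le> \<bar>u\<bar> * \<bar>v\<bar> + \<bar>u'\<bar> * \<bar>v'\<bar>"
        using abs_triangle_ineq4[of "u * v" "u' * v'"] by (simp add: abs_mult)
      also have "\<dots> \<le> e * \<bar>v\<bar> + e * \<bar>v'\<bar>" using that by (intro add_mono mult_right_mono) auto
      finally show ?thesis .
    qed
    have 1: "\<bar>of_int m\<bar> \<le> e * \<bar>q'\<bar> + e * \<bar>p'\<bar>" "\<bar>of_int n\<bar> \<le> e * \<bar>p\<bar> + e * \<bar>q\<bar>"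
      by (subst m, rule tri[OF e]) (subst n, rule tri[OF e(2,1)])
    have "N * e = e + e * \<bar>p\<bar> + e * \<bar>q\<bar> + e * \<bar>p'\<bar> + e * \<bar>q'\<bar>"
      by (simp add: N_def algebra_simps)
    moreover have "e * \<bar>p\<bar> \<ge> 0" "e * \<bar>q\<bar> \<ge> 0" "e * \<bar>p'\<bar> \<ge> 0" "e * \<bar>q'\<bar> \<ge> 0" using e0 by simp_all
    moreover have "1 \<le> \<bar>real_of_int m\<bar> \<or> 1 \<le> \<bar>real_of_int n\<bar>" using mn by (cases "m = 0") auto
    ultimately show ?thesis using 1 e0 by linarith
  qed
  have "\<exists>B \<in> sets lborel. emeasure lborel B \<le> ennreal ((b - a) / 4) \<and>
      {x \<in> {a..b}. \<not> thick (1/7) p q p' q' (Complex x y)} \<subseteq> B" if y: "0 < y" "y < y0" for y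
  proof -
    define s where "s = sqrt y"
    have s0: "s > 0" and ss: "s * s = y" using y by (auto simp: s_def)
    have "s < 1 / (N * C)" unfolding s_def using y N C by (intro real_less_lsqrt) (auto simp: y0_def)
    then have sC: "N * (C * s) < 1" using N C by (simp add: field_simps)
    define X Y where "X = (\<lambda>(m::int, n::int). m * p + n * p')" and "Y = (\<lambda>(m::int, n::int). m * q + n * q')"
    \<comment> \<open>As \<open>s = exp (- t)\<close>, these are the vectors whose two flowed
      coordinates are both below \<open>1/7\<close>, the second for all \<open>x\<close> and the
      first for some \<open>x\<close>.\<close>
    define P where "P = {k. k \<noteq> (0, 0) \<and> \<bar>Y k\<bar> * s < 1/7 \<and> (\<exists>x\<in>{a..b}. \<bar>X k + x * Y k\<bar> < s / 7)}"
    \<comment> \<open>This says that the enlarged radius \<open>7/2 * s / \<bar>Y k\<bar>\<close> is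
      at most \<open>b - a\<close>, so no enlarged interval reaches far beyond
      \<open>{a..b}\<close>.\<close>
    have Ylow: "7/2 * s / (b - a) \<le> \<bar>Y k\<bar>" if kP: "k \<in> P" for k
    proof (rule ccontr)
      assume not: "\<not> ?thesis"
      have E0: "7/2 * s / (b - a) \<ge> 0" using s0 ab by simp
      have ME: "M * (7/2 * s / (b - a)) \<ge> 0" using E0 M by (rule mult_nonneg_nonneg[rotated])
      have Cs: "C * s = s / 7 + M * (7/2 * s / (b - a)) + 7/2 * s / (b - a)"
        by (simp add: C_def distrib_right add_divide_distrib distrib_left mult.commute)
      from not have small: "\<bar>Y k\<bar> \<le> 7/2 * s / (b - a)" by simp
      obtain x where x: "x \<in> {a..b}" "\<bar>X k + x * Y k\<bar> < s / 7" using kP by (auto simp: P_def)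
      have "\<bar>X k\<bar> \<le> \<bar>X k + x * Y k\<bar> + \<bar>x\<bar> * \<bar>Y k\<bar>"
        using abs_triangle_ineq4[of "X k + x * Y k" "x * Y k"] by (simp add: abs_mult)
      also have "\<dots> \<le> s / 7 + M * (7/2 * s / (b - a))"
        using x small M by (intro add_mono mult_mono) (auto simp: M_def)
      also have "\<dots> \<le> C * s" using Cs M E0 by linarith
      finally have 1: "\<bar>X k\<bar> \<le> C * s" .
      have "7/2 * s / (b - a) \<le> C * s" using Cs ME s0 by linarith
      with small have 2: "\<bar>Y k\<bar> \<le> C * s" by linarith
      have "1 \<le> N * (C * s)"
        using kP 1 2 by (intro disc[of "fst k" "snd k"]) (auto simp: P_def X_def Y_def case_prod_beta)
      with sC show False by simp
    qed
    have Ypos: "\<bar>Y k\<bar> > 0" if "k \<in> P" for k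
    proof -
      have "7/2 * s / (b - a) > 0" using s0 ab by simp
      then show ?thesis using Ylow[OF that] by linarith
    qed
    have fin: "finite P"
    proof -
      define R where "R = s / 7 + (M + 1) * (1 / (7 * s))"
      have "P \<subseteq> {- \<lceil>N * R\<rceil>..\<lceil>N * R\<rceil>} \<times> {- \<lceil>N * R\<rceil>..\<lceil>N * R\<rceil>}"
      proof
        fix k assume k: "k \<in> P"
        obtain m n where mn: "k = (m, n)" by (cases k)
        obtain x where x: "x \<in> {a..b}" "\<bar>X k + x * Y k\<bar> < s / 7" using k by (auto simp: P_def)
        have Yk: "\<bar>Y k\<bar> \<le> 1 / (7 * s)" using k s0 by (auto simp: P_def field_simps)
        have "\<bar>X k\<bar> \<le> \<bar>X k + x * Y k\<bar> + \<bar>x\<bar> * \<bar>Y k\<bar>"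
          using abs_triangle_ineq4[of "X k + x * Y k" "x * Y k"] by (simp add: abs_mult)
        also have "\<dots> \<le> s / 7 + (M + 1) * (1 / (7 * s))"
          using x Yk M by (intro add_mono mult_mono) (auto simp: M_def)
        finally have XR: "\<bar>X k\<bar> \<le> R" by (simp add: R_def)
        have "1 * (1 / (7 * s)) \<le> (M + 1) * (1 / (7 * s))" using M s0 by (intro mult_right_mono) auto
        then have YR: "\<bar>Y k\<bar> \<le> R" using Yk s0 unfolding R_def by linarith
        have m: "of_int m = X k * q' - Y k * p'" and n: "of_int n = Y k * p - X k * q"
        proof -
          have "of_int m * (p * q' - p' * q) = X k * q' - Y k * p'"
            "of_int n * (p * q' - p' * q) = Y k * p - X k * q"
            by (simp_all add: mn X_def Y_def algebra_simps)
          then show "of_int m = X k * q' - Y k * p'" "of_int n = Y k * p - X k * q" by (simp_all add: det)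
        qed
        have R0: "R \<ge> 0" using XR by linarith
        have "\<bar>u * v - u' * v'\<bar> \<le> N * R" if "\<bar>u\<bar> \<le> R" "\<bar>u'\<bar> \<le> R" "\<bar>v\<bar> + \<bar>v'\<bar> \<le> N" for u v u' v'
        proof -
          have "\<bar>u * v - u' * v'\<bar> \<le> \<bar>u\<bar> * \<bar>v\<bar> + \<bar>u'\<bar> * \<bar>v'\<bar>"
            using abs_triangle_ineq4[of "u * v" "u' * v'"] by (simp add: abs_mult)
          also have "\<dots> \<le> R * \<bar>v\<bar> + R * \<bar>v'\<bar>" using that by (intro add_mono mult_right_mono) auto
          also have "\<dots> = (\<bar>v\<bar> + \<bar>v'\<bar>) * R" by (simp add: algebra_simps)
          also have "\<dots> \<le> N * R" using that R0 by (intro mult_right_mono) auto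
          finally show ?thesis .
        qed
        from this[OF XR YR, of q' p'] this[OF YR XR, of p q]
        have "\<bar>of_int m\<bar> \<le> N * R" "\<bar>of_int n\<bar> \<le> N * R" unfolding m n by (auto simp: N_def)
        then show "k \<in> {- \<lceil>N * R\<rceil>..\<lceil>N * R\<rceil>} \<times> {- \<lceil>N * R\<rceil>..\<lceil>N * R\<rceil>}"
          unfolding mn by (auto simp: abs_le_iff) linarith+
      qed
      then show ?thesis by (rule finite_subset) auto
    qed
    define c where "c k = - X k / Y k" for k
    \<comment> \<open>Parallel vectors share the centre \<open>c k\<close>. Indexing by the centre
      and keeping the largest radius counts each direction once.\<close>
    define \<rho> where "\<rho> \<xi> = Max ((\<lambda>k. s / \<bar>Y k\<bar>) ` {k \<in> P. c k = \<xi>})" for \<xi>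
    have \<rho>_ge: "s / \<bar>Y k\<bar> \<le> \<rho> (c k)" if "k \<in> P" for k
      unfolding \<rho>_def using that fin by (intro Max_ge) auto
    have \<rho>_in: "\<exists>k \<in> P. c k = \<xi> \<and> \<rho> \<xi> = s / \<bar>Y k\<bar>" if "\<xi> \<in> c ` P" for \<xi>
    proof -
      have "\<rho> \<xi> \<in> (\<lambda>k. s / \<bar>Y k\<bar>) ` {k \<in> P. c k = \<xi>}"
        unfolding \<rho>_def using that fin by (intro Max_in) auto
      then show ?thesis by auto
    qed
    have lin: "\<bar>X k + x * Y k\<bar> = \<bar>x - c k\<bar> * \<bar>Y k\<bar>" if "k \<in> P" for k x
    proof -
      have "X k + x * Y k = (x - c k) * Y k" using Ypos[OF that] by (simp add: c_def field_simps)
      then show ?thesis by (simp add: abs_mult)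
    qed
    have lin_less: "\<bar>X k + x * Y k\<bar> < e * s \<longleftrightarrow> \<bar>x - c k\<bar> < e * (s / \<bar>Y k\<bar>)" if "k \<in> P" for k x e
      unfolding lin[OF that] times_divide_eq_right pos_less_divide_eq[OF Ypos[OF that]] ..
    define I where "I e \<xi> = {\<xi> - e * \<rho> \<xi> <..< \<xi> + e * \<rho> \<xi>}" for e \<xi> :: real
    have Is: "I e \<xi> \<in> sets borel" for e \<xi> by (simp add: I_def)
    have \<rho>0: "\<rho> \<xi> > 0" if "\<xi> \<in> c ` P" for \<xi>
      using \<rho>_in[OF that] s0 Ypos by auto
    \<comment> \<open>The area spanned by two such vectors is below
      \<open>7/2 * (1/7 + 1/7) = 1\<close>, and it is an integer because the basis is unimodular.
      This is how \<open>7/2\<close> is matched to \<open>1/7\<close>.\<close>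
    have disj: "disjoint_family_on (I (7/2)) (c ` P)"
      unfolding disjoint_family_on_def
    proof (intro ballI impI, rule ccontr)
      fix \<xi> \<zeta> assume xz: "\<xi> \<in> c ` P" "\<zeta> \<in> c ` P" "\<xi> \<noteq> \<zeta>" and "I (7/2) \<xi> \<inter> I (7/2) \<zeta> \<noteq> {}"
      then obtain x where "x \<in> I (7/2) \<xi>" "x \<in> I (7/2) \<zeta>" by blast
      then have x: "\<bar>x - \<xi>\<bar> < 7/2 * \<rho> \<xi>" "\<bar>x - \<zeta>\<bar> < 7/2 * \<rho> \<zeta>"
        unfolding I_def greaterThanLessThan_iff abs_less_iff by argo+
      obtain k l where k: "k \<in> P" "c k = \<xi>" "\<rho> \<xi> = s / \<bar>Y k\<bar>" and l: "l \<in> P" "c l = \<zeta>" "\<rho> \<zeta> = s / \<bar>Y l\<bar>"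
        using \<rho>_in xz by metis
      have kx: "\<bar>X k + x * Y k\<bar> < 7/2 * s" "\<bar>X l + x * Y l\<bar> < 7/2 * s"
        using x k l by (simp_all only: lin_less)
      have Ys: "\<bar>Y k\<bar> * s < 1/7" "\<bar>Y l\<bar> * s < 1/7" using k l by (auto simp: P_def)
      have "X k * Y l - X l * Y k = (X k + x * Y k) * Y l - (X l + x * Y l) * Y k"
        by (simp add: algebra_simps)
      also have "\<bar>\<dots>\<bar> \<le> \<bar>X k + x * Y k\<bar> * \<bar>Y l\<bar> + \<bar>X l + x * Y l\<bar> * \<bar>Y k\<bar>"
        by (rule order_trans[OF abs_triangle_ineq4]) (simp add: abs_mult)
      also have "\<dots> \<le> 7/2 * s * \<bar>Y l\<bar> + 7/2 * s * \<bar>Y k\<bar>"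
        using kx by (intro add_mono mult_right_mono) auto
      also have "\<dots> < 1" using Ys by (simp add: algebra_simps)
      finally have lt: "\<bar>X k * Y l - X l * Y k\<bar> < 1" .
      have eq: "X k * Y l - X l * Y k = of_int (fst k * snd l - fst l * snd k) * (p * q' - p' * q)"
        by (simp add: X_def Y_def case_prod_beta algebra_simps)
      with lt have "\<bar>real_of_int (fst k * snd l - fst l * snd k)\<bar> < 1" by (simp add: det)
      then have "fst k * snd l - fst l * snd k = 0" by linarith
      with eq have "X k * Y l = X l * Y k" by simp
      then have "c k = c l" using Ypos[OF k(1)] Ypos[OF l(1)] by (simp add: c_def field_simps)
      with k l xz show False by simp
    qed
    have finC: "finite (c ` P)" using fin by simp
    have sub: "(\<Union>\<xi>\<in>c ` P. I (7/2) \<xi>) \<subseteq> {a - 2 * (b - a) .. b + 2 * (b - a)}"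
    proof (intro UN_least subsetI)
      fix \<xi> x assume \<xi>: "\<xi> \<in> c ` P" and x: "x \<in> I (7/2) \<xi>"
      obtain k where k: "k \<in> P" "c k = \<xi>" "\<rho> \<xi> = s / \<bar>Y k\<bar>" using \<rho>_in[OF \<xi>] by auto
      have ba: "b - a > 0" using ab by simp
      have "7/2 * s \<le> \<bar>Y k\<bar> * (b - a)" using Ylow[OF k(1)] unfolding pos_divide_le_eq[OF ba] .
      then have le: "7/2 * \<rho> \<xi> \<le> b - a"
        unfolding k(3) times_divide_eq_right pos_divide_le_eq[OF Ypos[OF k(1)]]
        by (simp only: mult.commute)
      obtain u where u: "u \<in> {a..b}" "\<bar>X k + u * Y k\<bar> < s / 7" using k(1) by (auto simp: P_def)
      have "\<bar>u - \<xi>\<bar> < 1/7 * \<rho> \<xi>" using u(2) lin_less[OF k(1), of u "1/7"] k by simp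
      with u le x \<rho>0[OF \<xi>] show "x \<in> {a - 2 * (b - a) .. b + 2 * (b - a)}"
        unfolding I_def greaterThanLessThan_iff atLeastAtMost_iff abs_less_iff by argo
    qed
    have len: "emeasure lborel (I e \<xi>) = ennreal (2 * e * \<rho> \<xi>)" if "\<xi> \<in> c ` P" "e \<ge> 0" for e \<xi>
      using \<rho>0[OF that(1)] that(2) by (simp add: I_def)
    have "(\<Sum>\<xi>\<in>c ` P. ennreal (2 * (7/2) * \<rho> \<xi>)) = (\<Sum>\<xi>\<in>c ` P. emeasure lborel (I (7/2) \<xi>))"
      using len by (intro sum.cong) auto
    also have "\<dots> = emeasure lborel (\<Union>\<xi>\<in>c ` P. I (7/2) \<xi>)"
      using disj finC by (intro sum_emeasure) (auto simp: Is)
    also have "\<dots> \<le> emeasure lborel {a - 2 * (b - a) .. b + 2 * (b - a)}"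
      using sub by (intro emeasure_mono) auto
    also have "\<dots> = ennreal (5 * (b - a))" using ab by simp
    finally have "(\<Sum>\<xi>\<in>c ` P. ennreal (7 * \<rho> \<xi>)) \<le> ennreal (5 * (b - a))" by simp
    then have "ennreal (\<Sum>\<xi>\<in>c ` P. 7 * \<rho> \<xi>) \<le> ennreal (5 * (b - a))"
      using \<rho>0 by (subst sum_ennreal[symmetric]) (auto simp: less_imp_le)
    then have tot: "7 * (\<Sum>\<xi>\<in>c ` P. \<rho> \<xi>) \<le> 5 * (b - a)" using ab by (simp add: sum_distrib_left)
    \<comment> \<open>The enlarged intervals have total length at most \<open>5 * (b - a)\<close>;
      shrinking by \<open>2/49\<close> leaves the proportion \<open>10/49 < 1/4\<close>.\<close>
    define B where "B = (\<Union>\<xi>\<in>c ` P. I (1/7) \<xi>)"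
    have "B \<in> sets lborel" unfolding B_def using finC by (intro sets.finite_UN) (auto simp: I_def)
    moreover have "emeasure lborel B \<le> ennreal ((b - a) / 4)"
    proof -
      have "emeasure lborel B \<le> (\<Sum>\<xi>\<in>c ` P. emeasure lborel (I (1/7) \<xi>))"
        unfolding B_def using finC by (intro emeasure_subadditive_finite) (auto simp: I_def)
      also have "\<dots> = (\<Sum>\<xi>\<in>c ` P. ennreal (2 * (1/7) * \<rho> \<xi>))" using len by (intro sum.cong) auto
      also have "\<dots> = ennreal (\<Sum>\<xi>\<in>c ` P. 2 * (1/7) * \<rho> \<xi>)" using \<rho>0 by (intro sum_ennreal) (auto simp: less_imp_le)
      also have "\<dots> \<le> ennreal ((b - a) / 4)"
        unfolding sum_distrib_left[symmetric] using tot ab by (intro ennreal_leI) argo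
      finally show ?thesis .
    qed
    moreover have "{x \<in> {a..b}. \<not> thick (1/7) p q p' q' (Complex x y)} \<subseteq> B"
    proof
      fix x assume "x \<in> {x \<in> {a..b}. \<not> thick (1/7) p q p' q' (Complex x y)}"
      then obtain m n :: int where x: "x \<in> {a..b}" and mn: "(m, n) \<noteq> (0, 0)"
        and lt: "cmod (of_int m * (of_real p + Complex x y * of_real q)
          + of_int n * (of_real p' + Complex x y * of_real q')) < 1/7 * s"
        by (auto simp: thick_def s_def not_le)
      define v where "v = of_int m * (of_real p + Complex x y * of_real q)
          + of_int n * (of_real p' + Complex x y * of_real q')"
      define k where "k = (m, n)"
      have v: "Re v = X k + x * Y k" "Im v = y * Y k"
        by (simp_all add: v_def k_def X_def Y_def algebra_simps)
      have ltv: "cmod v < 1/7 * s" using lt by (simp only: v_def)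
      have 1: "\<bar>X k + x * Y k\<bar> < s / 7" using abs_Re_le_cmod[of v] ltv unfolding v(1) by simp
      have "\<bar>y * Y k\<bar> < 1/7 * s" using abs_Im_le_cmod[of v] ltv unfolding v(2) by simp
      moreover have "\<bar>y * Y k\<bar> = \<bar>Y k\<bar> * s * s" using y by (simp add: abs_mult ss mult.assoc)
      ultimately have "\<bar>Y k\<bar> * s * s < 1/7 * s" by simp
      then have 2: "\<bar>Y k\<bar> * s < 1/7" using s0 by simp
      have k: "k \<in> P" using 1 2 mn x by (auto simp: P_def k_def)
      have "\<bar>x - c k\<bar> < 1/7 * (s / \<bar>Y k\<bar>)" using 1 lin_less[OF k, of x "1/7"] by simp
      also have "\<dots> \<le> 1/7 * \<rho> (c k)" using \<rho>_ge[OF k] by simp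
      finally have "x \<in> I (1/7) (c k)" unfolding I_def greaterThanLessThan_iff abs_less_iff by argo
      then show "x \<in> B" using k by (auto simp: B_def)
    qed
    ultimately show ?thesis by blast
  qed
  moreover have "y0 > 0" using N C by (simp add: y0_def)
  ultimately show thesis using that by blast
qed

section \<open>Limsup sets of intervals in a grid\<close>

text \<open>Integrate \<open>1 \<ge> 2 c s - c\<^sup>2 s\<^sup>2\<close>, where \<open>s\<close> counts the sets containing the point.\<close>

lemma second_moment_lower_bound:
  fixes A :: "'i \<Rightarrow> 'a set" and c :: real
  assumes F: "finite F" and A: "\<And>n. n \<in> F \<Longrightarrow> A n \<in> fmeasurable M"
  shows "2 * c * (\<Sum>n\<in>F. measure M (A n)) - c\<^sup>2 * (\<Sum>m\<in>F. \<Sum>n\<in>F. measure M (A m \<inter> A n))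
    \<le> measure M (\<Union>n\<in>F. A n)"
proof -
  have int: "integrable M (\<lambda>x. indicator (A n) x :: real)" "integrable M (\<lambda>x. indicator (A m \<inter> A n) x :: real)"
    if "m \<in> F" "n \<in> F" for m n
    using A[OF that(1)] A[OF that(2)]
    by (auto intro!: integrable_real_indicator simp: fmeasurable_def
        intro: le_less_trans[OF emeasure_mono[of "A m \<inter> A n" "A n"]])
  have U: "(\<Union>n\<in>F. A n) \<in> fmeasurable M" using F A by (intro fmeasurable.finite_UN) auto
  have "(\<integral>x. 2 * c * (\<Sum>n\<in>F. indicator (A n) x) - c\<^sup>2 * (\<Sum>m\<in>F. \<Sum>n\<in>F. indicator (A m \<inter> A n) x) \<partial>M)
      \<le> (\<integral>x. indicator (\<Union>n\<in>F. A n) x \<partial>M :: real)"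
  proof (rule integral_mono)
    show "integrable M (\<lambda>x. 2 * c * (\<Sum>n\<in>F. indicator (A n) x)
        - c\<^sup>2 * (\<Sum>m\<in>F. \<Sum>n\<in>F. indicator (A m \<inter> A n) x))"
      using int by (intro Bochner_Integration.integrable_diff integrable_mult_right Bochner_Integration.integrable_sum) auto
    show "integrable M (\<lambda>x. indicator (\<Union>n\<in>F. A n) x :: real)"
      using U by (intro integrable_real_indicator) (auto simp: fmeasurable_def)
    fix x
    define s :: real where "s = (\<Sum>n\<in>F. indicator (A n) x)"
    have sq: "(\<Sum>m\<in>F. \<Sum>n\<in>F. indicator (A m \<inter> A n) x) = s\<^sup>2"
      unfolding s_def power2_eq_square sum_product by (simp add: indicator_inter_arith)
    show "2 * c * (\<Sum>n\<in>F. indicator (A n) x) - c\<^sup>2 * (\<Sum>m\<in>F. \<Sum>n\<in>F. indicator (A m \<inter> A n) x)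
        \<le> (indicator (\<Union>n\<in>F. A n) x :: real)"
    proof (cases "x \<in> (\<Union>n\<in>F. A n)")
      case True
      have "0 \<le> (1 - c * s)\<^sup>2" by simp
      then show ?thesis using True unfolding sq s_def[symmetric]
        by (simp add: power2_eq_square algebra_simps)
    next
      case False
      then have "s = 0" unfolding s_def by (intro sum.neutral) auto
      then show ?thesis using False unfolding sq s_def[symmetric] by simp
    qed
  qed
  also have "(\<integral>x. indicator (\<Union>n\<in>F. A n) x \<partial>M :: real) = measure M (\<Union>n\<in>F. A n)"
    using U sets.sets_into_space[of _ M] by (auto simp: fmeasurable_def Int_absorb1)
  also have "(\<integral>x. 2 * c * (\<Sum>n\<in>F. indicator (A n) x) - c\<^sup>2 * (\<Sum>m\<in>F. \<Sum>n\<in>F. indicator (A m \<inter> A n) x) \<partial>M)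
      = 2 * c * (\<Sum>n\<in>F. measure M (A n)) - c\<^sup>2 * (\<Sum>m\<in>F. \<Sum>n\<in>F. measure M (A m \<inter> A n))"
  proof -
    have "A n \<inter> space M = A n" "A m \<inter> A n \<inter> space M = A m \<inter> A n" if "m \<in> F" "n \<in> F" for m n
      using A[OF that(2)] sets.sets_into_space[of "A n" M] by (auto simp: fmeasurable_def)
    then show ?thesis using int
      by (subst Bochner_Integration.integral_diff) (auto intro!: sum.cong)
  qed
  finally show ?thesis .
qed

lemma card_nat_interval_le:
  fixes u v :: real
  assumes H: "\<And>i. i \<in> H \<Longrightarrow> u \<le> real i \<and> real i \<le> v" and fin: "finite H" and uv: "u \<le> v + 1"
  shows "real (card H) \<le> v - u + 1"
proof (cases "H = {}")
  case True
  then show ?thesis using uv by simp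
next
  case False
  have "H \<subseteq> {Min H..Max H}" using fin by auto
  then have "card H \<le> card {Min H..Max H}" by (intro card_mono) auto
  moreover have "Min H \<le> Max H" using fin False by simp
  ultimately have "card H + Min H \<le> Max H + 1" by simp
  then have "real (card H) + real (Min H) \<le> real (Max H) + 1" by linarith
  moreover have "u \<le> real (Min H)" "real (Max H) \<le> v" using H fin False by auto
  ultimately show ?thesis by linarith
qed

lemma geometric_sum_4: "(\<Sum>m\<le>n. 4 ^ m) \<le> (4/3 :: real) * 4 ^ n"
  by (induction n) auto

lemma not_summable_tail_sum:
  fixes \<psi> :: "nat \<Rightarrow> real"
  assumes ns: "\<not> summable \<psi>" and \<psi>: "\<And>n. 0 \<le> \<psi> n"
  obtains N where "K < (\<Sum>n\<in>{k..<N}. \<psi> n)"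
proof (rule ccontr)
  assume no: "\<not> thesis"
  have "(\<Sum>i<n. \<psi> (i + k)) \<le> K" for n
  proof -
    have "(\<Sum>i<n. \<psi> (i + k)) = (\<Sum>i\<in>{k..<n + k}. \<psi> i)"
      using sum.shift_bounds_nat_ivl[of \<psi> 0 k n] by (simp add: atLeast0LessThan)
    also have "\<dots> \<le> K" using no that by (meson not_le)
    finally show ?thesis .
  qed
  then have "summable (\<lambda>i. \<psi> (i + k))" using \<psi> by (intro summableI_nonneg_bounded) auto
  then show False using ns summable_iff_shift by blast
qed

text \<open>At level \<open>n\<close> the interval \<open>[a, b]\<close> is cut into \<open>4 ^ n\<close> cells, and at least half of
  them contain an interval centred at \<open>\<xi> n j\<close> whose radius is \<open>c * \<psi> n\<close> times the cell length.
  The limsup set of these intervals fills a fifth of \<open>[a, b]\<close>, whatever the value of \<open>c\<close>.\<close>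

locale grid_intervals =
  fixes a b c :: real and \<psi> :: "nat \<Rightarrow> real" and G :: "nat \<Rightarrow> nat set"
    and \<xi> :: "nat \<Rightarrow> nat \<Rightarrow> real" and n0 :: nat
  assumes ab: "a < b" and c: "0 < c" and \<psi>: "\<And>n. 0 \<le> \<psi> n" and ns: "\<not> summable \<psi>"
    and G: "\<And>n. n \<ge> n0 \<Longrightarrow> G n \<subseteq> {..<4 ^ n}" "\<And>n. n \<ge> n0 \<Longrightarrow> 4 ^ n \<le> 2 * card (G n)"
    and cell: "\<And>n j. n \<ge> n0 \<Longrightarrow> j \<in> G n \<Longrightarrow>
       a + real j * ((b - a) / 4 ^ n) \<le> \<xi> n j - c * ((b - a) / 4 ^ n) * \<psi> n \<and>
       \<xi> n j + c * ((b - a) / 4 ^ n) * \<psi> n < a + (real j + 1) * ((b - a) / 4 ^ n)"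
begin

definition h :: "nat \<Rightarrow> real" where "h n = (b - a) / 4 ^ n"
definition r :: "nat \<Rightarrow> real" where "r n = c * h n * \<psi> n"
definition J :: "nat \<Rightarrow> nat \<Rightarrow> real set" where "J n j = {\<xi> n j - r n .. \<xi> n j + r n}"
definition A :: "nat \<Rightarrow> real set" where "A n = (\<Union>j\<in>G n. J n j)"

lemma h_pos: "h n > 0" using ab by (simp add: h_def)
lemma r_nonneg: "r n \<ge> 0" using h_pos[of n] c \<psi>[of n] by (simp add: r_def)

lemma J_bounds:
  assumes "n \<ge> n0" "j \<in> G n" "x \<in> J n j"
  shows "a + real j * h n \<le> x" "x < a + (real j + 1) * h n"
  using cell[OF assms(1,2)] assms(3) unfolding J_def r_def h_def atLeastAtMost_iff by linarith+

lemma finite_G: "n \<ge> n0 \<Longrightarrow> finite (G n)"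
  using G(1) finite_subset by blast

lemma A_sets: "A n \<in> sets lborel"
  unfolding A_def J_def by (intro sets.countable_UN') auto

lemma A_subset: assumes n: "n \<ge> n0" shows "A n \<subseteq> {a..b}"
proof
  fix x assume "x \<in> A n"
  then obtain j where j: "j \<in> G n" "x \<in> J n j" by (auto simp: A_def)
  note x = J_bounds[OF n j]
  have "0 \<le> j * h n" using h_pos[of n] by simp
  moreover have "(real j + 1) * h n \<le> 4 ^ n * h n"
  proof (intro mult_right_mono)
    have "j + 1 \<le> 4 ^ n" using G(1)[OF n] j by (auto simp: Suc_le_eq)
    then have "real (j + 1) \<le> real (4 ^ n)" by (simp only: of_nat_le_iff)
    then show "real j + 1 \<le> 4 ^ n" by simp
  qed (use h_pos[of n] in auto)
  moreover have "4 ^ n * h n = b - a" by (simp add: h_def)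
  ultimately show "x \<in> {a..b}" using x by auto
qed

lemma A_fmeasurable: "n \<ge> n0 \<Longrightarrow> A n \<in> fmeasurable lborel"
  by (rule fmeasurableI2[OF _ A_subset A_sets]) (auto simp: fmeasurable_def emeasure_lborel_Icc_eq)

lemma measure_J: "measure lborel (J n j) = 2 * r n"
  using r_nonneg[of n] by (simp add: J_def)

lemma J_fmeasurable: "J n j \<in> fmeasurable lborel"
  by (simp add: J_def fmeasurable_def emeasure_lborel_Icc_eq)

lemma measure_A:
  assumes n: "n \<ge> n0" shows "c * (b - a) * \<psi> n \<le> measure lborel (A n)"
proof -
  have "disjoint_family_on (J n) (G n)"
    unfolding disjoint_family_on_def
  proof (intro ballI impI, rule ccontr)
    fix i j assume ij: "i \<in> G n" "j \<in> G n" "i \<noteq> j" "J n i \<inter> J n j \<noteq> {}"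
    then obtain x where x: "x \<in> J n i" "x \<in> J n j" by auto
    have "real i * h n < (real j + 1) * h n" "real j * h n < (real i + 1) * h n"
      using J_bounds[OF n ij(1) x(1)] J_bounds[OF n ij(2) x(2)] by linarith+
    then have "real i < real j + 1" "real j < real i + 1" using h_pos[of n] by simp_all
    then show False using ij by linarith
  qed
  then have "measure lborel (A n) = (\<Sum>j\<in>G n. measure lborel (J n j))"
    unfolding A_def
  proof (intro measure_finite_Union image_subsetI)
    show "J n j \<in> sets lborel" for j by (simp add: J_def)
    show "emeasure lborel (J n j) \<noteq> \<infinity>" for j by (simp add: J_def emeasure_lborel_Icc_eq)
  qed (use finite_G[OF n] in auto)
  also have "\<dots> = card (G n) * (2 * r n)" by (simp add: measure_J)
  also have "\<dots> \<ge> 4 ^ n * r n"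
  proof -
    have "real (4 ^ n) \<le> real (2 * card (G n))" using G(2)[OF n] by (simp only: of_nat_le_iff)
    then have "4 ^ n * r n \<le> (2 * card (G n)) * r n" using r_nonneg[of n] by (intro mult_right_mono) auto
    then show ?thesis by simp
  qed
  also have "4 ^ n * r n = c * (b - a) * \<psi> n" by (simp add: r_def h_def)
  finally show ?thesis .
qed

text \<open>At most \<open>2 * r m / h n + 2\<close> fine cells meet a coarse interval. The first
  term yields the bound that independence would give, up to a constant; the two boundary cells yield
  an error that decays geometrically in \<open>n - m\<close>.\<close>

lemma measure_A_Int:
  assumes m: "m \<ge> n0" and mn: "m \<le> n"
  shows "measure lborel (A m \<inter> A n) \<le> (b - a) * (4 * c\<^sup>2 * \<psi> m * \<psi> n + 4 * c * (4 ^ m / 4 ^ n) * \<psi> n)"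
proof -
  have n: "n \<ge> n0" using m mn by simp
  define H where "H j = {i \<in> G n. J n i \<inter> J m j \<noteq> {}}" for j
  have fH: "finite (H j)" for j using finite_G[OF n] by (simp add: H_def)
  have cH: "real (card (H j)) \<le> 2 * r m / h n + 2" for j
  proof -
    have "(\<xi> m j - r m - a) / h n - 1 \<le> real i \<and> real i \<le> (\<xi> m j + r m - a) / h n" if "i \<in> H j" for i
    proof -
      obtain x where x: "i \<in> G n" "x \<in> J n i" "x \<in> J m j" using \<open>i \<in> H j\<close> by (auto simp: H_def)
      have "\<xi> m j - r m \<le> x" "x \<le> \<xi> m j + r m" using x(3) by (auto simp: J_def)
      then have "\<xi> m j - r m - a \<le> (real i + 1) * h n" "real i * h n \<le> \<xi> m j + r m - a"
        using J_bounds[OF n x(1,2)] by linarith+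
      then have "(\<xi> m j - r m - a) / h n \<le> real i + 1" "real i \<le> (\<xi> m j + r m - a) / h n"
        using h_pos[of n] by (simp_all add: pos_divide_le_eq pos_le_divide_eq)
      then show ?thesis by simp
    qed
    then have "real (card (H j)) \<le> (\<xi> m j + r m - a) / h n - ((\<xi> m j - r m - a) / h n - 1) + 1"
    proof (rule card_nat_interval_le)
      show "(\<xi> m j - r m - a) / h n - 1 \<le> (\<xi> m j + r m - a) / h n + 1"
        using r_nonneg[of m] h_pos[of n] by (smt (verit) divide_right_mono)
    qed (use fH in auto)
    also have "\<dots> = 2 * r m / h n + 2" by (simp add: field_simps add_divide_distrib diff_divide_distrib)
    finally show ?thesis .
  qed
  have "A m \<inter> A n \<subseteq> (\<Union>j\<in>G m. \<Union>i\<in>H j. J n i)" by (auto simp: A_def H_def)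
  then have "measure lborel (A m \<inter> A n) \<le> measure lborel (\<Union>j\<in>G m. \<Union>i\<in>H j. J n i)"
    using A_sets finite_G[OF m] fH J_fmeasurable
    by (intro measure_mono_fmeasurable fmeasurable.finite_UN) auto
  also have "\<dots> \<le> (\<Sum>j\<in>G m. measure lborel (\<Union>i\<in>H j. J n i))"
    using finite_G[OF m] fH J_fmeasurable
    by (intro measure_UNION_le fmeasurableD fmeasurable.finite_UN) auto
  also have "\<dots> \<le> (\<Sum>j\<in>G m. \<Sum>i\<in>H j. measure lborel (J n i))"
    using fH J_fmeasurable by (intro sum_mono measure_UNION_le fmeasurableD) auto
  also have "\<dots> = (\<Sum>j\<in>G m. card (H j) * (2 * r n))" by (simp add: measure_J)
  also have "\<dots> \<le> (\<Sum>j\<in>G m. (2 * r m / h n + 2) * (2 * r n))"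
    using cH r_nonneg[of n] by (intro sum_mono mult_right_mono) auto
  also have "\<dots> = card (G m) * ((2 * r m / h n + 2) * (2 * r n))" by simp
  also have "\<dots> \<le> 4 ^ m * ((2 * r m / h n + 2) * (2 * r n))"
  proof (intro mult_right_mono)
    have "card (G m) \<le> 4 ^ m" using card_mono[OF _ G(1)[OF m]] by simp
    then have "real (card (G m)) \<le> real (4 ^ m)" by (simp only: of_nat_le_iff)
    then show "real (card (G m)) \<le> 4 ^ m" by simp
    show "0 \<le> (2 * r m / h n + 2) * (2 * r n)"
      using r_nonneg[of n] r_nonneg[of m] h_pos[of n] by (intro mult_nonneg_nonneg add_nonneg_nonneg) auto
  qed
  also have "\<dots> = (b - a) * (4 * c\<^sup>2 * \<psi> m * \<psi> n + 4 * c * (4 ^ m / 4 ^ n) * \<psi> n)"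
    using ab by (simp add: r_def h_def field_simps power2_eq_square)
  finally show ?thesis .
qed

text \<open>Over a block with \<open>s = c * (\<Sum>n. \<psi> n) > 11\<close> the boundary errors,
  at most \<open>2 * 16/3 * s\<close>, are absorbed into \<open>s^2\<close>, so the second moment is
  at most \<open>5 * s^2\<close> against a first moment of at least \<open>s\<close> (in units of
  \<open>b - a\<close>). Since \<psi> is not summable, such a block exists for every
  \<open>c > 0\<close>, which is why the resulting proportion does not depend on
  \<open>c\<close>.\<close>

lemma measure_Union_A:
  assumes k: "k \<ge> n0"
  obtains N where "(b - a) / 5 \<le> measure lborel (\<Union>n\<in>{k..<N}. A n)"
proof -
  obtain N where N: "11 / c < (\<Sum>n\<in>{k..<N}. \<psi> n)"
    using not_summable_tail_sum[OF ns \<psi>] by blast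
  define F where "F = {k..<N}"
  define S where "S = (\<Sum>n\<in>F. \<psi> n)"
  define s where "s = c * S"
  define L where "L = b - a"
  have L: "L > 0" using ab by (simp add: L_def)
  have s: "s > 11" using N c by (simp add: s_def S_def F_def field_simps)
  have Fk: "n \<ge> n0" if "n \<in> F" for n using that k by (simp add: F_def)
  have fin: "finite F" by (simp add: F_def)
  have sum1: "L * s \<le> (\<Sum>n\<in>F. measure lborel (A n))"
  proof -
    have "L * s = (\<Sum>n\<in>F. c * (b - a) * \<psi> n)"
      by (simp add: s_def S_def L_def sum_distrib_left mult_ac)
    also have "\<dots> \<le> (\<Sum>n\<in>F. measure lborel (A n))" using Fk measure_A by (intro sum_mono) auto
    finally show ?thesis .
  qed
  \<comment> \<open>The boundary error, kept only for \<open>m \<le> n\<close>. Adding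
    \<open>g n m\<close> makes the pair bound symmetric, with the diagonal harmlessly counted
    twice.\<close>
  define g where "g m n = (if m \<le> n then 4 * c * (4 ^ m / 4 ^ n) * \<psi> n else 0)" for m n :: nat
  have g0: "g m n \<ge> 0" for m n using c \<psi>[of n] by (simp add: g_def)
  have pair: "measure lborel (A m \<inter> A n) \<le> L * (4 * c\<^sup>2 * \<psi> m * \<psi> n + g m n + g n m)"
    if "m \<in> F" "n \<in> F" for m n
  proof -
    have *: "measure lborel (A m \<inter> A n) \<le> L * (4 * c\<^sup>2 * \<psi> m * \<psi> n + g m n)"
      if "m \<in> F" "m \<le> n" for m n
      using measure_A_Int[OF Fk[OF that(1)] that(2)] that(2) by (simp add: g_def L_def)
    have **: "L * g i j \<ge> 0" for i j using L g0 by simp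
    show ?thesis
    proof (cases "m \<le> n")
      case True
      then show ?thesis using *[OF that(1) True] **[of n m] by (simp add: distrib_left)
    next
      case False
      then have "measure lborel (A n \<inter> A m) \<le> L * (4 * c\<^sup>2 * \<psi> n * \<psi> m + g n m)" using *[OF that(2)] by simp
      then show ?thesis using **[of m n] by (simp add: distrib_left Int_commute mult_ac)
    qed
  qed
  have gsum: "(\<Sum>m\<in>F. \<Sum>n\<in>F. g m n) \<le> 16/3 * s"
  proof -
    have "(\<Sum>m\<in>F. g m n) \<le> 4 * c * \<psi> n * (4/3)" for n
    proof -
      have "(\<Sum>m\<in>F. g m n) = (\<Sum>m\<in>F \<inter> {..n}. 4 * c * (4 ^ m / 4 ^ n) * \<psi> n)"
        unfolding g_def by (rule sum.mono_neutral_cong_right) (use fin in auto)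
      also have "\<dots> \<le> (\<Sum>m\<le>n. 4 * c * (4 ^ m / 4 ^ n) * \<psi> n)"
        using c \<psi>[of n] by (intro sum_mono2) auto
      also have "\<dots> = 4 * c * \<psi> n * ((\<Sum>m\<le>n. 4 ^ m) / 4 ^ n)"
        by (simp add: sum_distrib_left sum_divide_distrib mult_ac)
      also have "\<dots> \<le> 4 * c * \<psi> n * (4/3)"
        using geometric_sum_4[of n] c \<psi>[of n] by (intro mult_left_mono) (auto simp: divide_le_eq)
      finally show ?thesis .
    qed
    then have "(\<Sum>n\<in>F. \<Sum>m\<in>F. g m n) \<le> (\<Sum>n\<in>F. 4 * c * \<psi> n * (4/3))" by (intro sum_mono)
    also have "\<dots> = 16/3 * s" by (simp add: s_def S_def sum_distrib_left mult_ac)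
    finally show ?thesis by (subst sum.swap)
  qed
  have "(\<Sum>m\<in>F. \<Sum>n\<in>F. measure lborel (A m \<inter> A n))
      \<le> (\<Sum>m\<in>F. \<Sum>n\<in>F. L * (4 * c\<^sup>2 * \<psi> m * \<psi> n + g m n + g n m))"
    using pair by (intro sum_mono) auto
  also have "\<dots> = L * ((\<Sum>m\<in>F. \<Sum>n\<in>F. 4 * c\<^sup>2 * \<psi> m * \<psi> n) + (\<Sum>m\<in>F. \<Sum>n\<in>F. g m n) + (\<Sum>m\<in>F. \<Sum>n\<in>F. g n m))"
    by (simp only: sum.distrib sum_distrib_left distrib_left)
  also have "(\<Sum>m\<in>F. \<Sum>n\<in>F. g n m) = (\<Sum>m\<in>F. \<Sum>n\<in>F. g m n)" by (rule sum.swap)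
  also have "(\<Sum>m\<in>F. \<Sum>n\<in>F. 4 * c\<^sup>2 * \<psi> m * \<psi> n) = 4 * s\<^sup>2"
    by (simp add: s_def S_def power2_eq_square sum_product sum_distrib_left mult_ac)
  also have "L * (4 * s\<^sup>2 + (\<Sum>m\<in>F. \<Sum>n\<in>F. g m n) + (\<Sum>m\<in>F. \<Sum>n\<in>F. g m n)) \<le> L * (5 * s\<^sup>2)"
  proof (intro mult_left_mono)
    have "11 * s \<le> s\<^sup>2" using s by (simp add: power2_eq_square)
    then show "4 * s\<^sup>2 + (\<Sum>m\<in>F. \<Sum>n\<in>F. g m n) + (\<Sum>m\<in>F. \<Sum>n\<in>F. g m n) \<le> 5 * s\<^sup>2"
      using gsum s by linarith
  qed (use L in auto)
  finally have sum2: "(\<Sum>m\<in>F. \<Sum>n\<in>F. measure lborel (A m \<inter> A n)) \<le> L * (5 * s\<^sup>2)" .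
  \<comment> \<open>The maximiser of \<open>2 * t * s - t^2 * 5 * s^2\<close>, with value
    \<open>1/5\<close>.\<close>
  define t where "t = 1 / (5 * s)"
  have t: "t > 0" using s by (simp add: t_def)
  have "L / 5 = 2 * t * (L * s) - t\<^sup>2 * (L * (5 * s\<^sup>2))"
    using s by (simp add: t_def field_simps power2_eq_square)
  also have "\<dots> \<le> 2 * t * (\<Sum>n\<in>F. measure lborel (A n)) - t\<^sup>2 * (\<Sum>m\<in>F. \<Sum>n\<in>F. measure lborel (A m \<inter> A n))"
    using sum1 sum2 t by (intro diff_mono mult_left_mono) auto
  also have "\<dots> \<le> measure lborel (\<Union>n\<in>F. A n)"
    using fin Fk A_fmeasurable by (intro second_moment_lower_bound) auto
  finally show thesis using that by (simp add: L_def F_def)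
qed

lemma emeasure_limsup_A: "ennreal ((b - a) / 5) \<le> emeasure lborel (\<Inter>k. \<Union>n\<in>{n0 + k..}. A n)"
proof -
  define U where "U k = (\<Union>n\<in>{n0 + k..}. A n)" for k
  have U: "U k \<in> sets lborel" for k unfolding U_def using A_sets by (intro sets.countable_UN') auto
  have Uab: "U k \<subseteq> {a..b}" for k unfolding U_def by (intro UN_least A_subset) auto
  have fin: "emeasure lborel (U k) \<noteq> \<infinity>" for k
    using emeasure_mono[OF Uab[of k], of lborel] ab by (auto simp: top_unique)
  have dec: "decseq U" unfolding decseq_def U_def by (intro allI impI UN_mono) auto
  have "ennreal ((b - a) / 5) \<le> emeasure lborel (U k)" for k
  proof -
    obtain N where N: "(b - a) / 5 \<le> measure lborel (\<Union>n\<in>{n0 + k..<N}. A n)"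
      using measure_Union_A[of "n0 + k"] by auto
    have fm: "(\<Union>n\<in>{n0 + k..<N}. A n) \<in> fmeasurable lborel"
      using A_fmeasurable by (intro fmeasurable.finite_UN) auto
    have "ennreal ((b - a) / 5) \<le> emeasure lborel (\<Union>n\<in>{n0 + k..<N}. A n)"
      using N by (subst emeasure_eq_measure2[OF fm]) (rule ennreal_leI)
    also have "\<dots> \<le> emeasure lborel (U k)" using U by (intro emeasure_mono) (auto simp: U_def)
    finally show ?thesis .
  qed
  then have "ennreal ((b - a) / 5) \<le> (INF k. emeasure lborel (U k))" by (intro INF_greatest)
  also have "\<dots> = emeasure lborel (\<Inter>k. U k)" using U dec fin by (intro INF_emeasure_decseq) auto
  finally show ?thesis by (simp add: U_def)
qed

end

section \<open>Sets of positive proportion in every interval\<close>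

text \<open>An elementary substitute for Lebesgue density. If a compact \<open>K\<close> of measure
  \<open>m > 0\<close> missed \<open>E\<close>, small cells meeting \<open>K\<close> would have
  total length at most \<open>(1 + c) * m\<close>, and \<open>E\<close> would take the proportion
  \<open>c\<close> of each, leaving \<open>m \<le> (1 - c) * (1 + c) * m < m\<close>.\<close>

lemma AE_if_positive_proportion:
  fixes E :: "real set" and c :: real
  assumes E: "E \<in> sets lborel" and c: "0 < c"
    and dens: "\<And>a b. a < b \<Longrightarrow> ennreal (c * (b - a)) \<le> emeasure lborel (E \<inter> {a..b})"
  shows "AE x in lborel. x \<in> E"
proof -
  have compact_null: "measure lborel K = 0" if K: "compact K" "K \<inter> E = {}" for K
  proof (rule ccontr)
    assume nz: "measure lborel K \<noteq> 0"
    define m where "m = measure lborel K"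
    have m: "m > 0" using nz by (simp add: m_def zero_less_measure_iff)
    have eK: "emeasure lborel K = ennreal m"
      unfolding m_def using emeasure_compact_finite[OF K(1)] by (simp add: emeasure_eq_ennreal_measure top.not_eq_extremum)
    have Ks: "K \<in> sets borel" using K(1) by (simp add: borel_compact)
    obtain U where U: "open U" "K \<subseteq> U" "emeasure lborel (U - K) < ennreal (c * m)"
      using outer_regular_lborel[OF Ks, of "c * m"] c m by auto
    have "emeasure lborel U = emeasure lborel K + emeasure lborel (U - K)"
      using U Ks by (subst plus_emeasure) (auto simp: Un_absorb1)
    also have "\<dots> \<le> ennreal m + ennreal (c * m)" using U(3) by (intro add_mono) (auto simp: eK)
    also have "\<dots> = ennreal (m + c * m)" using c m by (simp add: ennreal_plus)
    finally have eU: "emeasure lborel U \<le> ennreal (m + c * m)" .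
    obtain \<delta> where \<delta>: "\<delta> > 0" "(\<Union>x\<in>K. ball x \<delta>) \<subseteq> U"
      using compact_subset_open_imp_ball_epsilon_subset[OF K(1) U(1,2)] by blast
    \<comment> \<open>With this mesh a cell that meets \<open>K\<close> lies entirely in
      \<open>U\<close>.\<close>
    define d where "d = \<delta> / 2"
    have d: "d > 0" using \<delta> by (simp add: d_def)
    define C where "C j = {of_int j * d ..< (of_int j + 1) * d}" for j :: int
    have C: "x \<in> C j \<longleftrightarrow> j = \<lfloor>x / d\<rfloor>" for x j
      unfolding C_def using d by (auto simp: floor_eq_iff field_simps eq_commute[of j])
    define Z where "Z = (\<lambda>x. \<lfloor>x / d\<rfloor>) ` K"
    obtain R where R: "\<And>x. x \<in> K \<Longrightarrow> \<bar>x\<bar> \<le> R"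
      using compact_imp_bounded[OF K(1)] by (auto simp: bounded_iff)
    have "Z \<subseteq> {\<lfloor>- R / d\<rfloor>..\<lfloor>R / d\<rfloor>}"
    proof
      fix j assume "j \<in> Z"
      then obtain x where x: "x \<in> K" "j = \<lfloor>x / d\<rfloor>" by (auto simp: Z_def)
      have "- R / d \<le> x / d" "x / d \<le> R / d" using R[OF x(1)] d by (intro divide_right_mono; simp add: abs_le_iff)+
      then show "j \<in> {\<lfloor>- R / d\<rfloor>..\<lfloor>R / d\<rfloor>}" using x by (auto intro: floor_mono)
    qed
    then have fZ: "finite Z" by (rule finite_subset) auto
    have Cs: "C j \<in> sets lborel" for j by (simp add: C_def)
    have Cl: "emeasure lborel (C j) = ennreal d" for j
      using d by (simp add: C_def algebra_simps)
    have disj: "disjoint_family_on C Z" by (auto simp: disjoint_family_on_def C)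
    have CU: "(\<Union>j\<in>Z. C j) \<subseteq> U"
    proof (intro UN_least subsetI)
      fix j y assume j: "j \<in> Z" and y: "y \<in> C j"
      obtain x where x: "x \<in> K" "x \<in> C j" using j C by (auto simp: Z_def)
      have "\<bar>x - y\<bar> < \<delta>" using x(2) y d by (auto simp: C_def d_def algebra_simps abs_if)
      then have "y \<in> ball x \<delta>" by (simp add: dist_real_def)
      then show "y \<in> U" using \<delta>(2) x(1) by blast
    qed
    have "(\<Sum>j\<in>Z. ennreal d) = (\<Sum>j\<in>Z. emeasure lborel (C j))" by (simp add: Cl)
    also have "\<dots> = emeasure lborel (\<Union>j\<in>Z. C j)"
      using fZ Cs disj by (intro sum_emeasure) auto
    also have "\<dots> \<le> emeasure lborel U" using CU U(1) by (intro emeasure_mono) auto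
    also have "\<dots> \<le> ennreal (m + c * m)" by (rule eU)
    finally have "ennreal (card Z * d) \<le> ennreal (m + c * m)"
      using d by (simp add: ennreal_of_nat_eq_real_of_nat ennreal_mult)
    then have cd: "card Z * d \<le> m + c * m" using c m by (subst (asm) ennreal_le_iff) auto
    have KC: "emeasure lborel (K \<inter> C j) + ennreal (c * d) \<le> ennreal d" for j
    proof -
      define I where "I = {of_int j * d .. (of_int j + 1) * d}"
      have "ennreal (c * d) \<le> emeasure lborel (E \<inter> I)"
        using dens[of "of_int j * d" "(of_int j + 1) * d"] d by (simp add: I_def algebra_simps)
      then have "emeasure lborel (K \<inter> C j) + ennreal (c * d) \<le> emeasure lborel (K \<inter> I) + emeasure lborel (E \<inter> I)"
        using Ks by (intro add_mono emeasure_mono) (auto simp: C_def I_def)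
      also have "\<dots> = emeasure lborel ((K \<inter> I) \<union> (E \<inter> I))"
        using Ks E K(2) by (intro plus_emeasure) (auto simp: I_def)
      also have "\<dots> \<le> emeasure lborel I" by (intro emeasure_mono) (auto simp: I_def)
      also have "\<dots> = ennreal d" using d by (simp add: I_def algebra_simps)
      finally show ?thesis .
    qed
    have cd0: "c * d \<ge> 0" using c d by simp
    have "emeasure lborel K + (\<Sum>j\<in>Z. ennreal (c * d)) \<le> (\<Sum>j\<in>Z. emeasure lborel (K \<inter> C j)) + (\<Sum>j\<in>Z. ennreal (c * d))"
    proof (intro add_right_mono)
      have "emeasure lborel K = emeasure lborel (\<Union>j\<in>Z. K \<inter> C j)"
        by (rule arg_cong[of _ _ "emeasure lborel"]) (auto simp: Z_def C)
      also have "\<dots> \<le> (\<Sum>j\<in>Z. emeasure lborel (K \<inter> C j))"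
        using fZ Ks Cs by (intro emeasure_subadditive_finite) auto
      finally show "emeasure lborel K \<le> (\<Sum>j\<in>Z. emeasure lborel (K \<inter> C j))" .
    qed
    also have "\<dots> \<le> (\<Sum>j\<in>Z. ennreal d)" unfolding sum.distrib[symmetric] using KC by (intro sum_mono)
    finally have "ennreal (m + card Z * (c * d)) \<le> ennreal (card Z * d)"
      using d m cd0 by (simp add: eK ennreal_of_nat_eq_real_of_nat ennreal_mult ennreal_plus)
    then have "m + card Z * (c * d) \<le> card Z * d" using d by simp
    then have "m \<le> (1 - c) * (card Z * d)" by (simp add: algebra_simps)
    also have "\<dots> \<le> (1 - c) * (m + c * m)"
    proof (cases "c \<le> 1")
      case True
      then show ?thesis using cd by (intro mult_left_mono) auto
    next
      case False
      then have "(1 - c) * (card Z * d) \<le> 0" using d by (intro mult_nonpos_nonneg) auto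
      with \<open>m \<le> _\<close> m show ?thesis by linarith
    qed
    also have "\<dots> = m - c * c * m" by (simp add: algebra_simps)
    finally show False using c m by (simp add: mult_le_0_iff not_le)
  qed
  define B where "B k = {- real k..real k} - E" for k :: nat
  have "emeasure lborel (B k) = 0" for k
  proof (rule ccontr)
    assume nz: "emeasure lborel (B k) \<noteq> 0"
    have Bs: "B k \<in> sets lborel" using E by (simp add: B_def)
    \<comment> \<open>An open \<open>U\<close> containing \<open>E\<close> makes
      \<open>{- real k..real k} - U\<close> a compact set that misses \<open>E\<close>, hence null.
      Then \<open>B k\<close> would have at most the measure of \<open>U - E\<close>, which was
      chosen smaller.\<close>
    obtain U where U: "open U" "E \<subseteq> U" "emeasure lborel (U - E) < emeasure lborel (B k)"
    proof -
      define e where "e = enn2real (min 1 (emeasure lborel (B k)))"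
      have fin: "min 1 (emeasure lborel (B k)) < top" by (rule le_less_trans[OF min.cobounded1]) simp
      then have ee: "ennreal e = min 1 (emeasure lborel (B k))" by (simp add: e_def)
      have "e > 0" unfolding e_def enn2real_positive_iff
        using fin nz by (simp add: zero_less_iff_neq_zero)
      then show thesis using outer_regular_lborel[of E e] E that ee by (metis min.cobounded2 order_less_le_trans sets_lborel)
    qed
    have "compact ({- real k..real k} - U)" using U(1) by (intro compact_diff) auto
    then have 0: "measure lborel ({- real k..real k} - U) = 0" using U(2) by (intro compact_null) auto
    then have "emeasure lborel ({- real k..real k} - U) = 0"
      using emeasure_compact_finite[OF \<open>compact ({- real k..real k} - U)\<close>]
      by (simp add: emeasure_eq_ennreal_measure top.not_eq_extremum)
    moreover have "emeasure lborel (B k) \<le> emeasure lborel (({- real k..real k} - U) \<union> (U - E))"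
      using U E by (intro emeasure_mono) (auto simp: B_def)
    moreover have "\<dots> \<le> emeasure lborel ({- real k..real k} - U) + emeasure lborel (U - E)"
      using U(1) E by (intro emeasure_subadditive) auto
    ultimately show False using U(3) by (simp add: not_less)
  qed
  then have "(\<Union>k. B k) \<in> null_sets lborel"
    using E by (intro null_sets_UN null_setsI) (auto simp: B_def)
  moreover have "x \<in> (\<Union>k. B k)" if "x \<notin> E" for x
  proof -
    obtain k :: nat where "\<bar>x\<bar> \<le> real k" using real_arch_simple by blast
    then have "x \<in> B k" using that by (auto simp: B_def)
    then show ?thesis by blast
  qed
  ultimately show ?thesis by (intro AE_I') (auto simp: subset_eq)
qed

section \<open>Integrals and samples of a monotone function\<close>

text \<open>The truncation by 1 is the one imposed on the radii of intervals, which must fit into a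
  cell; summability makes it inactive from some index on. The shift \<kappa> may place early samples
  at negative times, where \<phi> is arbitrary, so the comparison starts after an index
  shift.\<close>

lemma integrable_if_summable_samples:
  fixes \<phi> :: "real \<Rightarrow> real"
  assumes cont: "continuous_on {0<..} \<phi>" and anti: "\<And>s t. 0 < s \<Longrightarrow> s \<le> t \<Longrightarrow> \<phi> t \<le> \<phi> s"
    and nonneg: "\<And>t. t > 0 \<Longrightarrow> 0 \<le> \<phi> t" and t0: "t0 > 0" and \<tau>: "\<tau> > 0"
    and sum: "summable (\<lambda>n. min 1 (\<phi> (real n * \<tau> + \<kappa>)))"
  shows "\<phi> integrable_on {t0..}"
proof -
  have "(\<lambda>n. min 1 (\<phi> (real n * \<tau> + \<kappa>))) \<longlonglongrightarrow> 0" by (rule summable_LIMSEQ_zero[OF sum])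
  then have "\<forall>\<^sub>F n in sequentially. min 1 (\<phi> (real n * \<tau> + \<kappa>)) < 1" by (rule order_tendstoD) simp
  then obtain N1 where N1: "\<And>n. n \<ge> N1 \<Longrightarrow> \<phi> (real n * \<tau> + \<kappa>) < 1"
    by (auto simp: eventually_sequentially min_def split: if_splits)
  obtain N2 :: nat where N2: "(t0 - \<kappa>) / \<tau> < real N2" using reals_Archimedean2 by blast
  define N where "N = max N1 N2"
  define g where "g n = real (n + N) * \<tau> + \<kappa>" for n :: nat
  have gt: "g n > t0" for n
  proof -
    have "(t0 - \<kappa>) / \<tau> < real (n + N)" using N2 by (simp add: N_def)
    then show ?thesis unfolding pos_divide_less_eq[OF \<tau>] by (simp add: g_def)
  qed
  have g_Suc: "g (Suc n) = g n + \<tau>" for n by (simp add: g_def algebra_simps)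
  have "summable (\<lambda>n. min 1 (\<phi> (g n)))" unfolding g_def using sum by (subst summable_iff_shift)
  moreover have "min 1 (\<phi> (g n)) = \<phi> (g n)" for n using N1[of "n + N"] by (simp add: g_def N_def)
  ultimately have sg: "summable (\<lambda>n. \<phi> (g n))" by simp
  have int: "\<phi> integrable_on {s..t}" if "s > 0" for s t
    using that by (intro integrable_continuous_interval continuous_on_subset[OF cont]) auto
  have bound: "integral {t0..g k} \<phi> \<le> integral {t0..g 0} \<phi> + (\<Sum>n<k. \<tau> * \<phi> (g n))" for k
  proof (induction k)
    case (Suc k)
    have "integral {t0..g (Suc k)} \<phi> = integral {t0..g k} \<phi> + integral {g k..g (Suc k)} \<phi>"
      using gt[of k] int[OF t0] \<tau> by (intro Henstock_Kurzweil_Integration.integral_combine[symmetric]) (auto simp: g_Suc)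
    also have "integral {g k..g (Suc k)} \<phi> \<le> integral {g k..g (Suc k)} (\<lambda>_. \<phi> (g k))"
    proof (rule integral_le)
      have "g k > 0" using gt[of k] t0 by linarith
      then show "\<phi> integrable_on {g k..g (Suc k)}" by (rule int)
      show "\<phi> x \<le> \<phi> (g k)" if "x \<in> {g k..g (Suc k)}" for x
        using anti[OF \<open>g k > 0\<close>, of x] that by auto
    qed (rule integrable_const_ivl)
    also have "\<dots> = \<tau> * \<phi> (g k)" using \<tau> by (simp add: g_Suc)
    finally show ?case using Suc by simp
  qed simp
  define F where "F k x = (if x \<in> {t0..g k} then \<phi> x else 0)" for k x
  have Fint: "F k integrable_on {t0..}" "integral {t0..} (F k) = integral {t0..g k} \<phi>" for k
  proof -
    have sub: "{t0..g k} \<subseteq> {t0..}" by auto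
    show "F k integrable_on {t0..}" unfolding F_def
      using int[OF t0] integrable_restrict_Int[of "{t0..g k}" \<phi> "{t0..}"] sub by (simp add: Int_absorb2)
    show "integral {t0..} (F k) = integral {t0..g k} \<phi>" unfolding F_def
      using integral_restrict_Int[of "{t0..}" "{t0..g k}" \<phi>] sub by (simp add: Int_absorb1 Int_absorb2)
  qed
  have "\<phi> integrable_on {t0..} \<and> (\<lambda>k. integral {t0..} (F k)) \<longlonglongrightarrow> integral {t0..} \<phi>"
  proof (rule monotone_convergence_increasing)
    show "F k integrable_on {t0..}" for k by (rule Fint)
    show "F k x \<le> F (Suc k) x" if "x \<in> {t0..}" for k x
      using nonneg[of x] that t0 \<tau> by (auto simp: F_def g_Suc)
    show "(\<lambda>k. F k x) \<longlonglongrightarrow> \<phi> x" if x: "x \<in> {t0..}" for x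
    proof (rule tendsto_eventually)
      obtain k0 :: nat where "(x - \<kappa>) / \<tau> < real k0" using reals_Archimedean2 by blast
      then have "x \<le> g k" if "k \<ge> k0" for k
      proof -
        have "(x - \<kappa>) / \<tau> < real (k + N)" using \<open>_ < real k0\<close> that by linarith
        then show ?thesis using \<tau> by (simp add: g_def field_simps)
      qed
      then show "\<forall>\<^sub>F k in sequentially. F k x = \<phi> x"
        using x unfolding eventually_sequentially by (auto simp: F_def)
    qed
    show "bounded (range (\<lambda>k. integral {t0..} (F k)))"
    proof -
      have "norm (integral {t0..} (F k)) \<le> integral {t0..g 0} \<phi> + \<tau> * (\<Sum>n. \<phi> (g n))" for k
      proof -
        have "integral {t0..g k} \<phi> \<ge> 0" using nonneg t0 by (intro integral_nonneg int) auto
        moreover have "(\<Sum>n<k. \<phi> (g n)) \<le> (\<Sum>n. \<phi> (g n))"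
          using nonneg gt t0 by (intro sum_le_suminf[OF sg]) (auto intro: less_trans)
        then have "(\<Sum>n<k. \<tau> * \<phi> (g n)) \<le> \<tau> * (\<Sum>n. \<phi> (g n))"
          using \<tau> by (simp flip: sum_distrib_left)
        ultimately show ?thesis using bound[of k] by (simp add: Fint)
      qed
      then show ?thesis by (auto simp: bounded_iff)
    qed
  qed
  then show ?thesis by simp
qed

lemma summable_samples_if_integrable:
  fixes \<phi> :: "real \<Rightarrow> real"
  assumes anti: "\<And>s t. 0 < s \<Longrightarrow> s \<le> t \<Longrightarrow> \<phi> t \<le> \<phi> s"
    and nonneg: "\<And>t. t > 0 \<Longrightarrow> 0 \<le> \<phi> t" and t0: "t0 > 0" and \<tau>: "\<tau> > 0"
    and int: "\<phi> integrable_on {t0..}"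
  shows "summable (\<lambda>n. \<phi> (real n * \<tau>))"
proof -
  obtain N :: nat where N: "t0 / \<tau> < real N" using reals_Archimedean2 by blast
  define g where "g n = real (n + N) * \<tau>" for n :: nat
  have gt: "g n > t0" for n
  proof -
    have "t0 / \<tau> < real (n + N)" using N by simp
    then show ?thesis unfolding pos_divide_less_eq[OF \<tau>] by (simp add: g_def)
  qed
  have g_Suc: "g (Suc n) = g n + \<tau>" for n by (simp add: g_def algebra_simps)
  have ivl: "\<phi> integrable_on {s..t}" if "s \<ge> t0" for s t
    using integrable_on_subinterval[OF int, of s t] that by auto
  have bound: "(\<Sum>n<k. \<tau> * \<phi> (g (Suc n))) \<le> integral {g 0..g k} \<phi>" for k
  proof (induction k)
    case (Suc k)
    have gk: "g 0 \<le> g k" using \<tau> by (simp add: g_def)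
    have "\<tau> * \<phi> (g (Suc k)) = integral {g k..g (Suc k)} (\<lambda>_. \<phi> (g (Suc k)))" using \<tau> by (simp add: g_Suc)
    also have "\<dots> \<le> integral {g k..g (Suc k)} \<phi>"
    proof (rule integral_le)
      show "\<phi> integrable_on {g k..g (Suc k)}" using gt[of k] by (intro ivl) auto
      show "\<phi> (g (Suc k)) \<le> \<phi> x" if "x \<in> {g k..g (Suc k)}" for x
        using anti[of x "g (Suc k)"] that gt[of k] t0 by auto
    qed (rule integrable_const_ivl)
    finally have "(\<Sum>n<Suc k. \<tau> * \<phi> (g (Suc n))) \<le> integral {g 0..g k} \<phi> + integral {g k..g (Suc k)} \<phi>"
      using Suc by simp
    also have "\<dots> = integral {g 0..g (Suc k)} \<phi>"
      using gk gt[of 0] \<tau> by (intro Henstock_Kurzweil_Integration.integral_combine ivl) (auto simp: g_Suc)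
    finally show ?case .
  qed simp
  have "summable (\<lambda>n. \<tau> * \<phi> (g (Suc n)))"
  proof (rule summableI_nonneg_bounded)
    show "0 \<le> \<tau> * \<phi> (g (Suc n))" for n using \<tau> nonneg gt[of "Suc n"] t0 by simp
    show "(\<Sum>n<k. \<tau> * \<phi> (g (Suc n))) \<le> integral {t0..} \<phi>" for k
    proof -
      have "integral {g 0..g k} \<phi> \<le> integral {t0..} \<phi>"
        using gt[of 0] t0 nonneg by (intro integral_subset_le int ivl) auto
      then show ?thesis using bound[of k] by linarith
    qed
  qed
  then have "summable (\<lambda>n. \<phi> (g (Suc n)))" using \<tau> by simp
  then have "summable (\<lambda>n. \<phi> (real (n + Suc N) * \<tau>))" by (simp add: g_def)
  then show ?thesis using summable_iff_shift[of "\<lambda>n. \<phi> (real n * \<tau>)" "Suc N"] by simp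
qed

section \<open>Almost every shear of a fixed lattice\<close>

text \<open>The times that decide membership in \<open>T_set f\<close>, written in half-plane
  coordinates for the lattice with basis \<open>(p, q)\<close>, \<open>(p', q')\<close> sheared by
  \<open>x\<close>; \<open>sheared_in_T_set_iff\<close> makes the link.\<close>

definition returns :: "(real \<Rightarrow> real) \<Rightarrow> real \<Rightarrow> real \<Rightarrow> real \<Rightarrow> real \<Rightarrow> real \<Rightarrow> real set" where
  "returns f p q p' q' x = {t. t > 0 \<and> thick (f t / sqrt \<Delta>) p q p' q' (Complex x (exp (- 2 * t)))}"

text \<open>During the times from \<open>n * ln 2\<close> to \<open>(n + 1) * ln 2\<close> the
  height \<open>exp (- 2 * t)\<close> sweeps exactly the range \<open>{h n..4 * h n}\<close> of one
  box, and monotonicity replaces \<open>f t\<close> by its value at the left end. A unit interval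
  needs \<open>4 ^ (n + 1)\<close> boxes, each costing \<open>O(\<psi> n * h n)\<close>, so level
  \<open>n\<close> costs \<open>O(\<psi> n)\<close>.\<close>

lemma AE_returns_bounded:
  fixes f :: "real \<Rightarrow> real" and p q p' q' :: real
  assumes det: "p * q' - p' * q = 1"
    and mono: "mono_on {0<..} f" and f1: "\<And>t. t > 0 \<Longrightarrow> f t < 1"
    and t0: "t0 > 0" and int: "(\<lambda>t. 1 - f t) integrable_on {t0..}"
  shows "AE x in lborel. bounded (returns f p q p' q' x)"
proof -
  define \<psi> where "\<psi> n = 1 - f (real n * ln 2)" for n :: nat
  have fm: "f s \<le> f t" if "0 < s" "s \<le> t" for s t using mono_onD[OF mono, of s t] that by auto
  have sum: "summable \<psi>" unfolding \<psi>_def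
    using fm f1 by (intro summable_samples_if_integrable[OF _ _ t0 _ int]) (auto simp: less_imp_le)
  have "\<psi> \<longlonglongrightarrow> 0" by (rule summable_LIMSEQ_zero[OF sum])
  then have "\<forall>\<^sub>F n in sequentially. \<psi> n < 1/2" by (rule order_tendstoD) simp
  then obtain N where N: "\<And>n. n \<ge> N \<Longrightarrow> \<psi> n < 1/2" by (auto simp: eventually_sequentially)
  \<comment> \<open>Level 0 samples \<open>f 0\<close>, about which nothing is assumed; levels below
    \<open>N\<close> may violate \<open>\<psi> n \<le> 1/2\<close>.\<close>
  define n1 where "n1 = max 1 N"
  have \<psi>: "0 \<le> \<psi> n" "\<psi> n \<le> 1/2" if "n \<ge> n1" for n
    using N[of n] f1[of "real n * ln 2"] that by (auto simp: \<psi>_def n1_def)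
  define h :: "nat \<Rightarrow> real" where "h n = 1 / 4 ^ (n + 1)" for n
  have h: "h n > 0" "4 ^ (n + 1) * h n = 1" for n by (simp_all add: h_def)
  define K :: real where "K = 121 ^ 4 * 5656"
  define cellset where "cellset x0 n = {x \<in> {x0..x0 + h n}. \<exists>y \<in> {h n..4 * h n}.
    thick ((1 - \<psi> n) / sqrt \<Delta>) p q p' q' (Complex x y)}" for x0 n
  define good where "good x0 n B \<longleftrightarrow> B \<in> sets lborel \<and>
    emeasure lborel B \<le> ennreal (K * \<psi> n * h n) \<and> cellset x0 n \<subseteq> B" for x0 n B
  define B where "B x0 n = (SOME B. good x0 n B)" for x0 n
  have "good x0 n (B x0 n)" if "n \<ge> n1" for x0 n
    unfolding B_def
  proof (rule someI_ex)
    show "\<exists>B. good x0 n B"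
      using near_hexagonal_cover[OF det h(1)[of n] \<psi>[OF that], of x0]
      unfolding good_def cellset_def K_def Bex_def by (simp add: mult.assoc)
  qed
  then have B: "\<And>x0 n. n \<ge> n1 \<Longrightarrow> B x0 n \<in> sets lborel"
    "\<And>x0 n. n \<ge> n1 \<Longrightarrow> emeasure lborel (B x0 n) \<le> ennreal (K * \<psi> n * h n)"
    "\<And>x0 n. n \<ge> n1 \<Longrightarrow> cellset x0 n \<subseteq> B x0 n" by (simp_all add: good_def)
  \<comment> \<open>Splitting the line into unit intervals keeps the measures finite; the countably
    many \<open>k\<close> are recombined almost everywhere.\<close>
  define D where "D k n = (if n < n1 then {} else \<Union>j<4 ^ (n + 1). B (of_int k + real j * h n) n)" for k :: int and n
  have Ds: "D k n \<in> sets lborel" for k n using B(1) by (auto simp: D_def)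
  have De: "emeasure lborel (D k n) \<le> ennreal (K * \<psi> n)" if n: "n \<ge> n1" for k n
  proof -
    have "emeasure lborel (D k n) \<le> (\<Sum>j<4 ^ (n + 1). emeasure lborel (B (of_int k + real j * h n) n))"
      using n B(1)[OF n] unfolding D_def by (simp add: emeasure_subadditive_finite image_subset_iff)
    also have "\<dots> \<le> (\<Sum>j<4 ^ (n + 1) :: nat. ennreal (K * \<psi> n * h n))" using B(2)[OF n] by (intro sum_mono)
    also have "\<dots> = ennreal (\<Sum>j<4 ^ (n + 1) :: nat. K * \<psi> n * h n)"
      using \<psi>[OF n] h(1)[of n] by (intro sum_ennreal) (simp add: K_def)
    also have "(\<Sum>j<4 ^ (n + 1) :: nat. K * \<psi> n * h n) = K * \<psi> n * (4 ^ (n + 1) * h n)" by simp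
    finally show ?thesis by (simp only: h(2) mult_1_right)
  qed
  have Dfin: "emeasure lborel (D k n) < \<infinity>" for k n
  proof (cases "n < n1")
    case False
    then show ?thesis using De[of n k] by (auto intro: le_less_trans)
  qed (simp add: D_def)
  have Dsum: "summable (\<lambda>n. measure lborel (D k n))" for k
  proof (rule summable_comparison_test')
    show "summable (\<lambda>n. K * \<psi> n)" using sum by (rule summable_mult)
    show "norm (measure lborel (D k n)) \<le> K * \<psi> n" if "n \<ge> n1" for n
      using De[OF that] \<psi>(1)[OF that] unfolding measure_def
      by (simp add: enn2real_leI K_def)
  qed
  have "AE x in lborel. \<forall>k. eventually (\<lambda>n. x \<in> space lborel - D k n) sequentially"
    using Ds Dfin Dsum by (subst AE_all_countable) (intro allI borel_cantelli_AE1)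
  then show ?thesis
  proof eventually_elim
    case (elim x)
    then obtain n2 where n2: "\<And>n. n \<ge> n2 \<Longrightarrow> x \<notin> D \<lfloor>x\<rfloor> n"
      by (auto simp: eventually_sequentially)
    have "t \<le> real (max n1 n2) * ln 2" if t: "t \<in> returns f p q p' q' x" for t
    proof (rule ccontr)
      assume big: "\<not> ?thesis"
      have t0: "t > 0" and th: "thick (f t / sqrt \<Delta>) p q p' q' (Complex x (exp (- 2 * t)))"
        using t by (auto simp: returns_def)
      define n where "n = nat \<lfloor>t / ln 2\<rfloor>"
      have fl: "real n \<le> t / ln 2" "t / ln 2 < real n + 1"
        using t0 by (auto simp: n_def)
      then have nt: "real n * ln 2 \<le> t" "t < (real n + 1) * ln 2" by (simp_all add: field_simps)
      have "real (max n1 n2) * ln 2 < (real n + 1) * ln 2" using big nt by linarith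
      then have "real (max n1 n2) < real n + 1" by simp
      then have n12: "n \<ge> n1" "n \<ge> n2" by linarith+
      then have "n \<ge> 1" by (simp add: n1_def)
      have e4: "exp (- 2 * (real m * ln 2)) = 1 / 4 ^ m" for m :: nat
      proof -
        have "exp (- 2 * (real m * ln 2)) = exp (- (real m * ln 4))"
          using ln_realpow[of 2 2] by (simp add: algebra_simps)
        also have "\<dots> = 1 / 4 ^ m" by (simp add: exp_minus exp_of_nat_mult inverse_eq_divide)
        finally show ?thesis .
      qed
      have "exp (- 2 * ((real (n + 1)) * ln 2)) \<le> exp (- 2 * t)" "exp (- 2 * t) \<le> exp (- 2 * (real n * ln 2))"
        using nt by (simp_all add: algebra_simps)
      then have y: "exp (- 2 * t) \<in> {h n..4 * h n}" unfolding e4 by (simp add: h_def)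
      have "f (real n * ln 2) \<le> f t" using nt \<open>n \<ge> 1\<close> by (intro fm) auto
      then have "(1 - \<psi> n) / sqrt \<Delta> \<le> f t / sqrt \<Delta>"
        using Delta_facts(1) by (intro divide_right_mono) (auto simp: \<psi>_def)
      from thick_mono[OF th this] have th': "thick ((1 - \<psi> n) / sqrt \<Delta>) p q p' q' (Complex x (exp (- 2 * t)))"
        by simp
      define u where "u = frac x / h n"
      define j where "j = nat \<lfloor>u\<rfloor>"
      have u0: "u \<ge> 0" using h(1)[of n] by (simp add: u_def)
      have ju: "real j \<le> u" "u < real j + 1" using u0 by (auto simp: j_def)
      have "u < 4 ^ (n + 1)" using frac_lt_1[of x] by (simp add: u_def h_def)
      then have "real j < real (4 ^ (n + 1))" using ju by simp
      then have j4: "j < 4 ^ (n + 1)" by (simp only: of_nat_less_iff)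
      have "real j * h n \<le> frac x" "frac x \<le> (real j + 1) * h n"
        using ju h(1)[of n] by (simp_all add: u_def field_simps)
      then have "x \<in> {of_int \<lfloor>x\<rfloor> + real j * h n .. of_int \<lfloor>x\<rfloor> + real j * h n + h n}"
        by (simp add: frac_def algebra_simps)
      with y th' have "x \<in> cellset (of_int \<lfloor>x\<rfloor> + real j * h n) n" unfolding cellset_def by blast
      then have "x \<in> D \<lfloor>x\<rfloor> n" using B(3)[OF n12(1)] n12(1) j4 unfolding D_def by auto
      with n2[OF n12(2)] show False by simp
    qed
    then have "returns f p q p' q' x \<subseteq> {0..real (max n1 n2) * ln 2}" by (auto simp: returns_def)
    then show ?case using bounded_subset bounded_closed_interval by blast
  qed
qed

text \<open>The return time of a hexagonal point is fixed by its height and so varies from cell to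
  cell. The radius at level \<open>n\<close> therefore uses the latest time \<open>T n\<close>
  compatible with that level, where \<open>1 - f\<close> is smallest; \<open>T n\<close> is an
  arithmetic progression, so divergence survives.\<close>

lemma AE_returns_unbounded:
  fixes f :: "real \<Rightarrow> real" and p q p' q' :: real
  assumes det: "p * q' - p' * q = 1"
    and cont: "continuous_on {0<..} f"
    and mono: "mono_on {0<..} f" and f1: "\<And>t. t > 0 \<Longrightarrow> f t < 1"
    and t0: "t0 > 0" and int: "\<not> (\<lambda>t. 1 - f t) integrable_on {t0..}"
    and meas: "{x. \<not> bounded (returns f p q p' q' x)} \<in> sets lborel"
  shows "AE x in lborel. \<not> bounded (returns f p q p' q' x)"
proof -
  define E where "E = {x. \<not> bounded (returns f p q p' q' x)}"
  have fm: "f s \<le> f t" if "0 < s" "s \<le> t" for s t using mono_onD[OF mono, of s t] that by auto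
  have "ennreal ((1/5) * (b - a)) \<le> emeasure lborel (E \<inter> {a..b})" if ab: "a < b" for a b
  proof -
    obtain y0 where y0: "y0 > 0"
      "\<And>y. 0 < y \<Longrightarrow> y < y0 \<Longrightarrow> \<exists>B \<in> sets lborel. emeasure lborel B \<le> ennreal ((b - a) / 4) \<and>
      {x \<in> {a..b}. \<not> thick (1/7) p q p' q' (Complex x y)} \<subseteq> B"
      using nondivergence[OF det ab] by blast
    define d where "d n = (b - a) / 4 ^ n" for n :: nat
    \<comment> \<open>Then \<open>160 * y n = d n / 8\<close>, so a hexagonal point found from the
      middle half of a cell stays at least \<open>d n / 8\<close> away from the ends of the
      cell.\<close>
    define y where "y n = d n / 1280" for n
    have d0: "d n > 0" "4 ^ n * d n = b - a" and y00: "y n > 0" for n using ab by (simp_all add: d_def y_def)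
    have small: "\<exists>m. \<forall>n\<ge>m. y n < e" if "e > 0" for e
    proof -
      have "(\<lambda>n. (b - a) / 1280 * (1/4) ^ n) \<longlonglongrightarrow> (b - a) / 1280 * 0"
        by (intro tendsto_mult_left LIMSEQ_power_zero) simp
      moreover have "y = (\<lambda>n. (b - a) / 1280 * (1/4) ^ n)"
        by (simp add: fun_eq_iff y_def d_def power_one_over)
      ultimately have "y \<longlonglongrightarrow> 0" by simp
      from order_tendstoD(2)[OF this that] show ?thesis by (simp add: eventually_sequentially)
    qed
    \<comment> \<open>The bound \<open>y0\<close> is for nondivergence; \<open>1/160\<close> forces
      \<open>Im w < 1\<close>, that is, positive return times.\<close>
    obtain n0 where n0: "\<And>n. n \<ge> n0 \<Longrightarrow> y n < min y0 (1/160)" using small[of "min y0 (1/160)"] y0(1) by auto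
    define \<kappa> where "\<kappa> = ln (204800 / (b - a)) / 2"
    \<comment> \<open>The latest return time at level \<open>n\<close>, where \<open>Im w\<close>
      has its least possible value \<open>y n / 160\<close>; here
      \<open>204800 = 160 * 1280\<close>.\<close>
    define T where "T n = real n * ln 2 + \<kappa>" for n :: nat
    have T: "T n = ln (160 / y n) / 2" for n
    proof -
      have "160 / y n = 4 ^ n * (204800 / (b - a))" by (simp add: y_def d_def)
      then have "ln (160 / y n) = ln (4 ^ n) + ln (204800 / (b - a))"
        using ab by (simp only:) (intro ln_mult_pos, auto)
      then have "ln (160 / y n) = real n * ln 4 + ln (204800 / (b - a))" by (simp add: ln_realpow)
      also have "ln (4 :: real) = 2 * ln 2" using ln_realpow[of 2 2] by simp
      finally show ?thesis by (simp add: T_def \<kappa>_def)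
    qed
    \<comment> \<open>The cap at 1 matters since \<open>f\<close> may be negative. Below
      \<open>n0\<close> the time \<open>T n\<close> need not be positive and \<open>f (T n)\<close>
      is uncontrolled, hence the value 0.\<close>
    define \<psi> where "\<psi> n = (if n \<ge> n0 then min 1 (1 - f (T n)) else 0)" for n
    have Tpos: "T n > 0" if "n \<ge> n0" for n
      using n0[OF that] y00[of n] by (simp add: T ln_gt_zero less_divide_eq)
    have psi01: "0 \<le> \<psi> n" "\<psi> n \<le> 1" for n using f1[OF Tpos[of n]] by (auto simp: \<psi>_def)
    have ns: "\<not> summable \<psi>"
    proof
      assume "summable \<psi>"
      moreover have "\<forall>\<^sub>F n in sequentially. \<psi> n = min 1 (1 - f (real n * ln 2 + \<kappa>))"
        unfolding eventually_sequentially by (auto simp: \<psi>_def T_def)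
      ultimately have "summable (\<lambda>n. min 1 (1 - f (real n * ln 2 + \<kappa>)))"
        using summable_cong by metis
      then have "(\<lambda>t. 1 - f t) integrable_on {t0..}"
        using fm f1 t0 by (intro integrable_if_summable_samples[where \<tau> = "ln 2" and \<kappa> = \<kappa>])
          (auto intro!: continuous_intros cont simp: less_imp_le)
      with int show False by simp
    qed
    define mid where "mid n j = {a + real j * d n + d n / 4 .. a + real j * d n + 3 / 4 * d n}" for n j :: nat
    define G where "G n = {j. j < 4 ^ n \<and> (\<exists>x \<in> mid n j. thick (1/7) p q p' q' (Complex x (y n)))}" for n
    \<comment> \<open>A cell outside \<open>G n\<close> puts its whole middle half, of length
      \<open>d n / 2\<close>, into a set of measure at most \<open>(b - a) / 4\<close>; at most half
      of the cells can do so.\<close>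
    have Gcard: "4 ^ n \<le> 2 * card (G n)" if n: "n \<ge> n0" for n
    proof -
      obtain B where B: "B \<in> sets lborel" "emeasure lborel B \<le> ennreal ((b - a) / 4)"
        "{x \<in> {a..b}. \<not> thick (1/7) p q p' q' (Complex x (y n))} \<subseteq> B"
        using y0(2)[OF y00[of n]] n0[OF n] by auto
      define Z where "Z = {..<4 ^ n} - G n"
      have fZ: "finite Z" by (simp add: Z_def)
      have midB: "mid n j \<subseteq> B" if "j \<in> Z" for j
      proof
        fix x assume x: "x \<in> mid n j"
        have "real (j + 1) \<le> real (4 ^ n)" using that unfolding of_nat_le_iff by (auto simp: Z_def Suc_le_eq)
        then have "(real j + 1) * d n \<le> 4 ^ n * d n" using d0(1)[of n] by (intro mult_right_mono) auto
        then have "real j * d n + d n \<le> b - a" using d0(2)[of n] by (simp add: algebra_simps)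
        moreover have "0 \<le> real j * d n" using d0(1)[of n] by simp
        ultimately have "x \<in> {a..b}" using x d0(1)[of n]
          unfolding mid_def atLeastAtMost_iff by argo
        then show "x \<in> B" using that x B(3) by (auto simp: Z_def G_def)
      qed
      have mid_sets: "mid n j \<in> sets borel" for j by (simp add: mid_def)
      have disj: "disjoint_family_on (mid n) Z"
        unfolding disjoint_family_on_def
      proof (intro ballI impI, rule ccontr)
        fix i j assume ij: "i \<noteq> j" "mid n i \<inter> mid n j \<noteq> {}"
        then obtain x where "x \<in> mid n i" "x \<in> mid n j" by auto
        then have "real i * d n < (real j + 1) * d n" "real j * d n < (real i + 1) * d n"
          using d0(1)[of n] unfolding mid_def atLeastAtMost_iff distrib_right mult_1 by argo+
        then have "real i < real j + 1" "real j < real i + 1" using d0(1)[of n] by simp_all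
        then show False using ij by linarith
      qed
      have "(\<Sum>j\<in>Z. ennreal (d n / 2)) = (\<Sum>j\<in>Z. emeasure lborel (mid n j))"
        using d0(1)[of n] by (intro sum.cong) (auto simp: mid_def)
      also have "\<dots> = emeasure lborel (\<Union>j\<in>Z. mid n j)"
        using fZ disj mid_sets by (intro sum_emeasure) auto
      also have "\<dots> \<le> emeasure lborel B" using B(1) midB by (intro emeasure_mono) auto
      also have "\<dots> \<le> ennreal ((b - a) / 4)" by (rule B)
      finally have "(\<Sum>j\<in>Z. ennreal (d n / 2)) \<le> ennreal ((b - a) / 4)" .
      moreover have "(\<Sum>j\<in>Z. ennreal (d n / 2)) = ennreal (\<Sum>j\<in>Z. d n / 2)"
        using d0(1)[of n] by (intro sum_ennreal) auto
      ultimately have "ennreal (\<Sum>j\<in>Z. d n / 2) \<le> ennreal ((b - a) / 4)" by simp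
      then have "(\<Sum>j\<in>Z. d n / 2) \<le> (b - a) / 4" using ab by (subst (asm) ennreal_le_iff) auto
      then have "(2 * real (card Z)) * d n \<le> 4 ^ n * d n" unfolding d0(2) by (simp add: mult_ac)
      then have "2 * real (card Z) \<le> 4 ^ n" using d0(1)[of n] by (simp only: mult_le_cancel_right_pos)
      then have "real (2 * card Z) \<le> real (4 ^ n)" by simp
      then have "2 * card Z \<le> 4 ^ n" by (simp only: of_nat_le_iff)
      moreover have "card Z = 4 ^ n - card (G n)"
        unfolding Z_def by (subst card_Diff_subset) (auto simp: G_def intro: finite_subset[of _ "{..<4 ^ n}"])
      ultimately show ?thesis by simp
    qed
    define good where "good n j w \<longleftrightarrow> Im w \<le> 160 * y n \<and> y n \<le> 160 * Im w \<and>
        (\<exists>x \<in> mid n j. \<bar>Re w - x\<bar> \<le> d n / 8) \<and>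
        (\<forall>s \<psi>. \<bar>s\<bar> \<le> \<psi> * Im w \<longrightarrow> \<psi> \<le> 1 \<longrightarrow> thick ((1 - \<psi>) / sqrt \<Delta>) p q p' q' (w + of_real s))"
      for n j w
    have ex: "\<exists>w. good n j w" if j: "j \<in> G n" for n j
    proof -
      obtain x where x: "x \<in> mid n j" "thick (1/7) p q p' q' (Complex x (y n))" using j by (auto simp: G_def)
      have Im: "Im (Complex x (y n)) > 0" using y00 by simp
      obtain w where "Im w \<le> 160 * Im (Complex x (y n))" "Im (Complex x (y n)) \<le> 160 * Im w"
        "\<bar>Re w - Re (Complex x (y n))\<bar> \<le> 160 * Im (Complex x (y n))"
        "\<And>s \<psi>. \<bar>s\<bar> \<le> \<psi> * Im w \<Longrightarrow> \<psi> \<le> 1 \<Longrightarrow> thick ((1 - \<psi>) / sqrt \<Delta>) p q p' q' (w + of_real s)"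
        using hex_point_near_thick[OF det Im x(2)] by blast
      moreover have "160 * y n = d n / 8" by (simp add: y_def)
      ultimately show ?thesis using x(1) unfolding good_def by (intro exI[of _ w]) auto
    qed
    define w where "w n j = (SOME w. good n j w)" for n j
    have "good n j (w n j)" if "j \<in> G n" for n j unfolding w_def by (rule someI_ex[OF ex[OF that]])
    then have w: "\<And>n j. j \<in> G n \<Longrightarrow> Im (w n j) \<le> 160 * y n"
      "\<And>n j. j \<in> G n \<Longrightarrow> y n \<le> 160 * Im (w n j)"
      "\<And>n j. j \<in> G n \<Longrightarrow> \<exists>x \<in> mid n j. \<bar>Re (w n j) - x\<bar> \<le> d n / 8"
      "\<And>n j s \<psi>. j \<in> G n \<Longrightarrow> \<bar>s\<bar> \<le> \<psi> * Im (w n j) \<Longrightarrow> \<psi> \<le> 1 \<Longrightarrow>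
        thick ((1 - \<psi>) / sqrt \<Delta>) p q p' q' (w n j + of_real s)"
      by (simp_all add: good_def)
    \<comment> \<open>This constant makes the radius \<open>\<psi> n * (y n / 160)\<close>, at most
      \<open>\<psi> n * Im (w n j)\<close> whatever the height of the hexagonal point.\<close>
    interpret grid_intervals a b "1/204800" \<psi> G "\<lambda>n j. Re (w n j)" n0
    proof
      fix n j assume n: "n \<ge> n0" and j: "j \<in> G n"
      obtain x where x: "x \<in> mid n j" "\<bar>Re (w n j) - x\<bar> \<le> d n / 8" using w(3)[OF j] by auto
      have "1 / 204800 * d n * \<psi> n \<le> 1 / 204800 * d n * 1"
        using psi01[of n] d0(1)[of n] by (intro mult_left_mono) auto
      moreover have "(real j + 1) * d n = real j * d n + d n" by (simp add: algebra_simps)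
      ultimately have "a + real j * d n \<le> Re (w n j) - 1 / 204800 * d n * \<psi> n \<and>
        Re (w n j) + 1 / 204800 * d n * \<psi> n < a + (real j + 1) * d n"
        using x d0(1)[of n] unfolding mid_def atLeastAtMost_iff abs_le_iff by argo
      then show "a + real j * ((b - a) / 4 ^ n) \<le> Re (w n j) - 1 / 204800 * ((b - a) / 4 ^ n) * \<psi> n \<and>
        Re (w n j) + 1 / 204800 * ((b - a) / 4 ^ n) * \<psi> n < a + (real j + 1) * ((b - a) / 4 ^ n)"
        by (simp only: d_def)
    qed (use ab psi01 ns Gcard in \<open>auto simp: G_def\<close>)
    let ?L = "\<Inter>k. \<Union>n\<in>{n0 + k..}. A n"
    have "?L \<subseteq> E \<inter> {a..b}"
    proof
      fix x assume x: "x \<in> ?L"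
      have "x \<in> {a..b}"
      proof -
        obtain n where "n \<ge> n0 + 0" "x \<in> A n" using x by blast
        then show ?thesis using A_subset[of n] by auto
      qed
      moreover have "\<not> bounded (returns f p q p' q' x)"
      proof
        assume "bounded (returns f p q p' q' x)"
        then obtain R where R: "\<And>t. t \<in> returns f p q p' q' x \<Longrightarrow> \<bar>t\<bar> \<le> R" by (auto simp: bounded_iff)
        obtain k where k: "\<And>n. n \<ge> k \<Longrightarrow> y n < exp (- 2 * R) / 160" using small[of "exp (- 2 * R) / 160"] by auto
        obtain n where n: "n \<ge> n0 + k" "x \<in> A n" using x by blast
        then obtain j where j: "j \<in> G n" "x \<in> J n j" by (auto simp: A_def)
        have nn: "n \<ge> n0" "n \<ge> k" using n by auto
        define t where "t = - ln (Im (w n j)) / 2"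
        have wpos: "Im (w n j) > 0" using w(2)[OF j(1)] y00[of n] by linarith
        have et: "exp (- 2 * t) = Im (w n j)" using wpos by (simp add: t_def)
        have w1: "Im (w n j) < 1" using w(1)[OF j(1)] n0[OF nn(1)] by auto
        then have tpos: "t > 0" using wpos by (simp add: t_def)
        have "exp (- 2 * t) < exp (- 2 * R)" unfolding et using w(1)[OF j(1)] k[OF nn(2)] by linarith
        then have tR: "t > R" by simp
        have "t \<le> T n"
        proof -
          have "- ln (Im (w n j)) = ln (1 / Im (w n j))" using wpos by (simp add: ln_div)
          also have "\<dots> \<le> ln (160 / y n)" using w(2)[OF j(1)] wpos y00[of n]
            by (intro ln_mono) (auto simp: field_simps)
          finally show ?thesis unfolding T t_def by simp
        qed
        then have "f t \<le> f (T n)" by (rule fm[OF tpos])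
        then have ft: "f t \<le> 1 - \<psi> n" using nn by (simp add: \<psi>_def)
        have "\<bar>x - Re (w n j)\<bar> \<le> \<psi> n * (y n / 160)"
        proof -
          have "r n = \<psi> n * (y n / 160)" by (simp add: r_def h_def y_def d_def)
          then show ?thesis using j(2) unfolding J_def atLeastAtMost_iff by linarith
        qed
        also have "\<dots> \<le> \<psi> n * Im (w n j)" using w(2)[OF j(1)] psi01(1)[of n] by (intro mult_left_mono) auto
        finally have "thick ((1 - \<psi> n) / sqrt \<Delta>) p q p' q' (w n j + of_real (x - Re (w n j)))"
          by (rule w(4)[OF j(1) _ psi01(2)])
        moreover have "w n j + of_real (x - Re (w n j)) = Complex x (exp (- 2 * t))"
          unfolding et by (simp add: complex_eq_iff)
        ultimately have "thick ((1 - \<psi> n) / sqrt \<Delta>) p q p' q' (Complex x (exp (- 2 * t)))" by simp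
        moreover have "f t / sqrt \<Delta> \<le> (1 - \<psi> n) / sqrt \<Delta>"
          using ft Delta_facts(1) by (intro divide_right_mono) auto
        ultimately have "thick (f t / sqrt \<Delta>) p q p' q' (Complex x (exp (- 2 * t)))"
          by (rule thick_mono) simp
        then have "t \<in> returns f p q p' q' x" using tpos by (simp add: returns_def)
        from R[OF this] tR show False by simp
      qed
      ultimately show "x \<in> E \<inter> {a..b}" by (simp add: E_def)
    qed
    then have "emeasure lborel ?L \<le> emeasure lborel (E \<inter> {a..b})"
      using meas by (intro emeasure_mono) (auto simp: E_def)
    from order_trans[OF emeasure_limsup_A this] show ?thesis by simp
  qed
  then have "AE x in lborel. x \<in> E"
    using meas by (intro AE_if_positive_proportion[of E "1/5"]) (auto simp: E_def)
  then show ?thesis by (simp add: E_def)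
qed

section \<open>Measurability and invariance\<close>

definition shear :: "real \<Rightarrow> real^2^2" where
  "shear x = vector [vector [1, x], vector [0, 1]]"

lemma shear_mult: "shear x *v v = vector [v $ 1 + x * v $ 2, v $ 2]"
  by (simp add: shear_def vec_eq_iff forall_2 matrix_vector_mult_def sum_2)

lemma diag_flow_mult: "diag_flow t *v v = vector [exp t * v $ 1, exp (- t) * v $ 2]"
  by (simp add: diag_flow_def vec_eq_iff forall_2 matrix_vector_mult_def sum_2)

lemma shear_in_SL2: "shear x \<in> SL2" by (simp add: SL2_def shear_def det_2)

lemma diag_flow_in_SL2: "diag_flow t \<in> SL2" by (simp add: SL2_def diag_flow_def det_2 flip: exp_add)

lemma act_in_unimodular_lattices:
  assumes g: "g \<in> SL2" and \<Lambda>: "\<Lambda> \<in> unimodular_lattices"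
  shows "act g \<Lambda> \<in> unimodular_lattices"
proof -
  obtain k where k: "\<bar>det k\<bar> = 1" "\<Lambda> = act k int_lattice" using \<Lambda> by (auto simp: unimodular_lattices_def)
  have "act g \<Lambda> = act (g ** k) int_lattice" by (simp add: k act_def image_image matrix_vector_mul_assoc)
  moreover have "\<bar>det (g ** k)\<bar> = 1" using g k by (simp add: det_mul SL2_def)
  ultimately show ?thesis by (auto simp: unimodular_lattices_def)
qed

lemma act_shear_shear: "act (shear x) (act (shear y) \<Lambda>) = act (shear (x + y)) \<Lambda>"
  by (simp add: act_def image_image shear_mult algebra_simps)

lemma act_shear_0: "act (shear 0) \<Lambda> = \<Lambda>"
proof -
  have "shear 0 *v v = v" for v by (simp add: shear_mult vec_eq_iff forall_2)
  then show ?thesis by (simp add: act_def)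
qed

lemma norm_real2: "norm (v :: real^2) = sqrt ((v $ 1)\<^sup>2 + (v $ 2)\<^sup>2)"
  by (simp add: norm_vec_def L2_set_def sum_2)

lemma norm_flow:
  "norm (diag_flow t *v (shear x *v v))
    = exp t * cmod (of_real (v $ 1) + Complex x (exp (- 2 * t)) * of_real (v $ 2))"
proof -
  have e: "exp t * exp (- 2 * t) = exp (- t)" by (simp flip: exp_add)
  have "(exp t * (v $ 1 + x * v $ 2))\<^sup>2 + (exp (- t) * v $ 2)\<^sup>2
      = (exp t)\<^sup>2 * ((v $ 1 + x * v $ 2)\<^sup>2 + (exp (- 2 * t) * v $ 2)\<^sup>2)"
    unfolding e[symmetric] power_mult_distrib by (simp add: distrib_left mult.assoc)
  then show ?thesis
    by (simp add: norm_real2 diag_flow_mult shear_mult cmod_def real_sqrt_mult mult.commute)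
qed

text \<open>The expansion factor \<open>exp t\<close> in \<open>norm_flow\<close> is
  \<open>1 / sqrt (Im z)\<close>, precisely the scaling built into \<open>thick\<close>. The columns
  of \<open>g\<close> serve as the lattice basis.\<close>

lemma flow_in_K_iff:
  assumes g: "g \<in> SL2"
  shows "act (diag_flow t) (act (shear x) (act g int_lattice)) \<in> \<K> r \<longleftrightarrow>
    thick (r / sqrt \<Delta>) (g $ 1 $ 1) (g $ 2 $ 1) (g $ 1 $ 2) (g $ 2 $ 2) (Complex x (exp (- 2 * t)))"
proof -
  define p q p' q' where pq: "p = g $ 1 $ 1" "q = g $ 2 $ 1" "p' = g $ 1 $ 2" "q' = g $ 2 $ 2"
  have det: "p * q' - p' * q = 1" using g by (simp add: SL2_def det_2 pq)
  have uni: "act (diag_flow t) (act (shear x) (act g int_lattice)) \<in> unimodular_lattices"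
    using g unimodular_lattices_eq_orbit by (intro act_in_unimodular_lattices[OF diag_flow_in_SL2]
        act_in_unimodular_lattices[OF shear_in_SL2]) auto
  define w :: "int \<Rightarrow> int \<Rightarrow> real^2" where "w m n = vector [m * p + n * p', m * q + n * q']" for m n
  define L where "L m n = diag_flow t *v (shear x *v w m n)" for m n
  have lat: "act g int_lattice = {w m n | m n. True}"
  proof -
    have gz: "g *v z = vector [z $ 1 * p + z $ 2 * p', z $ 1 * q + z $ 2 * q']" for z
      by (simp add: pq vec_eq_iff forall_2 matrix_vector_mult_def sum_2 mult.commute)
    have "w m n = g *v vector [of_int m, of_int n]" for m n by (simp add: gz w_def)
    moreover have "vector [of_int m, of_int n] \<in> int_lattice" for m n
      by (simp add: int_lattice_def forall_2)
    moreover have "\<exists>m n. g *v z = w m n" if zl: "z \<in> int_lattice" for z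
    proof -
      have z: "z $ 1 \<in> \<int>" "z $ 2 \<in> \<int>" using zl by (simp_all add: int_lattice_def)
      obtain m where "z $ 1 = of_int m" using z(1) by (rule Ints_cases)
      moreover obtain n where "z $ 2 = of_int n" using z(2) by (rule Ints_cases)
      ultimately show ?thesis by (auto simp: gz w_def)
    qed
    ultimately show ?thesis by (auto simp: act_def image_iff)
  qed
  have norm: "norm (L m n) = exp t * cmod (of_int m * (of_real p + Complex x (exp (- 2 * t)) * of_real q)
      + of_int n * (of_real p' + Complex x (exp (- 2 * t)) * of_real q'))" for m n
    unfolding L_def norm_flow by (simp add: w_def algebra_simps)
  have nz: "L m n \<noteq> 0 \<longleftrightarrow> (m, n) \<noteq> (0, 0)" for m n
  proof
    assume "L m n \<noteq> 0"
    then show "(m, n) \<noteq> (0, 0)" by (auto simp: L_def w_def diag_flow_mult shear_mult vec_eq_iff forall_2)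
  next
    assume mn: "(m, n) \<noteq> (0, 0)"
    show "L m n \<noteq> 0"
    proof
      assume "L m n = 0"
      then have XY: "m * q + n * q' = 0" "m * p + n * p' = 0"
        by (auto simp: L_def w_def diag_flow_mult shear_mult vec_eq_iff forall_2)
      have "of_int m * (p * q' - p' * q) = (m * p + n * p') * q' - (m * q + n * q') * p'"
        "of_int n * (p * q' - p' * q) = (m * q + n * q') * p - (m * p + n * p') * q"
        by (simp_all add: algebra_simps)
      then have "real_of_int m = 0" "real_of_int n = 0" unfolding XY det by simp_all
      with mn show False by simp
    qed
  qed
  have cmp: "norm (L m n) < r / sqrt \<Delta> \<longleftrightarrow> \<not> r / sqrt \<Delta> * exp (- t) \<le> norm (L m n) * exp (- t)" for m n
    unfolding not_le by (rule mult_less_cancel_right_pos[symmetric]) simp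
  have ee: "exp t * c * exp (- t) = c" for c :: real by (simp add: exp_minus)
  have "exp (- 2 * t) = (exp (- t))\<^sup>2" by (simp add: power2_eq_square flip: exp_add)
  then have sq: "sqrt (exp (- 2 * t)) = exp (- t)" by (simp only: real_sqrt_abs abs_exp_cancel)
  have img: "act (diag_flow t) (act (shear x) {w m n | m n. True}) = {L m n | m n. True}"
    by (auto simp: act_def L_def)
  have "act (diag_flow t) (act (shear x) (act g int_lattice)) \<in> \<K> r \<longleftrightarrow>
    (\<forall>m n. L m n \<noteq> 0 \<longrightarrow> \<not> norm (L m n) < r / sqrt \<Delta>)"
    using uni unfolding \<K>_def lat img by auto
  also have "\<dots> \<longleftrightarrow> thick (r / sqrt \<Delta>) p q p' q' (Complex x (exp (- 2 * t)))"
    unfolding thick_def nz cmp unfolding norm complex.sel sq ee not_not ..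
  finally show ?thesis by (simp add: pq)
qed

lemma sheared_in_T_set_iff:
  assumes g: "g \<in> SL2"
  shows "act (shear x) (act g int_lattice) \<in> T_set f \<longleftrightarrow>
    \<not> bounded (returns f (g $ 1 $ 1) (g $ 2 $ 1) (g $ 1 $ 2) (g $ 2 $ 2) x)"
proof -
  have "act (shear x) (act g int_lattice) \<in> unimodular_lattices"
    using g unimodular_lattices_eq_orbit by (intro act_in_unimodular_lattices[OF shear_in_SL2]) auto
  then show ?thesis by (simp add: T_set_def returns_def flow_in_K_iff[OF g])
qed

section \<open>Joint measurability in the shear and the lattice\<close>

lemma openin_short_vector_lattices:
  fixes A :: "real^2^2"
  shows "openin lattice_topology {\<Lambda> \<in> unimodular_lattices. \<exists>v\<in>\<Lambda>. v \<noteq> 0 \<and> norm (A *v v) < \<rho>}"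
  unfolding openin_lattice_topology
proof
  let ?O = "\<Union>z\<in>int_lattice. {g. g *v z \<noteq> 0} \<inter> {g. norm (A *v (g *v z)) < \<rho>}"
  have cont: "continuous_on UNIV (\<lambda>g :: real^2^2. g *v z)" for z
    unfolding matrix_vector_mult_def by (intro continuous_intros)
  have cont2: "continuous_on UNIV (\<lambda>g :: real^2^2. norm (A *v (g *v z)))" for z
  proof -
    have "continuous_on UNIV (\<lambda>v. A *v v)" by (intro linear_continuous_on matrix_vector_mul_bounded_linear)
    then show ?thesis by (intro continuous_on_norm continuous_on_compose2[OF _ cont]) auto
  qed
  have "open ?O"
  proof (intro open_UN ballI open_Int)
    fix z :: "real^2"
    have "open ((\<lambda>g :: real^2^2. g *v z) -` (- {0}))" by (intro open_vimage cont) auto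
    then show "open {g :: real^2^2. g *v z \<noteq> 0}" by (simp add: vimage_def)
    show "open {g :: real^2^2. norm (A *v (g *v z)) < \<rho>}" by (intro open_Collect_less cont2 continuous_on_const)
  qed
  then have "openin (top_of_set SL2) (SL2 \<inter> ?O)" by (rule openin_open_Int)
  moreover have "{g \<in> SL2. act g int_lattice \<in> {\<Lambda> \<in> unimodular_lattices. \<exists>v\<in>\<Lambda>. v \<noteq> 0 \<and> norm (A *v v) < \<rho>}}
      = SL2 \<inter> ?O"
  proof -
    have "act g int_lattice \<in> unimodular_lattices" if "g \<in> SL2" for g
      using that unimodular_lattices_eq_orbit by auto
    moreover have "(\<exists>v\<in>act g int_lattice. v \<noteq> 0 \<and> norm (A *v v) < \<rho>) \<longleftrightarrow> g \<in> ?O" for g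
      by (simp add: act_def)
    ultimately show ?thesis by blast
  qed
  ultimately show "openin (top_of_set SL2)
    {g \<in> SL2. act g int_lattice \<in> {\<Lambda> \<in> unimodular_lattices. \<exists>v\<in>\<Lambda>. v \<noteq> 0 \<and> norm (A *v v) < \<rho>}}" by simp
qed auto

lemma norm_flow_shear_le:
  "norm (diag_flow t *v (shear x *v v))
    \<le> (1 + exp (2 * t) * \<bar>x - x'\<bar>) * norm (diag_flow t *v (shear x' *v v))"
proof -
  let ?u = "diag_flow t *v (shear x' *v v)"
  have "\<bar>v $ 2\<bar> * exp (- t) \<le> norm ?u"
    using component_le_norm_cart[of ?u 2] by (simp add: diag_flow_mult shear_mult abs_mult mult.commute)
  then have "\<bar>v $ 2\<bar> * exp (- t) * exp t \<le> norm ?u * exp t" by (intro mult_right_mono) auto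
  then have Y: "\<bar>v $ 2\<bar> \<le> norm ?u * exp t" by (simp add: mult.assoc flip: exp_add)
  have "diag_flow t *v (shear x *v v) = ?u + vector [exp t * (x - x') * v $ 2, 0]"
    by (simp add: diag_flow_mult shear_mult vec_eq_iff forall_2 algebra_simps)
  then have "norm (diag_flow t *v (shear x *v v)) \<le> norm ?u + norm (vector [exp t * (x - x') * v $ 2, 0] :: real^2)"
    by (metis norm_triangle_ineq)
  also have "norm (vector [exp t * (x - x') * v $ 2, 0] :: real^2) = exp t * \<bar>x - x'\<bar> * \<bar>v $ 2\<bar>"
    by (simp add: norm_real2 abs_mult)
  also have "\<dots> \<le> exp t * \<bar>x - x'\<bar> * (norm ?u * exp t)" using Y by (intro mult_left_mono) auto
  also have "\<dots> = exp (2 * t) * \<bar>x - x'\<bar> * norm ?u"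
  proof -
    have "exp (2 * t) = exp t * exp t" by (simp flip: exp_add)
    then show ?thesis by simp
  qed
  finally show ?thesis by (simp add: algebra_simps)
qed

text \<open>The factor is the same for all \<open>v\<close>. This uniformity allows a time to be
  moved to a rational one for the infinitely many lattice vectors at once.\<close>

lemma norm_flow_time_ge:
  "exp (- \<bar>s - t\<bar>) * norm (diag_flow t *v v) \<le> norm (diag_flow s *v v)"
proof -
  have a: "exp (- \<bar>s - t\<bar>) * exp t \<le> exp s" "exp (- \<bar>s - t\<bar>) * exp (- t) \<le> exp (- s)"
    by (simp_all flip: exp_add)
  have "(exp (- \<bar>s - t\<bar>) * norm (diag_flow t *v v))\<^sup>2
      = ((exp (- \<bar>s - t\<bar>) * exp t) * \<bar>v $ 1\<bar>)\<^sup>2 + ((exp (- \<bar>s - t\<bar>) * exp (- t)) * \<bar>v $ 2\<bar>)\<^sup>2"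
    by (simp add: norm_real2 diag_flow_mult power_mult_distrib algebra_simps)
  also have "\<dots> \<le> (exp s * \<bar>v $ 1\<bar>)\<^sup>2 + (exp (- s) * \<bar>v $ 2\<bar>)\<^sup>2"
    using a by (intro add_mono power_mono mult_right_mono) auto
  also have "\<dots> = (norm (diag_flow s *v v))\<^sup>2"
    by (simp add: norm_real2 diag_flow_mult power_mult_distrib)
  finally show ?thesis by (rule power2_le_imp_le) simp
qed

text \<open>This trades uncountably many times for countably many. From left to right
  \<open>lip\<close> loses the same factor for every \<open>v\<close>, which the slack absorbs at a
  nearby rational; from right to left a limit point of approximate solutions in the compact interval
  is an exact one.\<close>

lemma attained_iff_approx_at_rationals:
  fixes N :: "'v \<Rightarrow> real \<Rightarrow> real" and f :: "real \<Rightarrow> real"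
  assumes ab: "a < b" and f: "continuous_on {a..b} f" and N: "\<And>v. continuous_on {a..b} (N v)"
    and lip: "\<And>v s t. exp (- \<bar>s - t\<bar>) * N v t \<le> N v s"
  shows "(\<exists>t\<in>{a..b}. \<forall>v\<in>W. f t \<le> N v t) \<longleftrightarrow>
    (\<forall>k :: nat. \<exists>t\<in>\<rat> \<inter> {a..b}. \<forall>v\<in>W. f t - 1 / (real k + 1) \<le> N v t)"
proof
  assume "\<exists>t\<in>{a..b}. \<forall>v\<in>W. f t \<le> N v t"
  then obtain t where t: "t \<in> {a..b}" "\<And>v. v \<in> W \<Longrightarrow> f t \<le> N v t" by auto
  show "\<forall>k :: nat. \<exists>t\<in>\<rat> \<inter> {a..b}. \<forall>v\<in>W. f t - 1 / (real k + 1) \<le> N v t"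
  proof
    fix k :: nat
    define e where "e = 1 / (real k + 1)"
    have e: "e > 0" by (simp add: e_def)
    \<comment> \<open>Comparison with the rescaled \<open>f t\<close> suits the multiplicative bound
      \<open>lip\<close>; the difference vanishes at \<open>s = t\<close>, whatever the sign of
      \<open>f\<close>.\<close>
    have "continuous_on {a..b} (\<lambda>s. f s - exp (- \<bar>s - t\<bar>) * f t)" by (intro continuous_intros f)
    then obtain \<delta> where \<delta>: "\<delta> > 0"
      "\<And>s. s \<in> {a..b} \<Longrightarrow> dist s t < \<delta> \<Longrightarrow> dist (f s - exp (- \<bar>s - t\<bar>) * f t) (f t - exp (- \<bar>t - t\<bar>) * f t) < e"
      unfolding continuous_on_iff using t(1) e by blast
    have "max a (t - \<delta>) < min b (t + \<delta>)" using \<delta>(1) ab t(1) by auto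
    then obtain s where s: "s \<in> \<rat>" "max a (t - \<delta>) < s" "s < min b (t + \<delta>)"
      using Rats_dense_in_real by blast
    have sab: "s \<in> {a..b}" "dist s t < \<delta>" using s by (auto simp: dist_real_def abs_less_iff)
    have "f s - e \<le> N v s" if v: "v \<in> W" for v
    proof -
      have "f s - e \<le> exp (- \<bar>s - t\<bar>) * f t" using \<delta>(2)[OF sab] by (simp add: dist_real_def abs_less_iff)
      also have "\<dots> \<le> exp (- \<bar>s - t\<bar>) * N v t" using t(2)[OF v] by (intro mult_left_mono) auto
      also have "\<dots> \<le> N v s" by (rule lip)
      finally show ?thesis .
    qed
    then show "\<exists>t\<in>\<rat> \<inter> {a..b}. \<forall>v\<in>W. f t - 1 / (real k + 1) \<le> N v t"
      using s(1) sab(1) unfolding e_def by blast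
  qed
next
  assume "\<forall>k :: nat. \<exists>t\<in>\<rat> \<inter> {a..b}. \<forall>v\<in>W. f t - 1 / (real k + 1) \<le> N v t"
  then obtain s where s: "\<And>k :: nat. s k \<in> {a..b}" "\<And>k v. v \<in> W \<Longrightarrow> f (s k) - 1 / (real k + 1) \<le> N v (s k)"
    by (metis IntD2)
  obtain l r where lr: "l \<in> {a..b}" "strict_mono r" "(s \<circ> r) \<longlonglongrightarrow> l"
    using compact_imp_seq_compact[OF compact_Icc[of a b]] s(1) by (metis seq_compactE)
  have "f l \<le> N v l" if v: "v \<in> W" for v
  proof (rule LIMSEQ_le)
    have "(\<lambda>k. f ((s \<circ> r) k)) \<longlonglongrightarrow> f l"
      using continuous_on_tendsto_compose[OF f lr(3) lr(1)] s(1) by simp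
    moreover have "(\<lambda>k. 1 / (real (r k) + 1)) \<longlonglongrightarrow> 0"
      using LIMSEQ_subseq_LIMSEQ[OF LIMSEQ_inverse_real_of_nat lr(2)]
      by (simp add: o_def inverse_eq_divide add.commute)
    ultimately show "(\<lambda>k. f ((s \<circ> r) k) - 1 / (real (r k) + 1)) \<longlonglongrightarrow> f l" using tendsto_diff by fastforce
    show "(\<lambda>k. N v ((s \<circ> r) k)) \<longlonglongrightarrow> N v l"
      using continuous_on_tendsto_compose[OF N lr(3) lr(1)] s(1) by simp
    show "\<exists>n. \<forall>k\<ge>n. f ((s \<circ> r) k) - 1 / (real (r k) + 1) \<le> N v ((s \<circ> r) k)" using s(2)[OF v] by simp
  qed
  then show "\<exists>t\<in>{a..b}. \<forall>v\<in>W. f t \<le> N v t" using lr(1) by blast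
qed

text \<open>The intervals are compact, of positive length and away from 0, as continuity of
  \<open>f\<close> on the positive axis and the approximation by rational times require.\<close>

lemma not_bounded_pos_iff:
  fixes P :: "real \<Rightarrow> bool"
  shows "\<not> bounded {t. t > 0 \<and> P t} \<longleftrightarrow> (\<forall>n :: nat. \<exists>m :: nat. \<exists>t\<in>{real n + 1..real n + 2 + real m}. P t)"
proof
  assume nb: "\<not> bounded {t. t > 0 \<and> P t}"
  show "\<forall>n :: nat. \<exists>m :: nat. \<exists>t\<in>{real n + 1..real n + 2 + real m}. P t"
  proof
    fix n :: nat
    obtain t where t: "t > 0" "P t" "\<bar>t\<bar> > real n + 1"
      using nb unfolding bounded_iff by (auto simp: not_le)
    obtain m :: nat where "t \<le> real m" using real_arch_simple by blast
    then have "t \<in> {real n + 1..real n + 2 + real m}" using t by auto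
    with t(2) show "\<exists>m :: nat. \<exists>t\<in>{real n + 1..real n + 2 + real m}. P t" by blast
  qed
next
  assume R: "\<forall>n :: nat. \<exists>m :: nat. \<exists>t\<in>{real n + 1..real n + 2 + real m}. P t"
  show "\<not> bounded {t. t > 0 \<and> P t}"
  proof
    assume "bounded {t. t > 0 \<and> P t}"
    then obtain B where B: "\<And>t. t > 0 \<Longrightarrow> P t \<Longrightarrow> \<bar>t\<bar> \<le> B" by (auto simp: bounded_iff)
    obtain n :: nat where n: "B \<le> real n" using real_arch_simple by blast
    obtain t where "t \<ge> real n + 1" "P t" using R by (meson atLeastAtMost_iff)
    then show False using B[of t] n by auto
  qed
qed

lemma T_set_iff_rational:
  assumes f: "continuous_on {0<..} f" and \<Lambda>: "\<Lambda> \<in> unimodular_lattices"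
  shows "act (shear x) \<Lambda> \<in> T_set f \<longleftrightarrow> (\<forall>n :: nat. \<exists>m :: nat. \<forall>k :: nat.
    \<exists>t\<in>\<rat> \<inter> {real n + 1..real n + 2 + real m}.
      \<not> (\<exists>v\<in>\<Lambda>. v \<noteq> 0 \<and> norm ((diag_flow t ** shear x) *v v) < (f t - 1 / (real k + 1)) / sqrt \<Delta>))"
proof -
  define N where "N v t = sqrt \<Delta> * norm (diag_flow t *v (shear x *v v))" for v t
  define W where "W = \<Lambda> - {0}"
  have D: "sqrt \<Delta> > 0" using Delta_facts(1) by simp
  have uni: "act (shear x) \<Lambda> \<in> unimodular_lattices"
    "act (diag_flow t) (act (shear x) \<Lambda>) \<in> unimodular_lattices" for t
    using \<Lambda> by (auto intro!: act_in_unimodular_lattices[OF diag_flow_in_SL2] act_in_unimodular_lattices[OF shear_in_SL2])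
  have le: "\<not> norm (diag_flow t *v (shear x *v v)) < s / sqrt \<Delta> \<longleftrightarrow> s \<le> N v t" for s t v
    using D by (simp add: N_def not_less pos_divide_le_eq mult.commute)
  have nz: "diag_flow t *v (shear x *v v) \<noteq> 0 \<longleftrightarrow> v \<noteq> 0" for t v
    by (auto simp: diag_flow_mult shear_mult vec_eq_iff forall_2)
  have hit: "act (diag_flow t) (act (shear x) \<Lambda>) \<in> \<K> s \<longleftrightarrow> (\<forall>v\<in>W. s \<le> N v t)" for t s
    using uni(2)[of t] nz unfolding \<K>_def W_def le[symmetric] by (auto simp: act_def)
  have exists_iff: "(\<exists>t\<in>{real n + 1..real n + 2 + real m}. \<forall>v\<in>W. f t \<le> N v t) \<longleftrightarrow>
    (\<forall>k :: nat. \<exists>t\<in>\<rat> \<inter> {real n + 1..real n + 2 + real m}. \<forall>v\<in>W. f t - 1 / (real k + 1) \<le> N v t)" for n m :: nat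
  proof (rule attained_iff_approx_at_rationals)
    show "continuous_on {real n + 1..real n + 2 + real m} f" by (rule continuous_on_subset[OF f]) auto
    show "continuous_on {real n + 1..real n + 2 + real m} (N v)" for v
      unfolding N_def norm_real2 diag_flow_mult vector_2 by (intro continuous_intros)
    show "exp (- \<bar>s - t\<bar>) * N v t \<le> N v s" for v s t
      using norm_flow_time_ge[of s t "shear x *v v"] D by (simp add: N_def mult.left_commute)
  qed auto
  have "act (shear x) \<Lambda> \<in> T_set f \<longleftrightarrow> \<not> bounded {t. t > 0 \<and> (\<forall>v\<in>W. f t \<le> N v t)}"
    using uni(1) by (simp add: T_set_def hit)
  also have "\<dots> \<longleftrightarrow> (\<forall>n :: nat. \<exists>m :: nat. \<forall>k :: nat.
    \<exists>t\<in>\<rat> \<inter> {real n + 1..real n + 2 + real m}. \<forall>v\<in>W. f t - 1 / (real k + 1) \<le> N v t)"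
    unfolding not_bounded_pos_iff exists_iff ..
  also have "(\<lambda>t k. \<forall>v\<in>W. f t - 1 / (real k + 1) \<le> N v t) = (\<lambda>t k. 
      \<not> (\<exists>v\<in>\<Lambda>. v \<noteq> 0 \<and> norm ((diag_flow t ** shear x) *v v) < (f t - 1 / (real k + 1)) / sqrt \<Delta>))"
    unfolding le[symmetric] W_def by (auto simp: fun_eq_iff matrix_vector_mul_assoc)
  finally show ?thesis .
qed

lemma sets_haar_measure_openin:
  "is_haar_measure M \<Longrightarrow> openin lattice_topology U \<Longrightarrow> U \<in> sets M"
  unfolding is_haar_measure_def by auto

text \<open>Replacing \<open>x\<close> by a nearby rational \<open>x'\<close> changes lengths by a
  factor close to 1, by \<open>norm_flow_shear_le\<close>. With a rational threshold slightly below
  \<rho> this exhibits the set as a countable union of rectangles, each with two open sides.\<close>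

lemma sets_short_after_shear:
  assumes M: "is_haar_measure M"
  shows "{(x, \<Lambda>). \<Lambda> \<in> unimodular_lattices \<and>
    (\<exists>v\<in>\<Lambda>. v \<noteq> 0 \<and> norm ((diag_flow t ** shear x) *v v) < \<rho>)} \<in> sets (lborel \<Otimes>\<^sub>M M)" (is "?V \<in> _")
proof -
  define O' where "O' x r = {\<Lambda> \<in> unimodular_lattices. \<exists>v\<in>\<Lambda>. v \<noteq> 0 \<and> norm ((diag_flow t ** shear x) *v v) < r}" for x r
  define I where "I x' r = {x. r * (1 + exp (2 * t) * \<bar>x - x'\<bar>) < \<rho>}" for x' r
  have nrm: "norm ((diag_flow t ** shear x) *v v) = norm (diag_flow t *v (shear x *v v))" for x v
    by (simp add: matrix_vector_mul_assoc)
  have eq: "?V = (\<Union>x'\<in>\<rat>. \<Union>r\<in>\<rat>. I x' r \<times> O' x' r)"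
  proof (intro set_eqI iffI)
    fix y assume "y \<in> (\<Union>x'\<in>\<rat>. \<Union>r\<in>\<rat>. I x' r \<times> O' x' r)"
    then obtain x x' r \<Lambda> v where y: "y = (x, \<Lambda>)" "r * (1 + exp (2 * t) * \<bar>x - x'\<bar>) < \<rho>" "\<Lambda> \<in> unimodular_lattices"
      and v: "v \<in> \<Lambda>" "v \<noteq> 0" "norm (diag_flow t *v (shear x' *v v)) < r"
      by (auto simp: I_def O'_def nrm)
    have "norm (diag_flow t *v (shear x *v v))
        \<le> (1 + exp (2 * t) * \<bar>x - x'\<bar>) * norm (diag_flow t *v (shear x' *v v))" by (rule norm_flow_shear_le)
    also have "\<dots> \<le> (1 + exp (2 * t) * \<bar>x - x'\<bar>) * r" using v by (intro mult_left_mono) auto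
    also have "\<dots> < \<rho>" using y(2) by (simp add: mult.commute)
    finally show "y \<in> ?V" using y v by (auto simp: nrm)
  next
    fix y assume "y \<in> ?V"
    then obtain x \<Lambda> v where y: "y = (x, \<Lambda>)" "\<Lambda> \<in> unimodular_lattices"
      and v: "v \<in> \<Lambda>" "v \<noteq> 0" "norm (diag_flow t *v (shear x *v v)) < \<rho>"
      by (auto simp: nrm)
    define n where "n = norm (diag_flow t *v (shear x *v v))"
    have n0: "n \<ge> 0" by (simp add: n_def)
    obtain r where r: "r \<in> \<rat>" "n < r" "r < \<rho>" using Rats_dense_in_real[of n \<rho>] v(3) by (auto simp: n_def)
    \<comment> \<open>The relative error is chosen so that both \<open>r * (1 + e) < \<rho>\<close>
      and \<open>n * (1 + e) < r\<close>.\<close>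
    define e where "e = min ((\<rho> - r) / (2 * r)) ((r - n) / (2 * r))"
    have r0: "r > 0" using n0 r by linarith
    have e0: "e > 0" using r r0 by (simp add: e_def)
    have "e * r \<le> (\<rho> - r) / (2 * r) * r" "e * r \<le> (r - n) / (2 * r) * r"
      using r0 unfolding e_def by (intro mult_right_mono; simp)+
    then have er: "e * r \<le> (\<rho> - r) / 2" "e * r \<le> (r - n) / 2" using r0 by simp_all
    define d where "d = e * exp (- 2 * t)"
    have d0: "d > 0" using e0 by (simp add: d_def)
    obtain x' where x': "x' \<in> \<rat>" "x < x'" "x' < x + d" using Rats_dense_in_real[of x "x + d"] d0 by auto
    have "exp (2 * t) * \<bar>x - x'\<bar> \<le> exp (2 * t) * d" using x' by (intro mult_left_mono) auto
    also have "exp (2 * t) * d = e" by (simp add: d_def flip: exp_add)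
    finally have c: "exp (2 * t) * \<bar>x - x'\<bar> \<le> e" .
    have "r * (1 + exp (2 * t) * \<bar>x - x'\<bar>) \<le> r * (1 + e)" using c r0 by (intro mult_left_mono) auto
    also have "\<dots> = r + e * r" by (simp add: algebra_simps)
    also have "\<dots> < \<rho>" using er(1) r(3) by simp
    finally have 1: "x \<in> I x' r" by (simp add: I_def)
    have "norm (diag_flow t *v (shear x' *v v)) \<le> (1 + exp (2 * t) * \<bar>x' - x\<bar>) * n"
      unfolding n_def by (rule norm_flow_shear_le)
    also have "\<dots> \<le> (1 + e) * n" using c n0 by (intro mult_right_mono) (auto simp: abs_minus_commute)
    also have "\<dots> = n + e * n" by (simp add: algebra_simps)
    also have "e * n \<le> e * r" using r(2) e0 by (intro mult_left_mono) auto
    also have "n + e * r < r" using er(2) r(2) by simp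
    finally have "\<Lambda> \<in> O' x' r" using y v by (auto simp: O'_def nrm)
    with 1 x'(1) r(1) show "y \<in> (\<Union>x'\<in>\<rat>. \<Union>r\<in>\<rat>. I x' r \<times> O' x' r)" using y(1) by blast
  qed
  have "I x' r \<times> O' x' r \<in> sets (lborel \<Otimes>\<^sub>M M)" for x' r
  proof (rule pair_measureI)
    have "open (I x' r)" unfolding I_def by (intro open_Collect_less continuous_intros)
    then show "I x' r \<in> sets lborel" by simp
    show "O' x' r \<in> sets M" unfolding O'_def
      by (intro sets_haar_measure_openin[OF M] openin_short_vector_lattices)
  qed
  then show ?thesis unfolding eq by (intro sets.countable_UN''[OF countable_rat])
qed

lemma sets_sheared_T_set:
  assumes M: "is_haar_measure M" and f: "continuous_on {0<..} f"
  shows "{(x, \<Lambda>). \<Lambda> \<in> unimodular_lattices \<and> act (shear x) \<Lambda> \<in> T_set f} \<in> sets (lborel \<Otimes>\<^sub>M M)"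
proof -
  let ?P = "lborel \<Otimes>\<^sub>M M"
  define V where "V t \<rho> = {(x, \<Lambda>). \<Lambda> \<in> unimodular_lattices \<and>
    (\<exists>v\<in>\<Lambda>. v \<noteq> 0 \<and> norm ((diag_flow t ** shear x) *v v) < \<rho>)}" for t \<rho>
  have V: "V t \<rho> \<in> sets ?P" for t \<rho> unfolding V_def by (rule sets_short_after_shear[OF M])
  have sp: "space ?P = UNIV \<times> unimodular_lattices"
    using M by (simp add: space_pair_measure is_haar_measure_def)
  have "{(x, \<Lambda>). \<Lambda> \<in> unimodular_lattices \<and> act (shear x) \<Lambda> \<in> T_set f}
    = (\<Inter>n :: nat. \<Union>m :: nat. \<Inter>k :: nat. \<Union>t \<in> \<rat> \<inter> {real n + 1..real n + 2 + real m}.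
        space ?P - V t ((f t - 1 / (real k + 1)) / sqrt \<Delta>))" (is "?L = ?R")
  proof (intro set_eqI)
    fix y :: "real \<times> (real^2) set"
    obtain x \<Lambda> where y: "y = (x, \<Lambda>)" by (cases y)
    show "y \<in> ?L \<longleftrightarrow> y \<in> ?R"
    proof (cases "\<Lambda> \<in> unimodular_lattices")
      case True
      then show ?thesis using T_set_iff_rational[OF f True, of x] by (simp add: y sp V_def)
    next
      case False
      then show ?thesis by (simp add: y sp)
    qed
  qed
  moreover have "?R \<in> sets ?P"
  proof -
    have "space ?P - V t r \<in> sets ?P" for t r by (rule sets.compl_sets[OF V])
    moreover have "countable (\<rat> \<inter> X :: real set)" for X by (rule countable_Int1[OF countable_rat])
    ultimately show ?thesis
      by (intro sets.countable_INT'[OF countableI_type] sets.countable_UN'[OF countableI_type]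
          sets.countable_UN' UNIV_not_empty image_subsetI)
  qed
  ultimately show ?thesis by simp
qed

text \<open>Fubini exchanges "for every lattice, almost every shear" for "for almost every shear,
  almost every lattice". A single such shear suffices, since it carries a set of full measure onto
  \<open>A\<close> and preserves \<open>M\<close>. The section at shear 0 is \<open>A\<close>
  itself, whence its measurability.\<close>

lemma emeasure_eq_if_ae_shear:
  assumes M: "is_haar_measure M"
    and A: "A \<subseteq> unimodular_lattices"
    and meas: "{(x, \<Lambda>). \<Lambda> \<in> unimodular_lattices \<and> act (shear x) \<Lambda> \<in> A} \<in> sets (lborel \<Otimes>\<^sub>M M)"
    and ae: "\<And>\<Lambda>. \<Lambda> \<in> unimodular_lattices \<Longrightarrow> AE x in lborel. act (shear x) \<Lambda> \<in> A"
  shows "A \<in> sets M" and "emeasure M A = 1"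
proof -
  interpret M: prob_space M using M by (simp add: is_haar_measure_def)
  have spM: "space M = unimodular_lattices" using M by (simp add: is_haar_measure_def)
  interpret pair_sigma_finite lborel M ..
  let ?S = "{(x, \<Lambda>). \<Lambda> \<in> unimodular_lattices \<and> act (shear x) \<Lambda> \<in> A}"
  have sec: "{\<Lambda> \<in> unimodular_lattices. act (shear x) \<Lambda> \<in> A} \<in> sets M" for x
    using sets_Pair1[OF meas, of x] by (simp add: vimage_def)
  have "{\<Lambda> \<in> unimodular_lattices. act (shear 0) \<Lambda> \<in> A} = A" using A by (auto simp: act_shear_0)
  with sec[of 0] show "A \<in> sets M" by simp
  have S: "{x \<in> space (lborel \<Otimes>\<^sub>M M). act (shear (fst x)) (snd x) \<in> A} = ?S"
    by (auto simp: space_pair_measure spM)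
  have "AE \<Lambda> in M. AE x in lborel. act (shear x) \<Lambda> \<in> A"
    by (rule AE_I2) (simp add: spM ae)
  then have "AE x in lborel. AE \<Lambda> in M. act (shear x) \<Lambda> \<in> A"
    using AE_commute[of "\<lambda>x \<Lambda>. act (shear x) \<Lambda> \<in> A"] meas unfolding S by simp
  moreover have "ae_filter (lborel :: real measure) \<noteq> bot"
    by (simp add: trivial_limit_def AE_iff_null null_sets_def)
  ultimately obtain x where x: "AE \<Lambda> in M. act (shear x) \<Lambda> \<in> A"
    using eventually_happens by blast
  define B where "B = {\<Lambda> \<in> unimodular_lattices. act (shear x) \<Lambda> \<in> A}"
  have B: "B \<in> sets M" unfolding B_def by (rule sec)
  have "AE \<Lambda> in M. \<Lambda> \<in> B" using x AE_space by eventually_elim (simp add: B_def spM)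
  then have "emeasure M B = 1" using M.emeasure_eq_1_AE[OF B] by simp
  moreover have "act (shear x) ` B = A"
  proof
    show "act (shear x) ` B \<subseteq> A" by (auto simp: B_def)
    show "A \<subseteq> act (shear x) ` B"
    proof
      fix \<Lambda> assume "\<Lambda> \<in> A"
      then have "act (shear (- x)) \<Lambda> \<in> B" "\<Lambda> = act (shear x) (act (shear (- x)) \<Lambda>)"
        using A by (auto simp: B_def act_shear_shear act_shear_0 intro!: act_in_unimodular_lattices shear_in_SL2)
      then show "\<Lambda> \<in> act (shear x) ` B" by blast
    qed
  qed
  ultimately show "emeasure M A = 1"
    using M B shear_in_SL2[of x] unfolding is_haar_measure_def by metis
qed

theorem theorem5p4:
  fixes f :: "real \<Rightarrow> real" and M :: "(real^2) set measure" and t0 :: real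
  assumes "is_haar_measure M"
    and "continuous_on {0<..} f"
    and "mono_on {0<..} f"
    and "\<And>t. t > 0 \<Longrightarrow> f t < 1"
    and "t0 > 0"
  shows "(\<not> (\<lambda>t. 1 - f t) integrable_on {t0..} \<longrightarrow> emeasure M (T_set f) = 1) \<and>
         ((\<lambda>t. 1 - f t) integrable_on {t0..} \<longrightarrow> T_set f \<in> null_sets M)"
proof -
  interpret M: prob_space M using assms(1) by (simp add: is_haar_measure_def)
  have spM: "space M = unimodular_lattices" using assms(1) by (simp add: is_haar_measure_def)
  have T: "T_set f \<subseteq> unimodular_lattices" by (auto simp: T_set_def)
  let ?S = "{(x, \<Lambda>). \<Lambda> \<in> unimodular_lattices \<and> act (shear x) \<Lambda> \<in> T_set f}"
  note S = sets_sheared_T_set[OF assms(1,2)]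
  have basis: "\<exists>g. g \<in> SL2 \<and> \<Lambda> = act g int_lattice \<and> g $ 1 $ 1 * g $ 2 $ 2 - g $ 1 $ 2 * g $ 2 $ 1 = 1"
    if "\<Lambda> \<in> unimodular_lattices" for \<Lambda>
    using that unfolding unimodular_lattices_eq_orbit by (auto simp: SL2_def det_2)
  show ?thesis
  proof (intro conjI impI)
    assume div: "\<not> (\<lambda>t. 1 - f t) integrable_on {t0..}"
    show "emeasure M (T_set f) = 1"
    proof (rule emeasure_eq_if_ae_shear(2)[OF assms(1) T S])
      fix \<Lambda> assume \<Lambda>: "\<Lambda> \<in> unimodular_lattices"
      then obtain g where g: "g \<in> SL2" "\<Lambda> = act g int_lattice" "g $ 1 $ 1 * g $ 2 $ 2 - g $ 1 $ 2 * g $ 2 $ 1 = 1"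
        using basis by blast
      have "{x. act (shear x) \<Lambda> \<in> T_set f} \<in> sets lborel"
        using sets_Pair2[OF S, of \<Lambda>] \<Lambda> by (simp add: vimage_def)
      then have m: "{x. \<not> bounded (returns f (g $ 1 $ 1) (g $ 2 $ 1) (g $ 1 $ 2) (g $ 2 $ 2) x)} \<in> sets lborel"
        by (simp only: g(2) sheared_in_T_set_iff[OF g(1)])
      show "AE x in lborel. act (shear x) \<Lambda> \<in> T_set f"
        unfolding g(2) sheared_in_T_set_iff[OF g(1)]
        by (rule AE_returns_unbounded[OF g(3) assms(2,3,4,5) div m])
    qed
  next
    assume conv: "(\<lambda>t. 1 - f t) integrable_on {t0..}"
    \<comment> \<open>In the convergence case almost no shear lies in \<open>T_set f\<close>, so the
      transfer from shears to lattices is applied to the complement.\<close>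
    define A where "A = unimodular_lattices - T_set f"
    have SA: "{(x, \<Lambda>). \<Lambda> \<in> unimodular_lattices \<and> act (shear x) \<Lambda> \<in> A} \<in> sets (lborel \<Otimes>\<^sub>M M)"
    proof -
      have "{(x, \<Lambda>). \<Lambda> \<in> unimodular_lattices \<and> act (shear x) \<Lambda> \<in> A} = space (lborel \<Otimes>\<^sub>M M) - ?S"
        by (auto simp: space_pair_measure spM A_def act_in_unimodular_lattices shear_in_SL2)
      then show ?thesis using sets.compl_sets[OF S] by (simp only:)
    qed
    have ae: "AE x in lborel. act (shear x) \<Lambda> \<in> A" if \<Lambda>: "\<Lambda> \<in> unimodular_lattices" for \<Lambda>
    proof -
      obtain g where g: "g \<in> SL2" "\<Lambda> = act g int_lattice" "g $ 1 $ 1 * g $ 2 $ 2 - g $ 1 $ 2 * g $ 2 $ 1 = 1"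
        using basis[OF \<Lambda>] by blast
      have "AE x in lborel. bounded (returns f (g $ 1 $ 1) (g $ 2 $ 1) (g $ 1 $ 2) (g $ 2 $ 2) x)"
        by (rule AE_returns_bounded[OF g(3) assms(3,4,5) conv])
      then show ?thesis
      proof eventually_elim
        case (elim x)
        then have "act (shear x) \<Lambda> \<notin> T_set f" unfolding g(2) sheared_in_T_set_iff[OF g(1)] by simp
        then show ?case using \<Lambda> by (simp add: A_def act_in_unimodular_lattices shear_in_SL2)
      qed
    qed
    have A: "A \<in> sets M" "emeasure M A = 1"
      using emeasure_eq_if_ae_shear[OF assms(1) _ SA ae] by (auto simp: A_def)
    have "T_set f = space M - A" using T by (auto simp: A_def spM)
    moreover have "space M - A \<in> null_sets M"
      using A M.emeasure_space_1 by (intro null_setsI) (auto simp: emeasure_compl)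
    ultimately show "T_set f \<in> null_sets M" by simp
  qed
qed

end
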